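(* Checking whether an $m\times n$ matrix $A$ with entries in $\mathbb{R}\cup\{-\infty\}$, with $m\geq n$, has tropical rank at least $n-k$ reduces to solving $\binom{n}{k}$ mean payoff game problems associated to $m\times(n-k)$ matrices, and can therefore be done in pseudo-polynomial time for a fixed value of $k$.
   Context: Write $[p]=\{1,\dots,p\}$. A square $\ell\times\ell$ matrix $B$ with entries in $\mathbb{R}\cup\{-\infty\}$ is tropically singular if $\max_\sigma\sum_{i\in[\ell]}B_{i\sigma(i)}$ (over all permutations $\sigma$ of $[\ell]$) is attained by at least two permutations or equals $-\infty$, and tropically nonsingular otherwise. The tropical rank of a matrix is the maximal size of a tropically nonsingular square submatrix. The mean payoff game problem associated to an $m\times p$ matrix $B$ with entries in $\mathbb{R}\cup\{-\infty\}$ and no column identically $-\infty$ is: decide whether Player Max has a winning state, i.e. whether $\bar\chi(f)\geq0$, where $$f_j(x)=\min_{i\in[m],\,B_{ij}\neq-\infty}\Bigl(-B_{ij}+\max_{k\in[p],\,k\neq j}(B_{ik}+x_k)\Bigr),\quad j\in[p],$$ is a self-map of $(\mathbb{R}\cup\{-\infty\})^p$ and $\bar\chi(f)=\lim_{N\to\infty}\max_{j\in[p]}f^N_j(0)/N$ (this limit exists in $\mathbb{R}\cup\{-\infty\}$). In the game, at column node $j$ Player Min chooses a row node $i$ with $B_{ij}\neq-\infty$, moves there and receives $B_{ij}$; then Player Max must move to a column node $k\neq j$ and receives $B_{ik}$. (If a matrix has a column identically $-\infty$, its columns are tropically dependent and there is no game to solve for it.) Pseudo-polynomial time refers to matrices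 whose finite entries are integers, and means time polynomial in the dimensions of the matrix and in the maximal absolute value of its finite entries. *)

theory Defs
  imports
    "HOL-Library.Extended_Real"
    "HOL-Analysis.Extended_Real_Limits"
    "HOL-Combinatorics.Permutations"
    "HOL-Computational_Algebra.Polynomial"
    "Jordan_Normal_Form.Matrix"
    "Jordan_Normal_Form.DL_Submatrix"
begin

section \<open>Tropical matrices and tropical rank\<close>

text \<open>Entries in \<open>\<real> \<union> {-\<infinity>}\<close> are extended reals different from \<open>\<infinity>\<close>; tropical
  addition is \<open>max\<close> and tropical multiplication is \<open>+\<close>. Indices start at 0.\<close>

definition trop_mat :: "ereal mat \<Rightarrow> bool" where
  "trop_mat A \<longleftrightarrow> \<infinity> \<notin> elements_mat A"

definition perm_weight :: "ereal mat \<Rightarrow> (nat \<Rightarrow> nat) \<Rightarrow> ereal" where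
  "perm_weight B \<sigma> = (\<Sum>i<dim_row B. B $$ (i, \<sigma> i))"

definition trop_perm :: "ereal mat \<Rightarrow> ereal" where
  "trop_perm B = Max (perm_weight B ` {\<sigma>. \<sigma> permutes {..<dim_row B}})"

definition trop_singular :: "ereal mat \<Rightarrow> bool" where
  "trop_singular B \<longleftrightarrow> trop_perm B = -\<infinity> \<or>
     (\<exists>\<sigma> \<tau>. \<sigma> permutes {..<dim_row B} \<and> \<tau> permutes {..<dim_row B} \<and> \<sigma> \<noteq> \<tau> \<and>
        perm_weight B \<sigma> = trop_perm B \<and> perm_weight B \<tau> = trop_perm B)"

text \<open>The empty matrix is tropically nonsingular, so the set below always contains 0.\<close>

definition trop_rank :: "ereal mat \<Rightarrow> nat" where
  "trop_rank A = Max {l. \<exists>I J. I \<subseteq> {..<dim_row A} \<and> J \<subseteq> {..<dim_col A} \<and>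
     card I = l \<and> card J = l \<and> \<not> trop_singular (submatrix A I J)}"

section \<open>Mean payoff games\<close>

definition neg_inf_column :: "ereal mat \<Rightarrow> bool" where
  "neg_inf_column B \<longleftrightarrow> (\<exists>j<dim_col B. \<forall>i<dim_row B. B $$ (i, j) = -\<infinity>)"

text \<open>If no column is identically \<open>-\<infinity>\<close>, the infimum is over a finite nonempty set, hence a
  minimum. The supremum is a maximum, equal to \<open>-\<infinity>\<close> when there is no column other than \<open>j\<close>.
  The sum \<open>\<infinity> + -\<infinity>\<close> does not occur.\<close>

definition game_map :: "ereal mat \<Rightarrow> ereal vec \<Rightarrow> ereal vec" where
  "game_map B x = vec (dim_col B) (\<lambda>j.
     INF i\<in>{i. i < dim_row B \<and> B $$ (i, j) \<noteq> -\<infinity>}.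
       - B $$ (i, j) + (SUP k\<in>{..<dim_col B} - {j}. B $$ (i, k) + x $ k))"

definition upper_mean_payoff :: "nat \<Rightarrow> (ereal vec \<Rightarrow> ereal vec) \<Rightarrow> ereal" where
  "upper_mean_payoff p f =
     lim (\<lambda>N. (SUP j\<in>{..<p}. (f ^^ N) (0\<^sub>v p) $ j / ereal (real N)))"

definition max_has_winning_state :: "ereal mat \<Rightarrow> bool" where
  "max_has_winning_state B \<longleftrightarrow> upper_mean_payoff (dim_col B) (game_map B) \<ge> 0"

section \<open>A machine model\<close>

text \<open>Structured programs for a random access machine whose memory cells, addressed by integers,
  hold integers. \<open>Const\<close> uses only constants of the program text; \<open>Load x y\<close> and \<open>Store x y\<close>
  are indirect reading and writing; \<open>If\<close> and \<open>While\<close> test whether a cell is positive.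
  Every instruction and every test costs one time unit. As there is no multiplication, one step
  lengthens the numbers in memory by at most one bit over the longest one so far, so that running
  times on this machine and on Turing machines are polynomially related.\<close>

datatype prog =
    Skip
  | Const int int
  | Add int int int
  | Sub int int int
  | Load int int
  | Store int int
  | Seq prog prog
  | If int prog prog
  | While int prog

type_synonym memory = "int \<Rightarrow> int"

text \<open>\<open>run c s t s'\<close>: started in memory \<open>s\<close>, program \<open>c\<close> halts after \<open>t\<close> time units in
  memory \<open>s'\<close>.\<close>

inductive run :: "prog \<Rightarrow> memory \<Rightarrow> nat \<Rightarrow> memory \<Rightarrow> bool" where
  Skip: "run Skip s 1 s"
| Const: "run (Const x c) s 1 (s(x := c))"
| Add: "run (Add x y z) s 1 (s(x := s y + s z))"
| Sub: "run (Sub x y z) s 1 (s(x := s y - s z))"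
| Load: "run (Load x y) s 1 (s(x := s (s y)))"
| Store: "run (Store x y) s 1 (s(s x := s y))"
| Seq: "run c1 s t1 s1 \<Longrightarrow> run c2 s1 t2 s2 \<Longrightarrow> run (Seq c1 c2) s (t1 + t2) s2"
| IfTrue: "s x > 0 \<Longrightarrow> run c1 s t s' \<Longrightarrow> run (If x c1 c2) s (t + 1) s'"
| IfFalse: "\<not> s x > 0 \<Longrightarrow> run c2 s t s' \<Longrightarrow> run (If x c1 c2) s (t + 1) s'"
| WhileFalse: "\<not> s x > 0 \<Longrightarrow> run (While x c) s 1 s"
| WhileTrue: "s x > 0 \<Longrightarrow> run c s t1 s1 \<Longrightarrow> run (While x c) s1 t2 s2 \<Longrightarrow>
    run (While x c) s (t1 + t2 + 1) s2"

inductive_cases run_cases: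
  "run Skip s t s'" "run (Const x c) s t s'" "run (Add x y z) s t s'" "run (Sub x y z) s t s'"
  "run (Load x y) s t s'" "run (Store x y) s t s'" "run (Seq c1 c2) s t s'"
  "run (If x c1 c2) s t s'" "run (While x c) s t s'"

lemma run_deterministic: "run c s t s' \<Longrightarrow> run c s u s'' \<Longrightarrow> t = u \<and> s' = s''"
proof (induction arbitrary: u s'' rule: run.induct)
  case (Seq c1 s t1 s1 c2 t2 s2)
  from Seq.prems show ?case by (rule run_cases(7)) (metis Seq.IH)
next
  case (IfTrue s x c1 t s' c2)
  from IfTrue.prems show ?case by (rule run_cases(8)) (use IfTrue.IH IfTrue.hyps(1) in auto)
next
  case (IfFalse s x c2 t s' c1)
  from IfFalse.prems show ?case by (rule run_cases(8)) (use IfFalse.IH IfFalse.hyps(1) in auto)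
next
  case (WhileFalse s x c)
  from WhileFalse.prems show ?case by (rule run_cases(9)) (use WhileFalse.hyps in auto)
next
  case (WhileTrue s x c t1 s1 t2 s2)
  from WhileTrue.prems show ?case by (rule run_cases(9)) (use WhileTrue.hyps(1) in simp, metis WhileTrue.IH Suc_eq_plus1)
qed (auto elim: run_cases(1-6))

section \<open>Pseudo-polynomial time\<close>

definition int_trop_mat :: "ereal mat \<Rightarrow> bool" where
  "int_trop_mat A \<longleftrightarrow> (\<forall>a\<in>elements_mat A. a = -\<infinity> \<or> (\<exists>z::int. a = ereal (of_int z)))"

text \<open>For \<open>a = -\<infinity>\<close> the value \<open>real_of_ereal a\<close> is 0, so these entries do not contribute.\<close>

definition max_abs_entry :: "ereal mat \<Rightarrow> nat" where
  "max_abs_entry A = Max (insert 0 ((\<lambda>a. nat \<lfloor>\<bar>real_of_ereal a\<bar>\<rfloor>) ` elements_mat A))"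

text \<open>Cells 0 and 1 hold the dimensions. From cell 2 on, each entry occupies two cells, in row-major
  order: a flag that is 1 for finite entries and 0 for \<open>-\<infinity>\<close>, followed by the value (0 for
  \<open>-\<infinity>\<close>). All other cells are 0.\<close>

definition encode_mat :: "ereal mat \<Rightarrow> memory" where
  "encode_mat A a =
    (if a = 0 then int (dim_row A)
     else if a = 1 then int (dim_col A)
     else if 2 \<le> a \<and> a < 2 + 2 * int (dim_row A) * int (dim_col A) then
       (let q = nat ((a - 2) div 2); e = A $$ (q div dim_col A, q mod dim_col A)
        in if even a then (if e = -\<infinity> then 0 else 1) else \<lfloor>real_of_ereal e\<rfloor>)
     else 0)"

text \<open>Deciding \<open>P\<close> on the integer matrices of the class \<open>D\<close>; the answer is left in cell 0.
  Being bounded by a polynomial in the number of rows, the number of columns and the maximal absolute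
  value amounts to being bounded by a univariate polynomial in their sum.\<close>

definition pseudo_poly_time_decidable :: "ereal mat set \<Rightarrow> (ereal mat \<Rightarrow> bool) \<Rightarrow> bool" where
  "pseudo_poly_time_decidable D P \<longleftrightarrow>
    (\<exists>c (b :: nat poly). \<forall>A\<in>D. int_trop_mat A \<longrightarrow>
       (\<exists>t s. run c (encode_mat A) t s \<and>
          t \<le> poly b (dim_row A + dim_col A + max_abs_entry A) \<and>
          s 0 = (if P A then 1 else 0)))"

end

theory Submission
  imports Defs
begin

text \<open>Call a set \<open>J\<close> of columns of \<open>A\<close> dependent if there is a vector \<open>x\<close>, not identically \<open>-\<infinity>\<close> and
supported in \<open>J\<close>, such that in every row the maximum of \<open>A\<^sub>i\<^sub>j + x\<^sub>j\<close> is \<open>-\<infinity>\<close> or attained twice.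
For the game map \<open>f\<close> of the submatrix with columns \<open>J\<close> this says \<open>x \<le> f x\<close>.
Everything rests on one alternative, \<open>not_dependent_dominates\<close>: if \<open>J\<close> is not dependent, there are a
choice \<open>\<sigma>\<close> of one row for each column and a real potential \<open>y\<close> such that, after adding \<open>y\<^sub>k\<close> to each
column \<open>k\<close>, row \<open>\<sigma> j\<close> has its strict maximum in column \<open>j\<close>. The choice \<open>\<sigma>\<close> is a positional winning
strategy of Min. It exists because, if Max could answer every \<open>\<sigma>\<close> by a vector \<open>x\<close> for the game with
\<open>\<sigma>\<close> fixed, these vectors could be glued along maxima to one vector for the full game
(\<open>min_positional_determinacy\<close>). Once \<open>\<sigma>\<close> is fixed, the potential \<open>y\<close> comes from Fourier--Motzkin
elimination (\<open>arc_system_alternative\<close>).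

Rank. Strict maxima in different columns force \<open>\<sigma>\<close> to be injective, and in the square submatrix with
rows \<open>\<sigma> ` J\<close> every permutation other than \<open>\<sigma>\<close> then has strictly smaller weight, so this submatrix is
nonsingular. Conversely, a dependence of the columns of a square matrix moves an optimal permutation
along cycles to a different one whose weight is at least as large. Hence the rank is at least \<open>l\<close>
if and only if some \<open>l\<close> columns are independent (\<open>trop_rank_ge_iff\<close>).

Games. The numbers \<open>max\<^sub>j f\<^sup>N\<^sub>j(0)\<close> are subadditive in \<open>N\<close>, so the mean payoff exists and is the infimum of
the averages. A vector with \<open>x \<le> f x\<close> keeps all of them nonnegative, whereas \<open>y\<close> satisfies
\<open>f y \<le> y - e\<close> for some \<open>e > 0\<close> and drives them below zero (\<open>winning_iff_dependent\<close>).

Complexity. For integer entries, dependence of \<open>J\<close> is decided by a descent: all columns of \<open>J\<close> start at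
a common level \<open>K\<close>, all others at 0, and a positive column is lowered by 1 whenever some row violates
the condition \<open>x \<le> f x\<close> there. Integer solutions have bounded gaps, hence fit below \<open>K\<close> for
a \<open>K\<close> of pseudo-polynomial size, and the descent never undercuts a solution. So a positive column
survives if and only if \<open>J\<close> is dependent (\<open>descent_decides_dependence\<close>). The program runs this
descent inside \<open>k\<close> nested loops over the deleted columns.\<close>

section \<open>Difference constraints and positional strategies\<close>

lemma finite_separation:
  fixes L U :: "real set"
  assumes "finite L" "finite U" and "\<And>l u. l \<in> L \<Longrightarrow> u \<in> U \<Longrightarrow> l < u"
  shows "\<exists>z. (\<forall>l\<in>L. l < z) \<and> (\<forall>u\<in>U. z < u)"
proof (cases "L = {}")
  case True
  have "\<exists>z. \<forall>u\<in>U. z < u"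
    using assms(2) by (metis Min_le lt_ex order_less_le_trans)
  then obtain z where "\<forall>u\<in>U. z < u" by blast
  with True show ?thesis by auto
next
  case L: False
  show ?thesis
  proof (cases "U = {}")
    case True
    then show ?thesis by (metis L assms(1) Max_ge gt_ex empty_iff order_le_less_trans)
  next
    case False
    have "Max L < Min U" using assms L False by simp
    then obtain z where "Max L < z" "z < Min U" using dense by blast
    then show ?thesis
      using assms L False by (intro exI[of _ z]) (metis Max_ge Min_le order_le_less_trans order_less_le_trans)
  qed
qed

text \<open>A triple \<open>(j, c, k)\<close> is an arc from \<open>j\<close> to \<open>k\<close> of weight \<open>c\<close>. The second alternative says that \<open>y\<close>
certifies that all cycles have negative weight, the first one that Max can move around forever
without a loss. The proof is Fourier--Motzkin elimination of one vertex \<open>v\<close>: every pair of an arc into \<open>v\<close>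
and an arc out of \<open>v\<close> is replaced by its concatenation. Multiple arcs between two vertices are
allowed, so that no maximum over parallel arcs has to be taken.\<close>

theorem arc_system_alternative:
  fixes T :: "(nat \<times> real \<times> nat) set"
  assumes "finite V" "finite T" "T \<subseteq> V \<times> UNIV \<times> V"
  shows "(\<exists>S x. S \<noteq> {} \<and> S \<subseteq> V \<and> (\<forall>j\<in>S. \<exists>c k. (j, c, k) \<in> T \<and> k \<in> S \<and> x j \<le> c + x k))
       \<or> (\<exists>y. \<forall>j c k. (j, c, k) \<in> T \<longrightarrow> c + y k < (y j :: real))"
  using assms
proof (induction V arbitrary: T rule: finite_induct)
  case empty
  then have "T = {}" by auto
  then show ?case by simp
next
  case (insert v V T)
  show ?case
  proof (cases "\<exists>c\<ge>0. (v, c, v) \<in> T")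
    case True
    then obtain c where "c \<ge> 0" "(v, c, v) \<in> T" by blast
    then show ?thesis by (intro disjI1 exI[of _ "{v}"] exI[of _ "\<lambda>_. 0"]) auto
  next
    case noloop: False
    \<comment> \<open>Together these are the arcs that remain after the elimination of v.\<close>
    define T1 where "T1 = {(j, c, k) \<in> T. j \<noteq> v \<and> k \<noteq> v}"
    define T2 where "T2 = {(j, e, k). \<exists>c d. e = c + d \<and> j \<noteq> v \<and> k \<noteq> v \<and> (j, c, v) \<in> T \<and> (v, d, k) \<in> T}"
    have T2_iff: "(j, e, k) \<in> T2 \<longleftrightarrow>
        (\<exists>c d. e = c + d \<and> j \<noteq> v \<and> k \<noteq> v \<and> (j, c, v) \<in> T \<and> (v, d, k) \<in> T)" for j e k
      by (simp add: T2_def)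
    have "finite T1" using insert.prems(1) by (rule rev_finite_subset) (auto simp: T1_def)
    moreover have "T2 \<subseteq> (\<lambda>((j, c, _), (_, d, k)). (j, c + d, k)) ` (T \<times> T)"
    proof
      fix t assume t: "t \<in> T2"
      obtain j e k where [simp]: "t = (j, e, k)" by (cases t)
      obtain c d where "e = c + d" "(j, c, v) \<in> T" "(v, d, k) \<in> T" using t T2_iff by auto
      then show "t \<in> (\<lambda>((j, c, _), (_, d, k)). (j, c + d, k)) ` (T \<times> T)"
        by (intro image_eqI[of _ _ "((j, c, v), (v, d, k))"]) auto
    qed
    then have "finite T2" using insert.prems(1) by (meson finite_SigmaI finite_imageI finite_subset)
    ultimately have fin: "finite (T1 \<union> T2)" by simp
    have mem: "j \<in> insert v V" "k \<in> insert v V" if "(j, c, k) \<in> T" for j c k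
      using insert.prems(2) that by auto
    have "j \<in> V \<and> k \<in> V" if t: "(j, c, k) \<in> T1 \<union> T2" for j c k
    proof (cases "(j, c, k) \<in> T1")
      case True
      then show ?thesis using mem[of j c k] by (simp add: T1_def)
    next
      case False
      then obtain c d where "j \<noteq> v" "k \<noteq> v" "(j, c, v) \<in> T" "(v, d, k) \<in> T"
        using t T2_iff by blast
      then show ?thesis using mem[of j c v] mem[of v d k] by simp
    qed
    note mem' = this
    have sub: "T1 \<union> T2 \<subseteq> V \<times> UNIV \<times> V"
    proof
      fix t assume t: "t \<in> T1 \<union> T2"
      obtain j c k where [simp]: "t = (j, c, k)" by (cases t)
      show "t \<in> V \<times> UNIV \<times> V" using mem'[of j c k] t by simp
    qed
    from insert.IH[OF fin sub] show ?thesis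
    proof (elim disjE exE conjE)
      fix S and x :: "nat \<Rightarrow> real"
      assume X: "S \<noteq> {}" "S \<subseteq> V"
        "\<forall>j\<in>S. \<exists>c k. (j, c, k) \<in> T1 \<union> T2 \<and> k \<in> S \<and> x j \<le> c + x k"
      show ?thesis
      proof (cases "\<forall>j\<in>S. \<exists>c k. (j, c, k) \<in> T1 \<and> k \<in> S \<and> x j \<le> c + x k")
        case True
        then have "\<forall>j\<in>S. \<exists>c k. (j, c, k) \<in> T \<and> k \<in> S \<and> x j \<le> c + x k"
          unfolding T1_def by blast
        then show ?thesis using X(1,2)
          by (intro disjI1 exI[of _ S] exI[of _ x]) auto
      next
        case False
        define H where "H = {(d, k). (v, d, k) \<in> T \<and> k \<in> S}"
        \<comment> \<open>Some concatenation is used, so v joins the support, at the best level that it can guarantee.\<close>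
        define z where "z = Max ((\<lambda>(d, k). d + x k) ` H)"
        have "H \<subseteq> snd ` T" unfolding H_def by force
        then have finH: "finite H" using insert.prems(1) by (meson finite_imageI finite_subset)
        from False X(3) obtain j e k where "j \<in> S" "k \<in> S" "(j, e, k) \<in> T2"
          unfolding Un_iff by meson
        then obtain d where "(v, d, k) \<in> T" "k \<in> S" unfolding T2_iff by blast
        then have neH: "H \<noteq> {}" by (auto simp: H_def)
        have "z \<in> (\<lambda>(d, k). d + x k) ` H" unfolding z_def using finH neH by (intro Max_in) auto
        then obtain d k where dk: "(v, d, k) \<in> T" "k \<in> S" "z = d + x k" by (auto simp: H_def)
        have zge: "d + x k \<le> z" if "(v, d, k) \<in> T" "k \<in> S" for d k
          unfolding z_def using finH that by (intro Max_ge) (auto simp: H_def image_iff)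
        have vS: "v \<notin> S" using X(2) insert.hyps(2) by blast
        define x' where "x' = x(v := z)"
        have "\<exists>c k. (j, c, k) \<in> T \<and> k \<in> insert v S \<and> x' j \<le> c + x' k" if "j \<in> insert v S" for j
        proof (cases "j = v")
          case True
          then show ?thesis using dk vS by (intro exI[of _ d] exI[of _ k]) (auto simp: x'_def)
        next
          case False
          with that have jS: "j \<in> S" by simp
          then obtain e k where e: "(j, e, k) \<in> T1 \<union> T2" "k \<in> S" "x j \<le> e + x k" using X(3) by blast
          show ?thesis
          proof (cases "(j, e, k) \<in> T1")
            case True
            then show ?thesis using e jS vS False
              by (intro exI[of _ e] exI[of _ k]) (auto simp: x'_def T1_def)
          next
            case nT1: False
            then obtain c d where "e = c + d" "(j, c, v) \<in> T" "(v, d, k) \<in> T"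
              using e(1) T2_iff by auto
            then show ?thesis using e zge[of d k] False
              by (intro exI[of _ c] exI[of _ v]) (auto simp: x'_def)
          qed
        qed
        then show ?thesis using X(2) by (intro disjI1 exI[of _ "insert v S"] exI[of _ x']) auto
      qed
    next
      fix y :: "nat \<Rightarrow> real"
      assume Y: "\<forall>j c k. (j, c, k) \<in> T1 \<union> T2 \<longrightarrow> c + y k < y j"
      define L where "L = (\<lambda>(j, d, k). d + y k) ` {(j, d, k) \<in> T. j = v \<and> k \<noteq> v}"
      define U where "U = (\<lambda>(j, c, k). y j - c) ` {(j, c, k) \<in> T. j \<noteq> v \<and> k = v}"
      have "finite L" unfolding L_def
        by (intro finite_imageI, rule finite_subset[OF _ insert.prems(1)]) blast
      moreover have "finite U" unfolding U_def
        by (intro finite_imageI, rule finite_subset[OF _ insert.prems(1)]) blast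
      moreover have "l < u" if lu: "l \<in> L" "u \<in> U" for l u
      proof -
        obtain d k where l: "(v, d, k) \<in> T" "k \<noteq> v" "l = d + y k" using lu(1) by (auto simp: L_def)
        obtain j c where u: "(j, c, v) \<in> T" "j \<noteq> v" "u = y j - c" using lu(2) by (auto simp: U_def)
        have "(j, c + d, k) \<in> T2" unfolding T2_iff using l u by blast
        then have "(c + d) + y k < y j" using Y by blast
        then show ?thesis using l u by simp
      qed
      \<comment> \<open>The concatenated arcs say that each lower bound for y v is below each upper bound.\<close>
      ultimately obtain z where z: "\<forall>l\<in>L. l < z" "\<forall>u\<in>U. z < u"
        using finite_separation[of L U] by blast
      have "c + (y(v := z)) k < (y(v := z)) j" if t: "(j, c, k) \<in> T" for j c k
      proof -
        consider "j = v" "k = v" | "j = v" "k \<noteq> v" | "j \<noteq> v" "k = v" | "j \<noteq> v" "k \<noteq> v" by blast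
        then show ?thesis
        proof cases
          case 1
          then have "c < 0" using noloop t by (meson not_le)
          then show ?thesis using 1 by simp
        next
          case 2 
          then have "c + y k \<in> L" using t by (force simp: L_def)
          then show ?thesis using z 2 by simp
        next
          case 3
          then have "y j - c \<in> U" using t by (force simp: U_def)
          then show ?thesis using z 3 by force
        next
          case 4
          then have "(j, c, k) \<in> T1" using t by (simp add: T1_def)
          then show ?thesis using Y 4 by auto
        qed
      qed
      then show ?thesis by (intro disjI2 exI[of _ "y(v := z)"]) blast
    qed
  qed
qed

text \<open>The vector is \<open>x\<close> on \<open>S\<close> and \<open>-\<infinity>\<close> elsewhere; keeping the support as a set leaves only real
coordinates to compute with. The condition for \<open>j\<close> is \<open>x\<^sub>j \<le> f\<^sub>j(x)\<close> for the game map \<open>f\<close>. As it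
is required of all \<open>j\<close>, it says that no row has a finite maximum that is attained only once.\<close>

definition columns_dependent :: "nat set \<Rightarrow> nat set \<Rightarrow> (nat \<Rightarrow> nat \<Rightarrow> ereal) \<Rightarrow> bool" where
  "columns_dependent I J a \<longleftrightarrow> (\<exists>S (x :: nat \<Rightarrow> real). S \<noteq> {} \<and> S \<subseteq> J \<and>
     (\<forall>j\<in>S. \<forall>i\<in>I. a i j \<noteq> -\<infinity> \<longrightarrow> (\<exists>k\<in>S. k \<noteq> j \<and> a i j + x j \<le> a i k + x k)))"

lemma columns_dependentI:
  fixes x :: "nat \<Rightarrow> real" and a :: "nat \<Rightarrow> nat \<Rightarrow> ereal"
  assumes "S \<noteq> {}" "S \<subseteq> J"
    and "\<And>i j. j \<in> S \<Longrightarrow> i \<in> I \<Longrightarrow> a i j \<noteq> -\<infinity> \<Longrightarrow> \<exists>k\<in>S. k \<noteq> j \<and> a i j + x j \<le> a i k + x k"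
  shows "columns_dependent I J a"
  unfolding columns_dependent_def by (rule exI[of _ S], rule exI[of _ x]) (simp add: assms)

lemma columns_dependentE:
  assumes "columns_dependent I J a"
  obtains S and x :: "nat \<Rightarrow> real" where "S \<noteq> {}" "S \<subseteq> J"
    "\<And>i j. j \<in> S \<Longrightarrow> i \<in> I \<Longrightarrow> a i j \<noteq> -\<infinity> \<Longrightarrow> \<exists>k\<in>S. k \<noteq> j \<and> a i j + x j \<le> a i k + x k"
proof -
  from assms show ?thesis
    unfolding columns_dependent_def
  proof (elim exE conjE)
    fix S and x :: "nat \<Rightarrow> real"
    assume *: "S \<noteq> {}" "S \<subseteq> J"
      "\<forall>j\<in>S. \<forall>i\<in>I. a i j \<noteq> -\<infinity> \<longrightarrow> (\<exists>k\<in>S. k \<noteq> j \<and> a i j + x j \<le> a i k + x k)"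
    show ?thesis by (rule that[OF *(1,2), of x]) (use *(3) in simp)
  qed
qed

text \<open>Here Min may leave column \<open>j\<close> only through the rows in \<open>R j\<close>. Full freedom for Min and a positional
strategy \<open>\<lambda>j. {\<sigma> j}\<close> are the two extreme cases, and one passes from the latter to the former by
freeing one column at a time.\<close>

definition min_restricted_solution ::
    "nat set \<Rightarrow> (nat \<Rightarrow> nat \<Rightarrow> ereal) \<Rightarrow> (nat \<Rightarrow> nat set) \<Rightarrow> nat set \<Rightarrow> (nat \<Rightarrow> real) \<Rightarrow> bool" where
  "min_restricted_solution J a R S x \<longleftrightarrow> S \<noteq> {} \<and> S \<subseteq> J \<and>
     (\<forall>j\<in>S. \<forall>i\<in>R j. \<exists>k\<in>S. k \<noteq> j \<and> a i j + x j \<le> a i k + x k)"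

lemma ereal_add_real_shift:
  fixes a b :: ereal
  assumes "a + ereal x \<le> b + ereal y"
  shows "a + ereal (x - r) \<le> b + ereal (y - r)"
  using assms by (cases a; cases b) auto

text \<open>Suppose that Max has a solution for each single choice of Min at \<open>v\<close>. If one of these solutions avoids \<open>v\<close>,
it does not notice the choice. Otherwise all of them can be shifted to take the value 0 at \<open>v\<close>, and
their pointwise maximum is a solution: the constraints are monotone in the coordinates on the right,
and at \<open>v\<close> each constraint is inherited from the solution for the row in question.\<close>

lemma glue_solutions:
  assumes "finite (R v)" "v \<in> J"
    and "\<And>i. i \<in> R v \<Longrightarrow> \<exists>S x. min_restricted_solution J a (R(v := {i})) S x"
  shows "\<exists>S x. min_restricted_solution J a R S x"
proof (cases "R v = {}")
  case True
  then show ?thesis using assms(2)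
    by (intro exI[of _ "{v}"]) (auto simp: min_restricted_solution_def)
next
  case ne: False
  obtain Sf xf where sol: "\<And>i. i \<in> R v \<Longrightarrow> min_restricted_solution J a (R(v := {i})) (Sf i) (xf i)"
    using assms(3) by metis
  show ?thesis
  proof (cases "\<exists>i\<in>R v. v \<notin> Sf i")
    case True
    then obtain i where i: "i \<in> R v" "v \<notin> Sf i" by blast
    have "min_restricted_solution J a R (Sf i) (xf i)"
      using sol[OF i(1)] i(2) unfolding min_restricted_solution_def
      by (metis fun_upd_other)
    then show ?thesis by blast
  next
    case vin: False
    define h where "h i j = xf i j - xf i v" for i j
    define S where "S = (\<Union>i\<in>R v. Sf i)"
    define x where "x j = Max ((\<lambda>i. h i j) ` {i \<in> R v. j \<in> Sf i})" for j
    have xge: "h i j \<le> x j" if "i \<in> R v" "j \<in> Sf i" for i j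
      unfolding x_def using that assms(1) by (intro Max_ge) auto
    have xin: "\<exists>i\<in>R v. j \<in> Sf i \<and> x j = h i j" if "j \<in> S" for j
    proof -
      have "x j \<in> (\<lambda>i. h i j) ` {i \<in> R v. j \<in> Sf i}"
        unfolding x_def using that assms(1) by (intro Max_in) (auto simp: S_def)
      then show ?thesis by auto
    qed
    have hv: "h i v = 0" for i by (simp add: h_def)
    have sh: "\<exists>k\<in>Sf i. k \<noteq> j \<and> a i' j + h i j \<le> a i' k + h i k"
      if "i \<in> R v" "j \<in> Sf i" "i' \<in> (R(v := {i})) j" for i j i'
      using sol[OF that(1)] that(2,3) unfolding min_restricted_solution_def h_def
      by (metis ereal_add_real_shift)
    have "\<exists>k\<in>S. k \<noteq> j \<and> a i' j + x j \<le> a i' k + x k" if j: "j \<in> S" and i': "i' \<in> R j" for j i'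
    proof -
      obtain i where i: "i \<in> R v" "j \<in> Sf i" "x j = h i j" "i' \<in> (R(v := {i})) j"
      proof (cases "j = v")
        case True
        have "x v = 0" using xin[of v] j True hv by auto
        then show ?thesis using that[of i'] True i' vin hv by auto
      next
        case False
        then show ?thesis using xin[OF j] that i' by auto
      qed
      obtain k where k: "k \<in> Sf i" "k \<noteq> j" "a i' j + h i j \<le> a i' k + h i k"
        using sh[OF i(1,2,4)] by blast
      have "k \<in> S" using k(1) i(1) by (auto simp: S_def)
      moreover have "a i' k + h i k \<le> a i' k + x k" using xge[OF i(1) k(1)] by (simp add: add_left_mono)
      ultimately show ?thesis using k(2,3) unfolding i(3) by (meson order_trans)
    qed
    moreover have "S \<noteq> {}" using ne vin by (auto simp: S_def)
    moreover have "S \<subseteq> J"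
      using sol unfolding S_def min_restricted_solution_def by (meson UN_least)
    ultimately have "min_restricted_solution J a R S x"
      unfolding min_restricted_solution_def by blast
    then show ?thesis by blast
  qed
qed

lemma min_positional_determinacy:
  assumes "finite J" and "\<And>j. j \<in> J \<Longrightarrow> finite (R j)"
    and "\<And>\<sigma>. (\<And>j. j \<in> J \<Longrightarrow> \<sigma> j \<in> R j) \<Longrightarrow> \<exists>S x. min_restricted_solution J a (\<lambda>j. {\<sigma> j}) S x"
  shows "\<exists>S x. min_restricted_solution J a R S x"
proof (cases "\<exists>j\<in>J. R j = {}")
  case True
  then obtain j where "j \<in> J" "R j = {}" by blast
  then show ?thesis by (intro exI[of _ "{j}"]) (auto simp: min_restricted_solution_def)
next
  case False
  \<comment> \<open>Min is free on U and plays \<sigma> elsewhere.\<close>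
  have "\<exists>S x. min_restricted_solution J a (\<lambda>j. if j \<in> U then R j else {\<sigma> j}) S x"
    if "finite U" "U \<subseteq> J" "\<And>j. j \<in> J \<Longrightarrow> \<sigma> j \<in> R j" for U \<sigma>
    using that
  proof (induction U arbitrary: \<sigma> rule: finite_induct)
    case empty
    then show ?case using assms(3) by simp
  next
    case (insert v U)
    show ?case
    proof (rule glue_solutions[of _ v])
      show "finite (if v \<in> insert v U then R v else {\<sigma> v})" using insert.prems assms(2) by auto
      show "v \<in> J" using insert.prems by simp
      fix i assume i: "i \<in> (if v \<in> insert v U then R v else {\<sigma> v})"
      have "(\<lambda>j. if j \<in> insert v U then R j else {\<sigma> j})(v := {i})
          = (\<lambda>j. if j \<in> U then R j else {(\<sigma>(v := i)) j})"
        using insert.hyps(2) by (auto simp: fun_eq_iff)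
      moreover have "\<And>j. j \<in> J \<Longrightarrow> (\<sigma>(v := i)) j \<in> R j" using insert.prems i by auto
      ultimately show "\<exists>S x. min_restricted_solution J a
          ((\<lambda>j. if j \<in> insert v U then R j else {\<sigma> j})(v := {i})) S x"
        using insert.IH[of "\<sigma>(v := i)"] insert.prems by simp
    qed
  qed
  note extend = this
  define \<sigma> where "\<sigma> j = (SOME i. i \<in> R j)" for j
  have "\<sigma> j \<in> R j" if "j \<in> J" for j
    using False that unfolding \<sigma>_def by (simp add: some_in_eq)
  from extend[OF assms(1) order_refl this]
  obtain S x where sol: "min_restricted_solution J a (\<lambda>j. if j \<in> J then R j else {\<sigma> j}) S x"
    by blast
  have "min_restricted_solution J a R S x"
    unfolding min_restricted_solution_def
  proof (intro conjI ballI)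
    show "S \<noteq> {}" "S \<subseteq> J" using sol by (simp_all add: min_restricted_solution_def)
    fix j i assume "j \<in> S" "i \<in> R j"
    then show "\<exists>k\<in>S. k \<noteq> j \<and> a i j + x j \<le> a i k + x k"
      using sol unfolding min_restricted_solution_def by (meson subset_iff)
  qed
  then show ?thesis by blast
qed

text \<open>The certificate of independence: \<open>\<sigma>\<close> is a positional strategy of Min, and \<open>y\<close> shows that every cycle
that Max can then close has negative weight.\<close>

definition dominates :: "nat set \<Rightarrow> nat set \<Rightarrow> (nat \<Rightarrow> nat \<Rightarrow> ereal) \<Rightarrow> (nat \<Rightarrow> nat) \<Rightarrow> (nat \<Rightarrow> real) \<Rightarrow> bool" where
  "dominates I J a \<sigma> y \<longleftrightarrow> (\<forall>j\<in>J. \<sigma> j \<in> I \<and> a (\<sigma> j) j \<noteq> -\<infinity> \<and>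
     (\<forall>k\<in>J. k \<noteq> j \<longrightarrow> a (\<sigma> j) k + y k < a (\<sigma> j) j + y j))"

lemma dominatesD:
  assumes "dominates I J a \<sigma> y" "j \<in> J"
  shows "\<sigma> j \<in> I" "a (\<sigma> j) j \<noteq> -\<infinity>"
    and "\<And>k. k \<in> J \<Longrightarrow> k \<noteq> j \<Longrightarrow> a (\<sigma> j) k + y k < a (\<sigma> j) j + y j"
  using assms by (simp_all add: dominates_def)

text \<open>If two columns \<open>j \<noteq> k\<close> shared a row, Max could move to and fro between them at no cost.\<close>

lemma dominates_inj: "dominates I J a \<sigma> y \<Longrightarrow> inj_on \<sigma> J"
proof (rule inj_onI, rule ccontr)
  fix j k assume dom: "dominates I J a \<sigma> y" and jk: "j \<in> J" "k \<in> J" "\<sigma> j = \<sigma> k" "j \<noteq> k"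
  have "a (\<sigma> j) k + y k < a (\<sigma> j) j + y j" "a (\<sigma> k) j + y j < a (\<sigma> k) k + y k"
    using dominatesD(3)[OF dom, of j k] dominatesD(3)[OF dom, of k j] jk by simp_all
  then show False using jk(3) by simp
qed

text \<open>The coordinate \<open>j\<close> of the support in which \<open>x - y\<close> is largest cannot satisfy its constraint in row \<open>\<sigma> j\<close>.\<close>

lemma dominates_not_dependent:
  assumes "dominates I J a \<sigma> y" "finite J" "\<And>i j. i \<in> I \<Longrightarrow> j \<in> J \<Longrightarrow> a i j \<noteq> \<infinity>"
  shows "\<not> columns_dependent I J a"
proof
  assume "columns_dependent I J a"
  then obtain S and x :: "nat \<Rightarrow> real" where S: "S \<noteq> {}" "S \<subseteq> J" and
    x: "\<And>i j. j \<in> S \<Longrightarrow> i \<in> I \<Longrightarrow> a i j \<noteq> -\<infinity> \<Longrightarrow> \<exists>k\<in>S. k \<noteq> j \<and> a i j + x j \<le> a i k + x k"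
    by (rule columns_dependentE) (rule that)
  have "finite S" using S(2) assms(2) finite_subset by blast
  then have "Max ((\<lambda>k. x k - y k) ` S) \<in> (\<lambda>k. x k - y k) ` S" using S(1) by (intro Max_in) auto
  then obtain j where j: "j \<in> S" "Max ((\<lambda>k. x k - y k) ` S) = x j - y j" by auto
  have jmax: "x k - y k \<le> x j - y j" if "k \<in> S" for k
    unfolding j(2)[symmetric] using \<open>finite S\<close> that by (intro Max_ge) auto
  have dj: "\<sigma> j \<in> I" "a (\<sigma> j) j \<noteq> -\<infinity>" "\<And>k. k \<in> J \<Longrightarrow> k \<noteq> j \<Longrightarrow> a (\<sigma> j) k + y k < a (\<sigma> j) j + y j"
    using dominatesD[OF assms(1), of j] j(1) S(2) by auto
  obtain k where k: "k \<in> S" "k \<noteq> j" "a (\<sigma> j) j + ereal (x j) \<le> a (\<sigma> j) k + ereal (x k)"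
    using x[OF j(1) dj(1,2)] by blast
  have "k \<in> J" "j \<in> J" using k(1) j(1) S(2) by auto
  with dj(3)[OF _ k(2)] dj(2) k(3) jmax[OF k(1)] assms(3)[OF dj(1), of j] assms(3)[OF dj(1), of k]
  show False by (cases "a (\<sigma> j) j"; cases "a (\<sigma> j) k") simp_all
qed

theorem not_dependent_dominates:
  assumes "finite I" "finite J" "\<And>i j. i \<in> I \<Longrightarrow> j \<in> J \<Longrightarrow> a i j \<noteq> \<infinity>" "\<not> columns_dependent I J a"
  shows "\<exists>\<sigma> y. dominates I J a \<sigma> y"
proof -
  define R where "R j = {i \<in> I. a i j \<noteq> -\<infinity>}" for j
  have "columns_dependent I J a" if "min_restricted_solution J a R S x" for S x
    by (rule columns_dependentI[where S = S and x = x])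
       (use that in \<open>auto simp: min_restricted_solution_def R_def\<close>)
  then have "\<nexists>S x. min_restricted_solution J a R S x" using assms(4) by blast
  then have "\<not> (\<forall>\<sigma>. (\<forall>j\<in>J. \<sigma> j \<in> R j) \<longrightarrow> (\<exists>S x. min_restricted_solution J a (\<lambda>j. {\<sigma> j}) S x))"
  proof (rule contrapos_nn)
    assume *: "\<forall>\<sigma>. (\<forall>j\<in>J. \<sigma> j \<in> R j) \<longrightarrow> (\<exists>S x. min_restricted_solution J a (\<lambda>j. {\<sigma> j}) S x)"
    show "\<exists>S x. min_restricted_solution J a R S x"
      using min_positional_determinacy[OF assms(2), of R a] * assms(1) by (simp add: R_def)
  qed
  then obtain \<sigma> where \<sigma>: "\<And>j. j \<in> J \<Longrightarrow> \<sigma> j \<in> R j"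
    and no: "\<nexists>S x. min_restricted_solution J a (\<lambda>j. {\<sigma> j}) S x"
    by auto
  \<comment> \<open>The gain of Max when Min answers column j by row \<sigma> j and Max moves on to k.\<close>
  define w where "w j k = real_of_ereal (a (\<sigma> j) k) - real_of_ereal (a (\<sigma> j) j)" for j k
  define T where "T = (\<lambda>(j, k). (j, w j k, k)) ` {(j, k) \<in> J \<times> J. k \<noteq> j \<and> a (\<sigma> j) k \<noteq> -\<infinity>}"
  have T_iff: "(j, c, k) \<in> T \<longleftrightarrow> j \<in> J \<and> k \<in> J \<and> k \<noteq> j \<and> a (\<sigma> j) k \<noteq> -\<infinity> \<and> c = w j k" for j c k
    by (auto simp: T_def)
  have "finite T" unfolding T_def using assms(2)
    by (intro finite_imageI) (auto intro: finite_subset[of _ "J \<times> J"])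
  moreover have "T \<subseteq> J \<times> UNIV \<times> J" by (auto simp: T_def)
  ultimately have "(\<exists>S x. S \<noteq> {} \<and> S \<subseteq> J \<and> (\<forall>j\<in>S. \<exists>c k. (j, c, k) \<in> T \<and> k \<in> S \<and> x j \<le> c + x k))
      \<or> (\<exists>y. \<forall>j c k. (j, c, k) \<in> T \<longrightarrow> c + y k < (y j :: real))"
    by (rule arc_system_alternative[OF assms(2)])
  then show ?thesis
  proof (elim disjE exE conjE)
    fix S and x :: "nat \<Rightarrow> real"
    assume X: "S \<noteq> {}" "S \<subseteq> J" "\<forall>j\<in>S. \<exists>c k. (j, c, k) \<in> T \<and> k \<in> S \<and> x j \<le> c + x k"
    have "\<exists>k\<in>S. k \<noteq> j \<and> a (\<sigma> j) j + x j \<le> a (\<sigma> j) k + x k" if "j \<in> S" for j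
    proof -
      obtain k where k: "k \<in> S" "j \<in> J" "k \<in> J" "k \<noteq> j" "a (\<sigma> j) k \<noteq> -\<infinity>" "x j \<le> w j k + x k"
        using X(3) \<open>j \<in> S\<close> by (auto simp: T_iff)
      moreover have "a (\<sigma> j) j \<noteq> -\<infinity>" "a (\<sigma> j) j \<noteq> \<infinity>" "a (\<sigma> j) k \<noteq> \<infinity>"
        using \<sigma>[of j] assms(3)[of "\<sigma> j"] k by (auto simp: R_def)
      ultimately show ?thesis
        by (intro bexI[of _ k]; cases "a (\<sigma> j) j"; cases "a (\<sigma> j) k") (auto simp: w_def)
    qed
    then have "min_restricted_solution J a (\<lambda>j. {\<sigma> j}) S x"
      using X by (auto simp: min_restricted_solution_def)
    then show ?thesis using no by blast
  next
    fix y :: "nat \<Rightarrow> real"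
    assume Y: "\<forall>j c k. (j, c, k) \<in> T \<longrightarrow> c + y k < y j"
    have "a (\<sigma> j) k + y k < a (\<sigma> j) j + y j" if "j \<in> J" "k \<in> J" "k \<noteq> j" for j k
    proof (cases "a (\<sigma> j) k = -\<infinity>")
      case True
      then show ?thesis using \<sigma>[OF that(1)] by (cases "a (\<sigma> j) j") (auto simp: R_def)
    next
      case False
      then have "w j k + y k < y j" using Y that by (auto simp: T_iff)
      moreover have "a (\<sigma> j) j \<noteq> -\<infinity>" "a (\<sigma> j) j \<noteq> \<infinity>" "a (\<sigma> j) k \<noteq> \<infinity>"
        using \<sigma>[of j] assms(3)[of "\<sigma> j"] that by (auto simp: R_def)
      ultimately show ?thesis using False
        by (cases "a (\<sigma> j) j"; cases "a (\<sigma> j) k") (auto simp: w_def)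
    qed
    moreover have "\<sigma> j \<in> I \<and> a (\<sigma> j) j \<noteq> -\<infinity>" if "j \<in> J" for j
      using \<sigma>[OF that] by (simp add: R_def)
    ultimately have "dominates I J a \<sigma> y" by (simp add: dominates_def)
    then show ?thesis by blast
  qed
qed

section \<open>Tropical singularity and tropical rank\<close>

lemma columns_dependent_mono:
  assumes "columns_dependent I J a" "I' \<subseteq> I" "J \<subseteq> J'"
  shows "columns_dependent I' J' a"
proof -
  obtain S and x :: "nat \<Rightarrow> real" where S: "S \<noteq> {}" "S \<subseteq> J" and
    x: "\<And>i j. j \<in> S \<Longrightarrow> i \<in> I \<Longrightarrow> a i j \<noteq> -\<infinity> \<Longrightarrow> \<exists>k\<in>S. k \<noteq> j \<and> a i j + ereal (x j) \<le> a i k + ereal (x k)"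
    using assms(1) by (rule columns_dependentE) (rule that)
  show ?thesis
    by (rule columns_dependentI[where S = S and x = x]) (use S x assms(2,3) in auto)
qed

lemma columns_dependent_cong:
  assumes "\<And>i j. i \<in> I \<Longrightarrow> j \<in> J \<Longrightarrow> a i j = b i j"
  shows "columns_dependent I J a \<longleftrightarrow> columns_dependent I J b"
proof -
  have "columns_dependent I J b"
    if dep: "columns_dependent I J a" and ab: "\<And>i j. i \<in> I \<Longrightarrow> j \<in> J \<Longrightarrow> a i j = b i j" for a b
  proof -
    obtain S and x :: "nat \<Rightarrow> real" where S: "S \<noteq> {}" "S \<subseteq> J" and
      x: "\<And>i j. j \<in> S \<Longrightarrow> i \<in> I \<Longrightarrow> a i j \<noteq> -\<infinity> \<Longrightarrow> \<exists>k\<in>S. k \<noteq> j \<and> a i j + ereal (x j) \<le> a i k + ereal (x k)"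
      using dep by (rule columns_dependentE) (rule that)
    show ?thesis
    proof (rule columns_dependentI[OF S, where x = x])
      fix i j assume ij: "j \<in> S" "i \<in> I" "b i j \<noteq> -\<infinity>"
      have ab': "a i k = b i k" if "k \<in> S" for k using ab[of i k] ij(2) that S(2) by auto
      show "\<exists>k\<in>S. k \<noteq> j \<and> b i j + ereal (x j) \<le> b i k + ereal (x k)"
        using x[of j i] ab' ij by auto
    qed
  qed
  then show ?thesis using assms by metis
qed

text \<open>Submatrices renumber their rows and columns; dependence is insensitive to this.\<close>

lemma columns_dependent_reindex:
  assumes "inj_on h J"
  shows "columns_dependent (g ` I) (h ` J) a \<longleftrightarrow> columns_dependent I J (\<lambda>i j. a (g i) (h j))"
proof
  assume "columns_dependent (g ` I) (h ` J) a"
  then obtain S and x :: "nat \<Rightarrow> real" where S: "S \<noteq> {}" "S \<subseteq> h ` J" and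
    x: "\<And>i j. j \<in> S \<Longrightarrow> i \<in> g ` I \<Longrightarrow> a i j \<noteq> -\<infinity> \<Longrightarrow> \<exists>k\<in>S. k \<noteq> j \<and> a i j + ereal (x j) \<le> a i k + ereal (x k)"
    by (rule columns_dependentE) (rule that)
  show "columns_dependent I J (\<lambda>i j. a (g i) (h j))"
  proof (rule columns_dependentI[where S = "{j \<in> J. h j \<in> S}" and x = "\<lambda>j. x (h j)"])
    fix i j assume "j \<in> {j \<in> J. h j \<in> S}" "i \<in> I" "a (g i) (h j) \<noteq> -\<infinity>"
    then obtain k where "k \<in> S" "k \<noteq> h j" "a (g i) (h j) + ereal (x (h j)) \<le> a (g i) k + ereal (x k)"
      using x[of "h j" "g i"] by auto
    moreover from this obtain k' where "k' \<in> J" "k = h k'" using S(2) by auto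
    ultimately show "\<exists>k\<in>{j \<in> J. h j \<in> S}. k \<noteq> j \<and>
        a (g i) (h j) + ereal (x (h j)) \<le> a (g i) (h k) + ereal (x (h k))"
      by (intro bexI[of _ k']) auto
  qed (use S in auto)
next
  assume "columns_dependent I J (\<lambda>i j. a (g i) (h j))"
  then obtain S and x :: "nat \<Rightarrow> real" where S: "S \<noteq> {}" "S \<subseteq> J" and
    x: "\<And>i j. j \<in> S \<Longrightarrow> i \<in> I \<Longrightarrow> a (g i) (h j) \<noteq> -\<infinity> \<Longrightarrow>
      \<exists>k\<in>S. k \<noteq> j \<and> a (g i) (h j) + ereal (x j) \<le> a (g i) (h k) + ereal (x k)"
    by (rule columns_dependentE) (rule that)
  have inv: "inv_into J h (h j) = j" if "j \<in> S" for j
    using assms S(2) that by (auto intro: inv_into_f_f)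
  show "columns_dependent (g ` I) (h ` J) a"
  proof (rule columns_dependentI[where S = "h ` S" and x = "\<lambda>j. x (inv_into J h j)"])
    fix i' j' assume "j' \<in> h ` S" "i' \<in> g ` I" "a i' j' \<noteq> -\<infinity>"
    then obtain i j where ij: "j' = h j" "j \<in> S" "i' = g i" "i \<in> I" "a (g i) (h j) \<noteq> -\<infinity>" by auto
    then obtain k where k: "k \<in> S" "k \<noteq> j" "a (g i) (h j) + ereal (x j) \<le> a (g i) (h k) + ereal (x k)"
      using x[of j i] by auto
    have "h k \<noteq> h j" using inv[OF k(1)] inv[OF ij(2)] k(2) by auto
    then show "\<exists>k\<in>h ` S. k \<noteq> j' \<and>
        a i' j' + ereal (x (inv_into J h j')) \<le> a i' k + ereal (x (inv_into J h k))"
      using k inv[OF k(1)] inv[OF ij(2)] ij by (intro bexI[of _ "h k"]) auto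
  qed (use S in auto)
qed

abbreviation mat_dependent :: "ereal mat \<Rightarrow> nat set \<Rightarrow> bool" where
  "mat_dependent A J \<equiv> columns_dependent {..<dim_row A} J (\<lambda>i j. A $$ (i, j))"

lemma trop_mat_entry: "trop_mat A \<Longrightarrow> i < dim_row A \<Longrightarrow> j < dim_col A \<Longrightarrow> A $$ (i, j) \<noteq> \<infinity>"
  unfolding trop_mat_def elements_mat_def by force

lemma bij_betw_pick: "finite I \<Longrightarrow> bij_betw (pick I) {..<card I} I"
proof -
  assume fin: "finite I"
  have inj: "inj_on (pick I) {..<card I}"
    by (rule inj_onI) (metis lessThan_iff linorder_neqE_nat pick_mono_le less_irrefl)
  moreover have "pick I ` {..<card I} \<subseteq> I" using pick_in_set_le by auto
  ultimately have "pick I ` {..<card I} = I"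
    by (intro card_subset_eq[OF fin]) (simp_all add: card_image)
  then show ?thesis using inj by (simp add: bij_betw_def)
qed

lemma dim_submatrix_subset:
  assumes "I \<subseteq> {..<dim_row A}" "J \<subseteq> {..<dim_col A}"
  shows "dim_row (submatrix A I J) = card I" "dim_col (submatrix A I J) = card J"
    and "dim_row (submatrix A UNIV J) = dim_row A"
    and "\<And>i j. i < card I \<Longrightarrow> j < card J \<Longrightarrow> submatrix A I J $$ (i, j) = A $$ (pick I i, pick J j)"
    and "\<And>i j. i < dim_row A \<Longrightarrow> j < card J \<Longrightarrow> submatrix A UNIV J $$ (i, j) = A $$ (i, pick J j)"
    and "dim_col (submatrix A UNIV J) = card J"
proof -
  have "{i. i < dim_row A \<and> i \<in> I} = I" "{j. j < dim_col A \<and> j \<in> J} = J" using assms by auto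
  then show "dim_row (submatrix A I J) = card I" "dim_col (submatrix A I J) = card J"
    "dim_row (submatrix A UNIV J) = dim_row A" "dim_col (submatrix A UNIV J) = card J"
    "\<And>i j. i < card I \<Longrightarrow> j < card J \<Longrightarrow> submatrix A I J $$ (i, j) = A $$ (pick I i, pick J j)"
    "\<And>i j. i < dim_row A \<Longrightarrow> j < card J \<Longrightarrow> submatrix A UNIV J $$ (i, j) = A $$ (i, pick J j)"
    by (simp_all add: dim_submatrix submatrix_index pick_UNIV)
qed

lemma trop_mat_submatrix:
  assumes "trop_mat A"
  shows "trop_mat (submatrix A I J)"
proof -
  have "submatrix A I J $$ (i, j) \<noteq> \<infinity>"
    if "i < dim_row (submatrix A I J)" "j < dim_col (submatrix A I J)" for i j
    using that trop_mat_entry[OF assms, of "pick I i" "pick J j"] pick_le[of i "dim_row A" I] pick_le[of j "dim_col A" J]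
    by (simp add: dim_submatrix submatrix_index)
  then show ?thesis unfolding trop_mat_def elements_mat_def by force
qed

lemma mat_dependent_submatrix:
  assumes "I \<subseteq> {..<dim_row A}" "J \<subseteq> {..<dim_col A}"
  shows "mat_dependent (submatrix A I J) {..<card J} \<longleftrightarrow> columns_dependent I J (\<lambda>i j. A $$ (i, j))"
    and "mat_dependent (submatrix A UNIV J) {..<card J} \<longleftrightarrow> mat_dependent A J"
proof -
  have fin: "finite I" "finite J" using assms by (auto intro: finite_subset)
  note dims = dim_submatrix_subset[OF assms]
  note bI = bij_betw_pick[OF fin(1)] and bJ = bij_betw_pick[OF fin(2)]
  have "mat_dependent (submatrix A I J) {..<card J} \<longleftrightarrow>
      columns_dependent {..<card I} {..<card J} (\<lambda>i j. A $$ (pick I i, pick J j))"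
    unfolding dims by (rule columns_dependent_cong) (simp add: dims)
  also have "\<dots> \<longleftrightarrow> columns_dependent I J (\<lambda>i j. A $$ (i, j))"
    using columns_dependent_reindex[OF bij_betw_imp_inj_on[OF bJ], of "pick I" "{..<card I}" "\<lambda>i j. A $$ (i, j)"]
      bI bJ by (simp add: bij_betw_def)
  finally show "mat_dependent (submatrix A I J) {..<card J} \<longleftrightarrow> columns_dependent I J (\<lambda>i j. A $$ (i, j))" .
  have "mat_dependent (submatrix A UNIV J) {..<card J} \<longleftrightarrow>
      columns_dependent {..<dim_row A} {..<card J} (\<lambda>i j. A $$ (id i, pick J j))"
    unfolding dims by (rule columns_dependent_cong) (simp add: dims)
  also have "\<dots> \<longleftrightarrow> mat_dependent A J"
    using columns_dependent_reindex[OF bij_betw_imp_inj_on[OF bJ], of id "{..<dim_row A}" "\<lambda>i j. A $$ (i, j)"]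
      bJ by (simp add: bij_betw_def)
  finally show "mat_dependent (submatrix A UNIV J) {..<card J} \<longleftrightarrow> mat_dependent A J" .
qed

text \<open>A nonempty invariant subset of least cardinality: \<open>g\<close> cannot map it to a smaller one. This replaces the search
for a cycle of \<open>g\<close>.\<close>

lemma exists_permuted_subset:
  assumes "finite S" "S \<noteq> {}" "g ` S \<subseteq> S"
  shows "\<exists>C. C \<noteq> {} \<and> C \<subseteq> S \<and> bij_betw g C C"
proof -
  let ?P = "\<lambda>C. C \<noteq> {} \<and> C \<subseteq> S \<and> g ` C \<subseteq> C"
  define C where "C = arg_min card ?P"
  have C: "?P C" "\<And>D. ?P D \<Longrightarrow> card C \<le> card D"
    using arg_min_nat_lemma[of ?P S card] assms unfolding C_def by auto
  have fin: "finite C" using C(1) assms(1) finite_subset by blast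
  have "card C \<le> card (g ` C)" by (rule C(2)) (use C(1) in auto)
  then have "g ` C = C" using C(1) fin by (intro card_subset_eq) (auto simp: card_image_le le_antisym)
  then have "bij_betw g C C" using fin by (simp add: bij_betw_def finite_surj_inj)
  then show ?thesis using C(1) by blast
qed

lemma sum_ereal_real:
  assumes "finite I" "\<And>i. i \<in> I \<Longrightarrow> \<bar>f i\<bar> \<noteq> (\<infinity> :: ereal)"
  shows "sum f I = ereal (\<Sum>i\<in>I. real_of_ereal (f i))"
proof -
  have "sum f I = (\<Sum>i\<in>I. ereal (real_of_ereal (f i)))"
    using assms(2) by (intro sum.cong) (auto simp: ereal_real)
  then show ?thesis by simp
qed

lemma sum_eq_MInf:
  assumes "finite I" "\<And>i. i \<in> I \<Longrightarrow> f i \<noteq> (\<infinity> :: ereal)" 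
  shows "sum f I = -\<infinity> \<longleftrightarrow> (\<exists>i\<in>I. f i = -\<infinity>)" "sum f I \<noteq> \<infinity>"
proof -
  have "(sum f I = -\<infinity> \<longleftrightarrow> (\<exists>i\<in>I. f i = -\<infinity>)) \<and> sum f I \<noteq> \<infinity>"
    using assms by (induction I rule: finite_induct) auto
  then show "sum f I = -\<infinity> \<longleftrightarrow> (\<exists>i\<in>I. f i = -\<infinity>)" "sum f I \<noteq> \<infinity>" by auto
qed

context
  fixes M :: "ereal mat" and l :: nat
  assumes M: "M \<in> carrier_mat l l" "trop_mat M"
begin

lemma perm_entry: "\<sigma> permutes {..<l} \<Longrightarrow> i < l \<Longrightarrow> M $$ (i, \<sigma> i) \<noteq> \<infinity>"
  using M trop_mat_entry[of M i "\<sigma> i"] permutes_in_image[of \<sigma> "{..<l}" i] by auto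

lemma perm_weight_MInf:
  assumes "\<sigma> permutes {..<l}"
  shows "perm_weight M \<sigma> = -\<infinity> \<longleftrightarrow> (\<exists>i<l. M $$ (i, \<sigma> i) = -\<infinity>)"
  using M sum_eq_MInf(1)[of "{..<l}" "\<lambda>i. M $$ (i, \<sigma> i)"] perm_entry[OF assms]
  by (auto simp: perm_weight_def)

lemma perm_weight_real:
  assumes "\<sigma> permutes {..<l}" "perm_weight M \<sigma> \<noteq> -\<infinity>"
  shows "perm_weight M \<sigma> = ereal (\<Sum>i<l. real_of_ereal (M $$ (i, \<sigma> i)))"
proof -
  have "\<bar>M $$ (i, \<sigma> i)\<bar> \<noteq> \<infinity>" if "i < l" for i
    using assms perm_weight_MInf perm_entry[OF assms(1) that] that by auto
  then have "(\<Sum>i<l. M $$ (i, \<sigma> i)) = ereal (\<Sum>i<l. real_of_ereal (M $$ (i, \<sigma> i)))"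
    by (intro sum_ereal_real) auto
  then show ?thesis using M by (simp add: perm_weight_def)
qed

lemma trop_perm_Max:
  shows "\<exists>\<sigma>. \<sigma> permutes {..<l} \<and> perm_weight M \<sigma> = trop_perm M"
    and "\<sigma> permutes {..<l} \<Longrightarrow> perm_weight M \<sigma> \<le> trop_perm M"
proof -
  have fin: "finite {\<sigma>. \<sigma> permutes {..<l}}" by (simp add: finite_permutations)
  have "id \<in> {\<sigma>. \<sigma> permutes {..<l}}" by (simp add: permutes_id)
  then have ne: "{\<sigma>. \<sigma> permutes {..<l}} \<noteq> {}" by blast
  have dim: "dim_row M = l" using M by simp
  have "trop_perm M \<in> perm_weight M ` {\<sigma>. \<sigma> permutes {..<l}}"
    unfolding trop_perm_def dim using fin ne by (intro Max_in) auto
  then show "\<exists>\<sigma>. \<sigma> permutes {..<l} \<and> perm_weight M \<sigma> = trop_perm M" by auto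
  show "\<sigma> permutes {..<l} \<Longrightarrow> perm_weight M \<sigma> \<le> trop_perm M"
    unfolding trop_perm_def dim using fin by (intro Max_ge) auto
qed

text \<open>Let \<open>\<pi>\<close> be an optimal permutation. By dependence, every column \<open>j\<close> in the support has in its row
under \<open>\<pi>\<close> another column \<open>g j\<close> in the support with \<open>M\<^sub>i\<^sub>j + x\<^sub>j \<le> M\<^sub>i\<^sub>k + x\<^sub>k\<close> for \<open>k = g j\<close>. On a subset
permuted by \<open>g\<close>, following \<open>\<pi>\<close> by \<open>g\<close> gives a different permutation, and the terms \<open>x\<close> cancel
in the sum, so its weight is at least that of \<open>\<pi>\<close>.\<close>

lemma dependent_imp_trop_singular:
  assumes "mat_dependent M {..<l}"
  shows "trop_singular M"
proof (cases "trop_perm M = -\<infinity>")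
  case True
  then show ?thesis by (simp add: trop_singular_def)
next
  case False
  obtain \<pi> where \<pi>: "\<pi> permutes {..<l}" "perm_weight M \<pi> = trop_perm M" using trop_perm_Max(1) by blast
  obtain S and x :: "nat \<Rightarrow> real" where S: "S \<noteq> {}" "S \<subseteq> {..<l}" and
    x: "\<And>i j. j \<in> S \<Longrightarrow> i \<in> {..<dim_row M} \<Longrightarrow> M $$ (i, j) \<noteq> -\<infinity> \<Longrightarrow>
      \<exists>k\<in>S. k \<noteq> j \<and> M $$ (i, j) + ereal (x j) \<le> M $$ (i, k) + ereal (x k)"
    using assms by (rule columns_dependentE) (rule that)
  have fin\<pi>: "M $$ (i, \<pi> i) \<noteq> -\<infinity>" if "i < l" for i
    using perm_weight_MInf[OF \<pi>(1)] \<pi>(2) False that by auto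
  let ?row = "inv_into UNIV \<pi>"
  have row: "?row j < l" "\<pi> (?row j) = j" if "j < l" for j
    using \<pi>(1) that permutes_in_image[OF permutes_inv[OF \<pi>(1)], of j] permutes_inverses(1)[OF \<pi>(1)] by auto
  have "\<exists>k\<in>S. k \<noteq> j \<and> M $$ (?row j, j) + ereal (x j) \<le> M $$ (?row j, k) + ereal (x k)" if "j \<in> S" for j
    using x[OF that, of "?row j"] row[of j] fin\<pi>[of "?row j"] that S(2) M by auto
  then obtain g where g: "\<And>j. j \<in> S \<Longrightarrow> g j \<in> S" "\<And>j. j \<in> S \<Longrightarrow> g j \<noteq> j"
    "\<And>j. j \<in> S \<Longrightarrow> M $$ (?row j, j) + ereal (x j) \<le> M $$ (?row j, g j) + ereal (x (g j))"
    by metis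
  have "finite S" "g ` S \<subseteq> S" using S(2) g(1) by (auto intro: finite_subset)
  then obtain C where C: "C \<noteq> {}" "C \<subseteq> S" "bij_betw g C C"
    using exists_permuted_subset[of S g] S(1) by blast
  \<comment> \<open>Outside of C the permutation \<pi> is kept.\<close>
  define h where "h j = (if j \<in> C then g j else j)" for j
  have "bij_betw h C C" using C(3) by (rule bij_betw_cong[THEN iffD1, rotated]) (simp add: h_def)
  then have "h permutes C" by (rule bij_imp_permutes) (simp add: h_def)
  then have h: "h permutes {..<l}" using C(2) S(2) by (auto intro: permutes_subset)
  define \<tau> where "\<tau> = h \<circ> \<pi>"
  have \<tau>: "\<tau> permutes {..<l}" unfolding \<tau>_def by (rule permutes_compose[OF \<pi>(1) h])
  have le: "M $$ (i, \<pi> i) + ereal (x (\<pi> i)) \<le> M $$ (i, \<tau> i) + ereal (x (\<tau> i))" if "i < l" for i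
  proof (cases "\<pi> i \<in> C")
    case True
    then show ?thesis using g(3)[of "\<pi> i"] C(2) permutes_inverses(2)[OF \<pi>(1)] by (auto simp: \<tau>_def h_def)
  qed (simp add: \<tau>_def h_def)
  have fin\<tau>: "M $$ (i, \<tau> i) \<noteq> -\<infinity>" if "i < l" for i
    using le[OF that] fin\<pi>[OF that] by (cases "M $$ (i, \<pi> i)") auto
  have reals: "real_of_ereal (M $$ (i, \<pi> i)) + x (\<pi> i) \<le> real_of_ereal (M $$ (i, \<tau> i)) + x (\<tau> i)"
    if "i < l" for i
    using le[OF that] fin\<tau>[OF that] fin\<pi>[OF that] perm_entry[OF \<pi>(1) that] perm_entry[OF \<tau> that]
    by (cases "M $$ (i, \<pi> i)"; cases "M $$ (i, \<tau> i)") auto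
  have "(\<Sum>i<l. real_of_ereal (M $$ (i, \<pi> i)) + x (\<pi> i)) \<le> (\<Sum>i<l. real_of_ereal (M $$ (i, \<tau> i)) + x (\<tau> i))"
    using reals by (intro sum_mono) auto
  moreover have "(\<Sum>i<l. x (\<pi> i)) = (\<Sum>i<l. x (\<tau> i))"
    using sum.permute[OF \<pi>(1), of x] sum.permute[OF \<tau>, of x] by (simp add: comp_def)
  ultimately have "(\<Sum>i<l. real_of_ereal (M $$ (i, \<pi> i))) \<le> (\<Sum>i<l. real_of_ereal (M $$ (i, \<tau> i)))"
    by (simp add: sum.distrib)
  moreover have "perm_weight M \<tau> \<noteq> -\<infinity>" using perm_weight_MInf[OF \<tau>] fin\<tau> by auto
  ultimately have "perm_weight M \<pi> \<le> perm_weight M \<tau>"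
    using perm_weight_real[OF \<pi>(1)] perm_weight_real[OF \<tau>] \<pi>(2) False by simp
  then have "perm_weight M \<tau> = trop_perm M" using trop_perm_Max(2)[OF \<tau>] \<pi>(2) by simp
  moreover have "\<pi> \<noteq> \<tau>"
  proof -
    obtain j where j: "j \<in> C" using C(1) by blast
    then have "j \<in> S" "j < l" using C(2) S(2) by auto
    then have "\<tau> (?row j) \<noteq> \<pi> (?row j)"
      using row(2)[of j] g(2)[of j] j by (simp add: \<tau>_def h_def)
    then show ?thesis by metis
  qed
  moreover have "dim_row M = l" using M by simp
  ultimately show ?thesis unfolding trop_singular_def using \<pi> \<tau>
    by (intro disjI2 exI[of _ \<pi>] exI[of _ \<tau>]) simp
qed

text \<open>The dominating rows form a permutation. Adding \<open>y\<^sub>j\<close> to each column \<open>j\<close> changes all permutation weights by the same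
amount, and afterwards that permutation picks the strict maximum of each row.\<close>

lemma not_dependent_imp_nonsingular:
  assumes "\<not> mat_dependent M {..<l}"
  shows "\<not> trop_singular M"
proof -
  have dims: "dim_row M = l" "dim_col M = l" using M by auto
  obtain \<rho> y where dom: "dominates {..<l} {..<l} (\<lambda>i j. M $$ (i, j)) \<rho> y"
    using not_dependent_dominates[of "{..<l}" "{..<l}" "\<lambda>i j. M $$ (i, j)"] assms trop_mat_entry[OF M(2)]
    unfolding dims by auto
  \<comment> \<open>The strategy maps columns to rows, whereas permutation weights are indexed by rows; so it is extended
    to a permutation of all numbers and inverted.\<close>
  define p where "p j = (if j < l then \<rho> j else j)" for j
  have "inj_on p {..<l}" using dominates_inj[OF dom] by (auto simp: inj_on_def p_def)
  moreover have "p ` {..<l} \<subseteq> {..<l}" using dominatesD(1)[OF dom] by (auto simp: p_def)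
  ultimately have "bij_betw p {..<l} {..<l}" by (simp add: bij_betw_def endo_inj_surj)
  then have p: "p permutes {..<l}" by (rule bij_imp_permutes) (simp add: p_def)
  define \<pi> where "\<pi> = inv_into UNIV p"
  have \<pi>: "\<pi> permutes {..<l}" unfolding \<pi>_def by (rule permutes_inv[OF p])
  have \<pi>l: "\<pi> i < l" if "i < l" for i using permutes_in_image[OF \<pi>, of i] that by simp
  have p\<pi>: "\<rho> (\<pi> i) = i" if "i < l" for i
    using permutes_inverses(1)[OF p, of i] \<pi>l[OF that] by (simp add: \<pi>_def p_def split: if_splits)
  have fin\<pi>: "M $$ (i, \<pi> i) \<noteq> -\<infinity>" if "i < l" for i
    using dominatesD(2)[OF dom, of "\<pi> i"] \<pi>l[OF that] p\<pi>[OF that] by simp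
  have strict: "M $$ (i, k) + ereal (y k) < M $$ (i, \<pi> i) + ereal (y (\<pi> i))"
    if "i < l" "k < l" "k \<noteq> \<pi> i" for i k
    using dominatesD(3)[OF dom, of "\<pi> i" k] \<pi>l[OF that(1)] p\<pi>[OF that(1)] that by simp
  have w\<pi>: "perm_weight M \<pi> \<noteq> -\<infinity>" using perm_weight_MInf[OF \<pi>] fin\<pi> by auto
  have less: "perm_weight M \<tau> < perm_weight M \<pi>" if \<tau>: "\<tau> permutes {..<l}" "\<tau> \<noteq> \<pi>" for \<tau>
  proof (cases "perm_weight M \<tau> = -\<infinity>")
    case True
    then show ?thesis using w\<pi> by (simp add: less_le)
  next
    case False
    then have fin\<tau>: "M $$ (i, \<tau> i) \<noteq> -\<infinity>" if "i < l" for i using perm_weight_MInf[OF \<tau>(1)] that by auto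
    have \<tau>l: "\<tau> i < l" if "i < l" for i using permutes_in_image[OF \<tau>(1), of i] that by simp
    have lt: "real_of_ereal (M $$ (i, \<tau> i)) + y (\<tau> i) < real_of_ereal (M $$ (i, \<pi> i)) + y (\<pi> i)"
      if "i < l" "\<tau> i \<noteq> \<pi> i" for i
      using strict[OF that(1) \<tau>l[OF that(1)] that(2)] fin\<tau>[OF that(1)] fin\<pi>[OF that(1)]
        perm_entry[OF \<pi> that(1)] perm_entry[OF \<tau>(1) that(1)]
      by (cases "M $$ (i, \<pi> i)"; cases "M $$ (i, \<tau> i)") auto
    have "\<exists>i<l. \<tau> i \<noteq> \<pi> i"
    proof (rule ccontr)
      assume "\<not> ?thesis"
      then have "\<tau> i = \<pi> i" for i
        using permutes_not_in[OF \<tau>(1), of i] permutes_not_in[OF \<pi>, of i] by (cases "i < l") auto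
      then show False using \<tau>(2) by auto
    qed
    then have "(\<Sum>i<l. real_of_ereal (M $$ (i, \<tau> i)) + y (\<tau> i)) < (\<Sum>i<l. real_of_ereal (M $$ (i, \<pi> i)) + y (\<pi> i))"
    proof (intro sum_strict_mono_ex1)
      show "\<forall>i\<in>{..<l}. real_of_ereal (M $$ (i, \<tau> i)) + y (\<tau> i) \<le> real_of_ereal (M $$ (i, \<pi> i)) + y (\<pi> i)"
        using lt by (metis lessThan_iff less_eq_real_def)
    qed (use lt in auto)
    moreover have "(\<Sum>i<l. y (\<pi> i)) = (\<Sum>i<l. y (\<tau> i))"
      using sum.permute[OF \<pi>, of y] sum.permute[OF \<tau>(1), of y] by (simp add: comp_def)
    ultimately show ?thesis
      using perm_weight_real[OF \<pi> w\<pi>] perm_weight_real[OF \<tau>(1) False] by (simp add: sum.distrib)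
  qed
  obtain \<sigma>0 where "\<sigma>0 permutes {..<l}" "perm_weight M \<sigma>0 = trop_perm M" using trop_perm_Max(1) by blast
  then have eq: "perm_weight M \<pi> = trop_perm M"
    using less[of \<sigma>0] trop_perm_Max(2)[OF \<pi>] by (cases "\<sigma>0 = \<pi>") auto
  have only: "\<sigma> = \<pi>" if "\<sigma> permutes {..<l}" "perm_weight M \<sigma> = trop_perm M" for \<sigma>
    using less[OF that(1)] that(2) eq by auto
  show ?thesis
  proof
    assume "trop_singular M"
    then obtain \<sigma> \<tau> where "\<sigma> permutes {..<l}" "\<tau> permutes {..<l}" "\<sigma> \<noteq> \<tau>"
      "perm_weight M \<sigma> = trop_perm M" "perm_weight M \<tau> = trop_perm M"
      using w\<pi> eq dims by (auto simp: trop_singular_def)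
    then show False using only[of \<sigma>] only[of \<tau>] by simp
  qed
qed

end

text \<open>The columns of a nonsingular submatrix, possibly more than \<open>l\<close>, are independent, and so are any \<open>l\<close> of them.
Conversely, the dominating rows for \<open>l\<close> independent columns cut out a nonsingular submatrix.\<close>

theorem trop_rank_ge_iff:
  assumes "trop_mat A"
  shows "l \<le> trop_rank A \<longleftrightarrow> (\<exists>J. J \<subseteq> {..<dim_col A} \<and> card J = l \<and> \<not> mat_dependent A J)"
proof -
  let ?L = "{l. \<exists>I J. I \<subseteq> {..<dim_row A} \<and> J \<subseteq> {..<dim_col A} \<and>
     card I = l \<and> card J = l \<and> \<not> trop_singular (submatrix A I J)}"
  have sub: "submatrix A I J \<in> carrier_mat (card J) (card J)"
    if "I \<subseteq> {..<dim_row A}" "J \<subseteq> {..<dim_col A}" "card I = card J" for I J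
    using dim_submatrix_subset[OF that(1,2)] that(3) by auto
  have "?L \<subseteq> {..dim_row A}"
  proof
    fix l assume "l \<in> ?L"
    then obtain I where "I \<subseteq> {..<dim_row A}" "card I = l" by auto
    then show "l \<in> {..dim_row A}" using card_mono[of "{..<dim_row A}" I] by simp
  qed
  then have fin: "finite ?L" using finite_subset by blast
  have mem: "card J \<in> ?L" if J: "J \<subseteq> {..<dim_col A}" "\<not> mat_dependent A J" for J
  proof -
    have finJ: "finite J" using J(1) finite_subset by blast
    have ent: "A $$ (i, j) \<noteq> \<infinity>" if "i \<in> {..<dim_row A}" "j \<in> J" for i j
      using trop_mat_entry[OF assms, of i j] that J(1) by auto
    obtain \<sigma> y where dom: "dominates {..<dim_row A} J (\<lambda>i j. A $$ (i, j)) \<sigma> y"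
      using not_dependent_dominates[of "{..<dim_row A}" J "\<lambda>i j. A $$ (i, j)"] finJ ent J(2) by auto
    define I where "I = \<sigma> ` J"
    have I: "I \<subseteq> {..<dim_row A}" using dominatesD(1)[OF dom] by (auto simp: I_def)
    have cI: "card I = card J" unfolding I_def by (rule card_image[OF dominates_inj[OF dom]])
    have "dominates I J (\<lambda>i j. A $$ (i, j)) \<sigma> y"
      using dom by (simp add: dominates_def I_def)
    then have "\<not> columns_dependent I J (\<lambda>i j. A $$ (i, j))"
      by (rule dominates_not_dependent) (use finJ ent I in auto)
    then have "\<not> trop_singular (submatrix A I J)"
      using not_dependent_imp_nonsingular[OF sub[OF I J(1) cI] trop_mat_submatrix[OF assms]]
        mat_dependent_submatrix(1)[OF I J(1)] by simp
    then show ?thesis using I J(1) cI by auto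
  qed
  have ne: "?L \<noteq> {}" using mem[of "{}"] by (auto simp: columns_dependent_def)
  show ?thesis
  proof
    assume l: "l \<le> trop_rank A"
    have "trop_rank A \<in> ?L" unfolding trop_rank_def using fin ne by (rule Max_in)
    then obtain I J where IJ: "I \<subseteq> {..<dim_row A}" "J \<subseteq> {..<dim_col A}"
      "card I = trop_rank A" "card J = trop_rank A" "\<not> trop_singular (submatrix A I J)" by blast
    have cIJ: "card I = card J" using IJ(3,4) by simp
    have "\<not> mat_dependent (submatrix A I J) {..<card J}"
      using dependent_imp_trop_singular[OF sub[OF IJ(1,2) cIJ] trop_mat_submatrix[OF assms]] IJ(5) by blast
    then have nd: "\<not> columns_dependent I J (\<lambda>i j. A $$ (i, j))"
      using mat_dependent_submatrix(1)[OF IJ(1,2)] by simp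
    obtain J' where J': "J' \<subseteq> J" "card J' = l"
      using obtain_subset_with_card_n[of l J] l IJ(4) by auto
    have "\<not> mat_dependent A J'" using nd columns_dependent_mono[OF _ IJ(1) J'(1)] by blast
    then show "\<exists>J. J \<subseteq> {..<dim_col A} \<and> card J = l \<and> \<not> mat_dependent A J" using J' IJ(2) by blast
  next
    assume "\<exists>J. J \<subseteq> {..<dim_col A} \<and> card J = l \<and> \<not> mat_dependent A J"
    then have "l \<in> ?L" using mem by blast
    then show "l \<le> trop_rank A" unfolding trop_rank_def using fin by (rule Max_ge[rotated])
  qed
qed

section \<open>The mean payoff of the game\<close>

lemma SUP_finite_less:
  fixes f :: "'b \<Rightarrow> ereal"
  assumes "finite S" "\<And>k. k \<in> S \<Longrightarrow> f k < c" "-\<infinity> < c"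
  shows "(SUP k\<in>S. f k) < c"
  using assms by (induction S rule: finite_induct) (auto simp: bot_ereal_def)

text \<open>Fekete's lemma for sequences that may take the value \<open>-\<infinity>\<close>.\<close>

theorem subadditive_average_converges:
  fixes u :: "nat \<Rightarrow> ereal"
  assumes fin: "\<And>N. u N \<noteq> \<infinity>" and zero: "u 0 \<le> 0" and sub: "\<And>N M. u (N + M) \<le> u N + u M"
  shows "(\<lambda>N. u N / ereal (real N)) \<longlonglongrightarrow> (INF N\<in>{1..}. u N / ereal (real N))"
    (is "_ \<longlonglongrightarrow> ?L")
proof (rule order_tendstoI)
  fix a assume a: "a < ?L"
  have "a < u N / ereal (real N)" if "1 \<le> N" for N
    using a INF_lower[of N "{1..}" "\<lambda>N. u N / ereal (real N)"] that by (auto intro: less_le_trans)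
  then show "\<forall>\<^sub>F N in sequentially. a < u N / ereal (real N)"
    using eventually_sequentially by blast
next
  fix a assume "?L < a"
  then obtain M where M: "1 \<le> M" "u M / ereal (real M) < a" unfolding INF_less_iff by auto
  obtain c where c: "u M / ereal (real M) < ereal c" "ereal c < a" using ereal_dense2[OF M(2)] by blast
  have uM: "u M \<le> ereal (c * real M)"
    using c(1) M(1) by (cases "u M") (auto simp: field_simps)
  have uqM: "u (q * M) \<le> ereal (real q * (c * real M))" for q
  proof (induction q)
    case 0
    then show ?case using zero by (simp add: zero_ereal_def)
  next
    case (Suc q)
    have "u (Suc q * M) \<le> u (q * M) + u M" using sub[of "q * M" M] by (simp add: add.commute)
    also have "\<dots> \<le> ereal (real q * (c * real M)) + ereal (c * real M)" by (rule add_mono[OF Suc uM])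
    finally show ?case by (simp add: algebra_simps)
  qed
  have "\<exists>K\<ge>0. \<forall>s<M'. u s \<le> ereal K" for M'
  proof (induction M')
    case 0
    show ?case by (intro exI[of _ 0]) simp
  next
    case (Suc M')
    then obtain K where K: "K \<ge> 0" "\<forall>s<M'. u s \<le> ereal K" by blast
    obtain K' where K': "u M' \<le> ereal K'" using fin[of M'] by (cases "u M'") auto
    show ?case
    proof (intro exI[of _ "max K K'"] conjI allI impI)
      fix s assume "s < Suc M'"
      then consider "s < M'" | "s = M'" by linarith
      then show "u s \<le> ereal (max K K')"
      proof cases
        case 1
        then have "u s \<le> ereal K" using K by simp
        also have "\<dots> \<le> ereal (max K K')" by simp
        finally show ?thesis .
      next
        case 2
        then have "u s \<le> ereal K'" using K' by simp
        also have "\<dots> \<le> ereal (max K K')" by simp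
        finally show ?thesis .
      qed
    qed (use K in simp)
  qed
  then obtain K where K: "K \<ge> 0" "\<And>s. s < M \<Longrightarrow> u s \<le> ereal K" by blast
  \<comment> \<open>D absorbs the remainder of N modulo M: K bounds u there, and c may be negative.\<close>
  define D where "D = \<bar>c\<bar> * real M + K"
  have bound: "u N \<le> ereal (c * real N + D)" for N
  proof -
    have s: "N mod M < M" using M(1) by simp
    have "N div M * M + N mod M = N" by simp
    then have "u N \<le> u (N div M * M) + u (N mod M)" using sub[of "N div M * M" "N mod M"] by simp
    also have "\<dots> \<le> ereal (real (N div M) * (c * real M)) + ereal K" by (rule add_mono[OF uqM K(2)[OF s]])
    also have "\<dots> = ereal (c * real (N div M * M) + K)" by (simp add: algebra_simps)
    also have "\<dots> \<le> ereal (c * real N + D)"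
    proof -
      have "real (N div M * M) = real N - real (N mod M)"
        by (metis add_diff_cancel_right' div_mult_mod_eq of_nat_add)
      then have "c * real (N div M * M) = c * real N - c * real (N mod M)"
        by (simp only: right_diff_distrib)
      moreover have "- c * real (N mod M) \<le> \<bar>c\<bar> * real M"
        using s by (intro mult_mono) auto
      ultimately show ?thesis by (simp add: D_def)
    qed
    finally show ?thesis .
  qed
  have "(\<lambda>N. c + D / real N) \<longlonglongrightarrow> c + 0"
    by (intro tendsto_add tendsto_const tendsto_divide_0[OF tendsto_const] filterlim_real_sequentially)
       (auto intro: filterlim_at_top_imp_at_infinity filterlim_real_sequentially)
  then have "(\<lambda>N. ereal (c + D / real N)) \<longlonglongrightarrow> ereal c" by simp
  then have "\<forall>\<^sub>F N in sequentially. ereal (c + D / real N) < a" using c(2) by (rule order_tendstoD(2))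
  then show "\<forall>\<^sub>F N in sequentially. u N / ereal (real N) < a"
    using eventually_ge_at_top[of 1]
  proof eventually_elim
    case (elim N)
    have "u N / ereal (real N) \<le> ereal (c * real N + D) / ereal (real N)"
      using bound[of N] by (intro ereal_divide_right_mono) (use elim in auto)
    also have "\<dots> = ereal (c + D / real N)" using elim by (simp add: field_simps)
    finally show ?case using elim by simp
  qed
qed

text \<open>The game map on functions. Unlike vectors these need no dimension bookkeeping under iteration.\<close>

definition game_fun :: "ereal mat \<Rightarrow> (nat \<Rightarrow> ereal) \<Rightarrow> nat \<Rightarrow> ereal" where
  "game_fun B x j = (INF i\<in>{i. i < dim_row B \<and> B $$ (i, j) \<noteq> -\<infinity>}.
     - B $$ (i, j) + (SUP k\<in>{..<dim_col B} - {j}. B $$ (i, k) + x k))"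

definition game_value :: "ereal mat \<Rightarrow> nat \<Rightarrow> nat \<Rightarrow> ereal" where
  "game_value B N = (game_fun B ^^ N) (\<lambda>_. 0)"

lemma game_map_vec: "game_map B (vec (dim_col B) x) = vec (dim_col B) (game_fun B x)"
  unfolding game_map_def game_fun_def
  by (intro eq_vecI) (auto intro!: arg_cong[where f = Inf] image_cong arg_cong2[where f = "(+)"] arg_cong[where f = Sup])

lemma game_map_iterate: "(game_map B ^^ N) (0\<^sub>v (dim_col B)) = vec (dim_col B) (game_value B N)"
proof (induction N)
  case 0
  show ?case by (auto simp: game_value_def)
next
  case (Suc N)
  then show ?case by (simp add: game_map_vec game_value_def)
qed

lemma game_fun_mono:
  assumes "\<And>k. k < dim_col B \<Longrightarrow> x k \<le> x' k"
  shows "game_fun B x j \<le> game_fun B x' j"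
  unfolding game_fun_def
proof (rule INF_mono)
  fix i assume "i \<in> {i. i < dim_row B \<and> B $$ (i, j) \<noteq> -\<infinity>}"
  then show "\<exists>i'\<in>{i. i < dim_row B \<and> B $$ (i, j) \<noteq> -\<infinity>}.
      - B $$ (i', j) + (SUP k\<in>{..<dim_col B} - {j}. B $$ (i', k) + x k) \<le>
      - B $$ (i, j) + (SUP k\<in>{..<dim_col B} - {j}. B $$ (i, k) + x' k)"
    by (intro bexI[of _ i] add_left_mono SUP_subset_mono order_refl) (use assms in auto)
qed

text \<open>Half of additive homogeneity; the other half is the instance for \<open>- c\<close>.\<close>

lemma game_fun_shift:
  "game_fun B (\<lambda>k. x k + ereal c) j \<le> game_fun B x j + ereal c"
proof -
  let ?F = "game_fun B (\<lambda>k. x k + ereal c) j"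
  have "?F - ereal c \<le> game_fun B x j"
    unfolding game_fun_def[of B x]
  proof (rule INF_greatest)
    fix i assume i: "i \<in> {i. i < dim_row B \<and> B $$ (i, j) \<noteq> -\<infinity>}"
    let ?s = "SUP k\<in>{..<dim_col B} - {j}. B $$ (i, k) + x k"
    have "?F \<le> - B $$ (i, j) + (SUP k\<in>{..<dim_col B} - {j}. B $$ (i, k) + (x k + ereal c))"
      unfolding game_fun_def by (rule INF_lower[OF i])
    also have "\<dots> \<le> - B $$ (i, j) + (?s + ereal c)"
    proof (intro add_left_mono SUP_least)
      fix k assume "k \<in> {..<dim_col B} - {j}"
      then have "B $$ (i, k) + x k \<le> ?s" by (rule SUP_upper)
      then show "B $$ (i, k) + (x k + ereal c) \<le> ?s + ereal c"
        unfolding add.assoc[symmetric] by (rule add_right_mono)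
    qed
    finally have "?F \<le> (- B $$ (i, j) + ?s) + ereal c" by (simp only: add.assoc)
    then show "?F - ereal c \<le> - B $$ (i, j) + ?s" by (subst ereal_minus_le) auto
  qed
  then show ?thesis by (subst (asm) ereal_minus_le) auto
qed

lemma game_iterate_mono:
  assumes "\<And>k. k < dim_col B \<Longrightarrow> x k \<le> x' k" "j < dim_col B"
  shows "(game_fun B ^^ N) x j \<le> (game_fun B ^^ N) x' j"
  using assms(2)
proof (induction N arbitrary: j)
  case 0
  then show ?case using assms(1) by simp
next
  case (Suc N)
  show ?case using Suc.IH by (auto intro: game_fun_mono)
qed

lemma game_iterate_shift:
  assumes "j < dim_col B"
  shows "(game_fun B ^^ N) (\<lambda>k. x k + ereal c) j \<le> (game_fun B ^^ N) x j + ereal c"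
  using assms
proof (induction N arbitrary: j)
  case (Suc N)
  have "(game_fun B ^^ Suc N) (\<lambda>k. x k + ereal c) j \<le> game_fun B (\<lambda>k. (game_fun B ^^ N) x k + ereal c) j"
    using Suc.IH by (auto intro: game_fun_mono)
  also have "\<dots> \<le> (game_fun B ^^ Suc N) x j + ereal c" using game_fun_shift by simp
  finally show ?case .
qed simp

lemma neg_inf_column_dependent:
  assumes "neg_inf_column B"
  shows "mat_dependent B {..<dim_col B}"
proof -
  obtain j where "j < dim_col B" "\<forall>i<dim_row B. B $$ (i, j) = -\<infinity>"
    using assms by (auto simp: neg_inf_column_def)
  then show ?thesis
    by (intro columns_dependentI[where S = "{j}" and x = "\<lambda>_. 0"]) auto
qed

context
  fixes B :: "ereal mat"
  assumes B: "trop_mat B" "\<not> neg_inf_column B"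
begin

lemma game_row: "j < dim_col B \<Longrightarrow> \<exists>i. i < dim_row B \<and> B $$ (i, j) \<noteq> -\<infinity> \<and> B $$ (i, j) \<noteq> \<infinity>"
  using B trop_mat_entry[of B _ j] by (auto simp: neg_inf_column_def)

lemma game_fun_less_PInf:
  assumes "j < dim_col B" "\<And>k. k < dim_col B \<Longrightarrow> x k < \<infinity>"
  shows "game_fun B x j < \<infinity>"
proof -
  obtain i where i: "i < dim_row B" "B $$ (i, j) \<noteq> -\<infinity>" using game_row[OF assms(1)] by blast
  have "game_fun B x j \<le> - B $$ (i, j) + (SUP k\<in>{..<dim_col B} - {j}. B $$ (i, k) + x k)"
    unfolding game_fun_def by (rule INF_lower) (use i in auto)
  moreover have "(SUP k\<in>{..<dim_col B} - {j}. B $$ (i, k) + x k) < \<infinity>"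
    by (rule SUP_finite_less) (use assms(2) trop_mat_entry[OF B(1) i(1)] in \<open>auto simp: less_top[symmetric]\<close>)
  ultimately show ?thesis using i(2)
    by (cases "B $$ (i, j)") (auto simp: less_top[symmetric])
qed

lemma game_fun_MInf:
  assumes "j < dim_col B" "\<And>k. k < dim_col B \<Longrightarrow> x k = -\<infinity>"
  shows "game_fun B x j = -\<infinity>"
proof -
  obtain i where i: "i < dim_row B" "B $$ (i, j) \<noteq> -\<infinity>" using game_row[OF assms(1)] by blast
  have "(SUP k\<in>{..<dim_col B} - {j}. B $$ (i, k) + x k) \<le> -\<infinity>"
    by (rule SUP_least) (use assms(2) trop_mat_entry[OF B(1) i(1)] in auto)
  then have s: "(SUP k\<in>{..<dim_col B} - {j}. B $$ (i, k) + x k) = -\<infinity>" by simp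
  have "game_fun B x j \<le> - B $$ (i, j) + (SUP k\<in>{..<dim_col B} - {j}. B $$ (i, k) + x k)"
    unfolding game_fun_def by (rule INF_lower) (use i in auto)
  also have "\<dots> = -\<infinity>" unfolding s using i(2) by (cases "B $$ (i, j)") auto
  finally show ?thesis by simp
qed

lemma game_value_less_PInf: "j < dim_col B \<Longrightarrow> game_value B N j < \<infinity>"
proof (induction N arbitrary: j)
  case (Suc N)
  have "game_fun B (game_value B N) j < \<infinity>"
    by (rule game_fun_less_PInf[OF Suc.prems]) (rule Suc.IH)
  then show ?case by (simp add: game_value_def)
qed (simp add: game_value_def)

definition best_value :: "nat \<Rightarrow> ereal" where
  "best_value N = (SUP j\<in>{..<dim_col B}. game_value B N j)"

lemma best_value_upper: "j < dim_col B \<Longrightarrow> game_value B N j \<le> best_value N"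
  unfolding best_value_def by (rule SUP_upper) simp

lemma best_value_not_PInf: "best_value N \<noteq> \<infinity>"
proof -
  have "best_value N < \<infinity>"
    unfolding best_value_def
  proof (rule SUP_finite_less)
    show "game_value B N j < \<infinity>" if "j \<in> {..<dim_col B}" for j
      using that by (intro game_value_less_PInf) simp
  qed simp_all
  then show ?thesis by simp
qed

text \<open>After \<open>M\<close> moves every coordinate is at most \<open>best_value M\<close>; monotonicity and homogeneity carry this bound
through \<open>N\<close> further moves. If \<open>best_value M\<close> is \<open>-\<infinity>\<close>, all later values are \<open>-\<infinity>\<close> as well.\<close>

lemma best_value_subadditive: "best_value (N + M) \<le> best_value N + best_value M"
proof -
  have split: "game_value B (N + M) = (game_fun B ^^ N) (game_value B M)"
    by (simp add: game_value_def funpow_add)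
  show ?thesis
  proof (cases "best_value M")
    case (real c)
    have "game_value B (N + M) j \<le> best_value N + best_value M" if j: "j < dim_col B" for j
    proof -
      have "game_value B (N + M) j \<le> (game_fun B ^^ N) (\<lambda>k. 0 + ereal c) j"
        unfolding split by (rule game_iterate_mono[OF _ j]) (use best_value_upper[of _ M] real in auto)
      also have "\<dots> \<le> game_value B N j + ereal c"
        using game_iterate_shift[OF j, of N "\<lambda>_. 0" c] by (simp add: game_value_def)
      also have "\<dots> \<le> best_value N + ereal c" by (rule add_right_mono[OF best_value_upper[OF j]])
      finally show ?thesis using real by simp
    qed
    then show ?thesis unfolding best_value_def[of "N + M"] by (intro SUP_least) auto
  next
    case PInf
    then show ?thesis using best_value_not_PInf by simp
  next
    case MInf
    have "(game_fun B ^^ N) (game_value B M) j = -\<infinity>" if "j < dim_col B" for j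
      using that
    proof (induction N arbitrary: j)
      case 0
      then show ?case using best_value_upper[of j M] MInf by simp
    next
      case (Suc N)
      then show ?case using game_fun_MInf[OF Suc.prems] by simp
    qed
    then have "best_value (N + M) \<le> -\<infinity>"
      unfolding best_value_def[of "N + M"] split by (intro SUP_least) auto
    then show ?thesis by simp
  qed
qed

lemma winning_iff_best_values_nonneg:
  assumes "0 < dim_col B"
  shows "max_has_winning_state B \<longleftrightarrow> (\<forall>N\<ge>1. 0 \<le> best_value N)"
proof -
  let ?L = "INF N\<in>{1..}. best_value N / ereal (real N)"
  let ?w = "\<lambda>N. SUP j\<in>{..<dim_col B}. game_value B N j / ereal (real N)"
  have "best_value 0 \<le> 0" by (simp add: best_value_def game_value_def SUP_least)
  then have "(\<lambda>N. best_value N / ereal (real N)) \<longlonglongrightarrow> ?L"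
    by (intro subadditive_average_converges best_value_not_PInf best_value_subadditive)
  moreover have "\<forall>\<^sub>F N in sequentially. best_value N / ereal (real N) = ?w N"
    using eventually_ge_at_top[of 1]
  proof eventually_elim
    case (elim N)
    show ?case
    proof (rule antisym)
      have "best_value N \<le> ereal (real N) * ?w N"
        unfolding best_value_def
      proof (rule SUP_least)
        fix j assume j: "j \<in> {..<dim_col B}"
        have "game_value B N j / ereal (real N) \<le> ?w N" by (rule SUP_upper[OF j])
        then show "game_value B N j \<le> ereal (real N) * ?w N"
          using elim by (subst (asm) ereal_divide_le_pos) auto
      qed
      then show "best_value N / ereal (real N) \<le> ?w N"
        using elim by (subst ereal_divide_le_pos) auto
      show "?w N \<le> best_value N / ereal (real N)"
        by (intro SUP_least ereal_divide_right_mono best_value_upper) (use elim in auto)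
    qed
  qed
  ultimately have "?w \<longlonglongrightarrow> ?L" by (rule Lim_transform_eventually)
  then have "lim ?w = ?L" by (rule limI)
  moreover have "upper_mean_payoff (dim_col B) (game_map B) = lim ?w"
    unfolding upper_mean_payoff_def game_map_iterate by (intro arg_cong[where f = lim]) auto
  ultimately have "max_has_winning_state B \<longleftrightarrow> (\<forall>N\<in>{1..}. 0 \<le> best_value N / ereal (real N))"
    by (simp add: max_has_winning_state_def le_INF_iff)
  also have "\<dots> \<longleftrightarrow> (\<forall>N\<ge>1. 0 \<le> best_value N)"
    by (auto simp: ereal_le_divide_pos)
  finally show ?thesis .
qed

text \<open>Shift the dependence \<open>x\<close> so that its maximum is 0. Then \<open>x \<le> 0\<close> and \<open>x \<le> f x\<close>, and monotonicity
gives \<open>x \<le> f\<^sup>N(0)\<close>.\<close>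

lemma dependent_imp_best_value_nonneg:
  assumes "mat_dependent B {..<dim_col B}"
  shows "0 \<le> best_value N"
proof -
  obtain S and x :: "nat \<Rightarrow> real" where S: "S \<noteq> {}" "S \<subseteq> {..<dim_col B}" and
    x: "\<And>i j. j \<in> S \<Longrightarrow> i \<in> {..<dim_row B} \<Longrightarrow> B $$ (i, j) \<noteq> -\<infinity> \<Longrightarrow>
      \<exists>k\<in>S. k \<noteq> j \<and> B $$ (i, j) + ereal (x j) \<le> B $$ (i, k) + ereal (x k)"
    using assms by (rule columns_dependentE) (rule that)
  have finS: "finite S" using S(2) by (rule finite_subset) simp
  then have "Max (x ` S) \<in> x ` S" using S(1) by (intro Max_in) auto
  then obtain v where v: "v \<in> S" "Max (x ` S) = x v" by auto
  have xle: "x j \<le> x v" if "j \<in> S" for j unfolding v(2)[symmetric] using finS that by (intro Max_ge) auto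
  define X where "X j = (if j \<in> S then ereal (x j - x v) else -\<infinity>)" for j
  have X0: "X j \<le> 0" for j using xle[of j] by (simp add: X_def)
  have XF: "X j \<le> game_fun B X j" for j
  proof (cases "j \<in> S")
    case True
    show ?thesis unfolding game_fun_def
    proof (rule INF_greatest)
      fix i assume "i \<in> {i. i < dim_row B \<and> B $$ (i, j) \<noteq> -\<infinity>}"
      then have i: "i < dim_row B" "B $$ (i, j) \<noteq> -\<infinity>" by auto
      obtain k where k: "k \<in> S" "k \<noteq> j" "B $$ (i, j) + ereal (x j) \<le> B $$ (i, k) + ereal (x k)"
        using x[OF True _ i(2)] i(1) by auto
      have kj: "k < dim_col B" "j < dim_col B" using k(1) True S(2) by auto
      have "B $$ (i, j) \<noteq> \<infinity>" "B $$ (i, k) \<noteq> \<infinity>" using trop_mat_entry[OF B(1) i(1)] kj by auto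
      then have "X j \<le> - B $$ (i, j) + (B $$ (i, k) + X k)"
        using k i(2) True by (cases "B $$ (i, j)"; cases "B $$ (i, k)") (auto simp: X_def)
      also have "\<dots> \<le> - B $$ (i, j) + (SUP k\<in>{..<dim_col B} - {j}. B $$ (i, k) + X k)"
        using kj k(2) by (intro add_left_mono SUP_upper) auto
      finally show "X j \<le> - B $$ (i, j) + (SUP k\<in>{..<dim_col B} - {j}. B $$ (i, k) + X k)" .
    qed
  qed (simp add: X_def)
  have "X j \<le> game_value B N j" for j
  proof (induction N arbitrary: j)
    case 0
    then show ?case using X0 by (simp add: game_value_def)
  next
    case (Suc N)
    have "X j \<le> game_fun B X j" by (rule XF)
    also have "\<dots> \<le> game_fun B (game_value B N) j" by (rule game_fun_mono) (rule Suc)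
    finally show ?case by (simp add: game_value_def)
  qed
  from this[of v] have "0 \<le> game_value B N v" using v(1) by (simp add: X_def zero_ereal_def)
  also have "\<dots> \<le> best_value N" by (rule best_value_upper) (use v(1) S(2) in auto)
  finally show ?thesis .
qed

text \<open>Let Min play \<open>\<sigma>\<close>. As there are finitely many columns, the strict inequalities have a uniform slack \<open>e\<close>.\<close>

lemma dominates_contracts:
  assumes "dominates {..<dim_row B} {..<dim_col B} (\<lambda>i j. B $$ (i, j)) \<sigma> y" "0 < dim_col B"
  shows "\<exists>e>0. \<forall>j<dim_col B. game_fun B (\<lambda>k. ereal (y k)) j \<le> ereal (y j - e)"
proof -
  have "\<exists>e>0. game_fun B (\<lambda>k. ereal (y k)) j \<le> ereal (y j - e)" if j: "j < dim_col B" for j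
  proof -
    let ?i = "\<sigma> j"
    have i: "?i < dim_row B" "B $$ (?i, j) \<noteq> -\<infinity>" using dominatesD(1,2)[OF assms(1), of j] j by auto
    have "B $$ (?i, j) \<noteq> \<infinity>" by (rule trop_mat_entry[OF B(1) i(1) j])
    then obtain b where b: "B $$ (?i, j) = ereal b" using i(2) by (cases "B $$ (?i, j)") auto
    have "(SUP k\<in>{..<dim_col B} - {j}. B $$ (?i, k) + ereal (y k)) < ereal (b + y j)"
      by (rule SUP_finite_less) (use dominatesD(3)[OF assms(1), of j] j b in auto)
    moreover have "game_fun B (\<lambda>k. ereal (y k)) j \<le>
        - B $$ (?i, j) + (SUP k\<in>{..<dim_col B} - {j}. B $$ (?i, k) + ereal (y k))"
      unfolding game_fun_def by (rule INF_lower) (use i in auto)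
    ultimately have less: "game_fun B (\<lambda>k. ereal (y k)) j < ereal (y j)"
      unfolding b
      by (cases "SUP k\<in>{..<dim_col B} - {j}. B $$ (?i, k) + ereal (y k)";
          cases "game_fun B (\<lambda>k. ereal (y k)) j") auto
    then obtain r where "game_fun B (\<lambda>k. ereal (y k)) j < ereal r" "ereal r < ereal (y j)"
      using ereal_dense2 by blast
    then show ?thesis by (intro exI[of _ "y j - r"]) auto
  qed
  then obtain e where e: "\<And>j. j < dim_col B \<Longrightarrow> e j > 0"
    "\<And>j. j < dim_col B \<Longrightarrow> game_fun B (\<lambda>k. ereal (y k)) j \<le> ereal (y j - e j)" by metis
  have "Min (e ` {..<dim_col B}) \<in> e ` {..<dim_col B}" using assms(2) by (intro Min_in) auto
  then have "Min (e ` {..<dim_col B}) > 0" using e(1) by auto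
  moreover have "game_fun B (\<lambda>k. ereal (y k)) j \<le> ereal (y j - Min (e ` {..<dim_col B}))"
    if "j < dim_col B" for j
  proof -
    have "Min (e ` {..<dim_col B}) \<le> e j" using that by (intro Min_le) auto
    then show ?thesis using e(2)[OF that] by (meson diff_left_mono ereal_less_eq(3) order_trans)
  qed
  ultimately show ?thesis by blast
qed

lemma not_dependent_imp_best_value_negative:
  assumes "\<not> mat_dependent B {..<dim_col B}" "0 < dim_col B"
  shows "\<exists>N\<ge>1. best_value N < 0"
proof -
  obtain \<sigma> y where dom: "dominates {..<dim_row B} {..<dim_col B} (\<lambda>i j. B $$ (i, j)) \<sigma> y"
    using not_dependent_dominates[of "{..<dim_row B}" "{..<dim_col B}" "\<lambda>i j. B $$ (i, j)"]
      assms(1) trop_mat_entry[OF B(1)] by auto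
  obtain e where e: "e > 0" "\<And>j. j < dim_col B \<Longrightarrow> game_fun B (\<lambda>k. ereal (y k)) j \<le> ereal (y j - e)"
    using dominates_contracts[OF dom assms(2)] by blast
  define c where "c = Max ((\<lambda>j. \<bar>y j\<bar>) ` {..<dim_col B})"
  have c: "\<bar>y j\<bar> \<le> c" if "j < dim_col B" for j unfolding c_def using that by (intro Max_ge) auto
  have descent: "(game_fun B ^^ N) (\<lambda>k. ereal (y k)) j \<le> ereal (y j - real N * e)" if "j < dim_col B" for N j
    using that
  proof (induction N arbitrary: j)
    case (Suc N)
    have "(game_fun B ^^ Suc N) (\<lambda>k. ereal (y k)) j \<le>
        game_fun B (\<lambda>k. ereal (y k) + ereal (- real N * e)) j"
      using Suc.IH by (auto intro: game_fun_mono)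
    also have "\<dots> \<le> game_fun B (\<lambda>k. ereal (y k)) j + ereal (- real N * e)" by (rule game_fun_shift)
    also have "\<dots> \<le> ereal (y j - e) + ereal (- real N * e)" by (rule add_right_mono[OF e(2)[OF Suc.prems]])
    also have "\<dots> = ereal (y j - real (Suc N) * e)" by (simp add: algebra_simps)
    finally show ?case .
  qed simp
  have "game_value B N j \<le> ereal (2 * c - real N * e)" if j: "j < dim_col B" for N j
  proof -
    have "game_value B N j \<le> (game_fun B ^^ N) (\<lambda>k. ereal (y k) + ereal c) j"
      unfolding game_value_def
    proof (rule game_iterate_mono[OF _ j])
      fix k assume "k < dim_col B"
      then show "0 \<le> ereal (y k) + ereal c" using c[of k] by auto
    qed
    also have "\<dots> \<le> (game_fun B ^^ N) (\<lambda>k. ereal (y k)) j + ereal c" by (rule game_iterate_shift[OF j])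
    also have "\<dots> \<le> ereal (y j - real N * e) + ereal c" by (rule add_right_mono[OF descent[OF j]])
    also have "\<dots> \<le> ereal (2 * c - real N * e)" using c[OF j] by auto
    finally show ?thesis .
  qed
  then have best: "best_value N \<le> ereal (2 * c - real N * e)" for N
    unfolding best_value_def by (intro SUP_least) auto
  obtain N where N: "2 * c < real N * e" using reals_Archimedean3[OF e(1)] by blast
  have "best_value (Suc N) \<le> ereal (2 * c - real (Suc N) * e)" by (rule best)
  also have "\<dots> < 0" using N e(1) by (simp add: algebra_simps zero_ereal_def)
  finally show ?thesis by (intro exI[of _ "Suc N"]) simp
qed

theorem winning_iff_dependent:
  "max_has_winning_state B \<longleftrightarrow> mat_dependent B {..<dim_col B}"
proof (cases "dim_col B = 0")
  case True
  have "(\<lambda>N. SUP j\<in>{..<0::nat}. (game_map B ^^ N) (0\<^sub>v 0) $ j / ereal (real N)) \<longlonglongrightarrow> -\<infinity>"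
    by (simp add: bot_ereal_def)
  then have "upper_mean_payoff 0 (game_map B) = -\<infinity>"
    unfolding upper_mean_payoff_def by (rule limI)
  then show ?thesis using True by (simp add: max_has_winning_state_def columns_dependent_def)
next
  case False
  then show ?thesis
    using winning_iff_best_values_nonneg dependent_imp_best_value_nonneg
      not_dependent_imp_best_value_negative by (meson not_le gr0I)
qed

end

section \<open>Deciding dependence of integer columns by descent\<close>

text \<open>A map that lowers a natural potential unless it is at a fixpoint reaches a fixpoint within a number of steps fixed
in advance. So the program needs no test for termination.\<close>

lemma fixpoint_after_potential_steps:
  assumes "\<And>v. P v \<Longrightarrow> P (f v)" "\<And>v. P v \<Longrightarrow> f v \<noteq> v \<Longrightarrow> \<Phi> (f v) < (\<Phi> v :: nat)" "P v" "\<Phi> v \<le> R"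
  shows "f ((f ^^ R) v) = (f ^^ R) v"
  using assms(3,4)
proof (induction R arbitrary: v)
  case 0
  then show ?case using assms(2)[of v] by auto
next
  case (Suc R)
  show ?case
  proof (cases "f v = v")
    case True
    then have "(f ^^ N) v = v" for N by (induction N) auto
    then show ?thesis using True by simp
  next
    case False
    then have "\<Phi> (f v) \<le> R" using assms(2)[of v] Suc.prems by simp
    then show ?thesis using Suc.IH[of "f v"] assms(1)[of v] Suc.prems(1)
      by (simp add: funpow_Suc_right del: funpow.simps)
  qed
qed

context
  fixes m n :: nat and a :: "nat \<Rightarrow> nat \<Rightarrow> ereal" and w :: "nat \<Rightarrow> nat \<Rightarrow> int"
begin

text \<open>A positive value of \<open>v\<close> is a live coordinate; a value 0 stands for \<open>-\<infinity>\<close>.\<close>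

definition row_violated :: "(nat \<Rightarrow> int) \<Rightarrow> nat \<Rightarrow> nat \<Rightarrow> bool" where
  "row_violated v j i \<longleftrightarrow> a i j \<noteq> -\<infinity> \<and>
     \<not> (\<exists>k<n. k \<noteq> j \<and> a i k \<noteq> -\<infinity> \<and> 0 < v k \<and> w i j + v j \<le> w i k + v k)"

definition lower :: "nat \<Rightarrow> (nat \<Rightarrow> int) \<Rightarrow> nat \<Rightarrow> int" where
  "lower j v = (if 0 < v j \<and> (\<exists>i<m. row_violated v j i) then v(j := v j - 1) else v)"

text \<open>The columns are visited downwards, in the order in which the counters of the program run.\<close>

definition sweep_from :: "nat \<Rightarrow> (nat \<Rightarrow> int) \<Rightarrow> nat \<Rightarrow> int" where
  "sweep_from r v = fold lower (rev [r..<n]) v"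

abbreviation sweep :: "(nat \<Rightarrow> int) \<Rightarrow> nat \<Rightarrow> int" where
  "sweep \<equiv> sweep_from 0"

lemma sweep_from_end: "sweep_from n v = v"
  by (simp add: sweep_from_def)

lemma sweep_from_step: "r < n \<Longrightarrow> sweep_from r v = lower r (sweep_from (Suc r) v)"
  by (simp add: sweep_from_def upt_rec[of r n])

lemma sweep_from_induct:
  assumes "P v" "\<And>v j. j < n \<Longrightarrow> P v \<Longrightarrow> P (lower j v)" "r \<le> n"
  shows "P (sweep_from r v)"
  using assms(3)
proof (induction r rule: inc_induct)
  case base
  then show ?case using assms(1) by (simp add: sweep_from_end)
next
  case (step r)
  then show ?case using assms(2) by (simp add: sweep_from_step)
qed

lemma lower_le: "lower j v k \<le> v k"
  by (simp add: lower_def)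

lemma lower_nonneg: "(\<And>k. 0 \<le> v k) \<Longrightarrow> 0 \<le> lower j v k"
  by (simp add: lower_def)

lemma sweep_from_le:
  assumes "r \<le> n"
  shows "sweep_from r v k \<le> v k"
proof (rule sweep_from_induct[where P = "\<lambda>u. u k \<le> v k", OF _ _ assms])
  show "lower j u k \<le> v k" if "u k \<le> v k" for u j
    using lower_le[of j u k] that by (rule order_trans)
qed simp

lemma sweep_from_antimono:
  assumes "r \<le> n"
  shows "sweep v k \<le> sweep_from r v k"
proof -
  have "sweep_from 0 v k \<le> sweep_from r v k" if "r \<le> n" for r
    using that
  proof (induction r)
    case (Suc r)
    then have "sweep_from 0 v k \<le> sweep_from r v k" by simp
    also have "\<dots> \<le> sweep_from (Suc r) v k" using Suc.prems by (simp add: sweep_from_step lower_le)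
    finally show ?case .
  qed simp
  then show ?thesis using assms by blast
qed

lemma sweep_fixpoint_not_violated:
  assumes "sweep v = v" "j < n" "0 < v j" "i < m"
  shows "\<not> row_violated v j i"
proof
  assume viol: "row_violated v j i"
  have eq: "sweep_from r v = v" if "r \<le> n" for r
  proof
    fix k
    show "sweep_from r v k = v k"
      using sweep_from_le[OF that, of v k] sweep_from_antimono[OF that, of v k] assms(1) by simp
  qed
  have "lower j v = v" using sweep_from_step[OF assms(2), of v] eq[of j] eq[of "Suc j"] assms(2) by simp
  moreover have "lower j v j = v j - 1" using viol assms(3,4) by (auto simp: lower_def)
  ultimately show False by simp
qed

lemma sweep_outside:
  assumes "n \<le> k"
  shows "sweep v k = v k"
  by (rule sweep_from_induct[where P = "\<lambda>u. u k = v k"]) (use assms in \<open>auto simp: lower_def\<close>)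

lemma sweep_rounds_fixpoint:
  assumes "\<And>k. 0 \<le> v k" "(\<Sum>k<n. v k) \<le> int R"
  shows "sweep ((sweep ^^ R) v) = (sweep ^^ R) v"
proof (rule fixpoint_after_potential_steps[where P = "\<lambda>v. \<forall>k. 0 \<le> v k" and \<Phi> = "\<lambda>v. nat (\<Sum>k<n. v k)"])
  fix v :: "nat \<Rightarrow> int"
  assume v: "\<forall>k. 0 \<le> v k"
  show nonneg: "\<forall>k. 0 \<le> sweep v k"
    by (rule sweep_from_induct[where P = "\<lambda>u. \<forall>k. 0 \<le> u k"]) (use v lower_nonneg in auto)
  assume "sweep v \<noteq> v"
  then obtain k where k: "sweep v k \<noteq> v k" by auto
  then have "sweep v k < v k" "k < n"
    using sweep_from_le[of 0 v k] sweep_outside[of k v] by (simp, meson not_le)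
  then have "(\<Sum>k<n. sweep v k) < (\<Sum>k<n. v k)"
    using sweep_from_le[of 0 v] by (intro sum_strict_mono_ex1) auto
  moreover have "0 \<le> (\<Sum>k<n. sweep v k)" using nonneg by (intro sum_nonneg) auto
  ultimately show "nat (\<Sum>k<n. sweep v k) < nat (\<Sum>k<n. v k)" by simp
qed (use assms in auto)

lemma sweep_rounds_le: "(sweep ^^ R) v k \<le> v k"
proof (induction R)
  case (Suc R)
  have "sweep ((sweep ^^ R) v) k \<le> (sweep ^^ R) v k" by (rule sweep_from_le) simp
  then show ?case using Suc by simp
qed simp

text \<open>A solution that lies below \<open>v\<close> supplies an answer to every row at a column where it touches \<open>v\<close>.
So such a column is never lowered.\<close>

lemma lower_ge_solution:
  assumes S: "S \<subseteq> {..<n}"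
    and sol: "\<And>j i. j \<in> S \<Longrightarrow> i < m \<Longrightarrow> a i j \<noteq> -\<infinity> \<Longrightarrow>
      \<exists>k\<in>S. k \<noteq> j \<and> a i k \<noteq> -\<infinity> \<and> w i j + x j \<le> w i k + x k"
    and pos: "\<And>j. j \<in> S \<Longrightarrow> 0 < x j"
    and below: "\<And>j. j \<in> S \<Longrightarrow> x j \<le> v j"
  shows "j \<in> S \<Longrightarrow> x j \<le> lower l v j"
proof -
  assume j: "j \<in> S"
  show "x j \<le> lower l v j"
  proof (cases "l = j \<and> x j = v j")
    case True
    have "\<not> row_violated v j i" if i: "i < m" for i
    proof
      assume viol: "row_violated v j i"
      then have "a i j \<noteq> -\<infinity>" by (simp add: row_violated_def)
      then obtain k where k: "k \<in> S" "k \<noteq> j" "a i k \<noteq> -\<infinity>" "w i j + x j \<le> w i k + x k"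
        using sol[OF j i] by blast
      have "k < n" "0 < v k" "w i j + v j \<le> w i k + v k"
        using k S True pos[OF k(1)] below[OF k(1)] by auto
      then show False using viol k by (auto simp: row_violated_def)
    qed
    then show ?thesis using True by (auto simp: lower_def)
  next
    case False
    then show ?thesis using below[OF j] by (auto simp: lower_def)
  qed
qed

text \<open>If no coordinate of a solution lies in a window of height \<open>2 * W\<close> below some level, the coordinates under the window
can be dropped from the support, because no answer of Max drops by more than \<open>2 * W\<close>. With at most \<open>n\<close>
coordinates, such a gap occurs within distance \<open>2 * W * n\<close> of the top.\<close>

lemma bounded_solution:
  fixes y :: "nat \<Rightarrow> int"
  assumes S: "S \<noteq> {}" "S \<subseteq> {..<n}"
    and sol: "\<And>j i. j \<in> S \<Longrightarrow> i < m \<Longrightarrow> a i j \<noteq> -\<infinity> \<Longrightarrow>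
      \<exists>k\<in>S. k \<noteq> j \<and> a i k \<noteq> -\<infinity> \<and> w i j + y j \<le> w i k + y k"
    and W: "\<And>i j. i < m \<Longrightarrow> j < n \<Longrightarrow> \<bar>w i j\<bar> \<le> W"
    and K: "2 * W * int n < K" and "0 \<le> W"
  shows "\<exists>S' x. S' \<noteq> {} \<and> S' \<subseteq> S \<and> (\<forall>j\<in>S'. 0 < x j \<and> x j \<le> K) \<and>
    (\<forall>j\<in>S'. \<forall>i<m. a i j \<noteq> -\<infinity> \<longrightarrow> (\<exists>k\<in>S'. k \<noteq> j \<and> a i k \<noteq> -\<infinity> \<and> w i j + x j \<le> w i k + x k))"
proof -
  have finS: "finite S" using S(2) by (rule finite_subset) simp
  define top where "top = Max (y ` S)"
  have "top \<in> y ` S" unfolding top_def using finS S(1) by (intro Max_in) auto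
  then obtain v where v: "v \<in> S" "y v = top" by auto
  have le_top: "y j \<le> top" if "j \<in> S" for j unfolding top_def using finS that by (intro Max_ge) auto
  \<comment> \<open>The sets T t increase with t; the first repetition is a gap of height 2 * W.\<close>
  define T where "T t = {j \<in> S. top - 2 * W * int t \<le> y j}" for t
  have T_mono: "T t \<subseteq> T (Suc t)" for t using \<open>0 \<le> W\<close> by (auto simp: T_def algebra_simps)
  have "\<exists>t<n. T t = T (Suc t)"
  proof (rule ccontr)
    assume no: "\<not> ?thesis"
    have "t < card (T t)" if "t \<le> n" for t
      using that
    proof (induction t)
      case 0
      have "v \<in> T 0" using v by (simp add: T_def)
      then show ?case using finS by (auto simp: T_def card_gt_0_iff)
    next
      case (Suc t)
      then have "T t \<subset> T (Suc t)" using no T_mono[of t] by auto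
      then have "card (T t) < card (T (Suc t))" using finS by (intro psubset_card_mono) (auto simp: T_def)
      then show ?case using Suc by simp
    qed
    then have "n < card (T n)" by simp
    also have "\<dots> \<le> card {..<n}" using S(2) by (intro card_mono) (auto simp: T_def)
    finally show False by simp
  qed
  then obtain t where t: "t < n" "T t = T (Suc t)" by blast
  have Wt: "2 * W * int t \<le> 2 * W * int n" using t(1) \<open>0 \<le> W\<close> by (intro mult_left_mono) auto
  \<comment> \<open>The highest coordinate is raised to the starting level K.\<close>
  define x where "x j = y j - top + K" for j
  show ?thesis
  proof (intro exI[of _ "T t"] exI[of _ x] conjI ballI allI impI)
    show "T t \<noteq> {}" using v \<open>0 \<le> W\<close> by (auto simp: T_def)
    show "T t \<subseteq> S" by (auto simp: T_def)
    fix j assume j: "j \<in> T t"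
    then have jS: "j \<in> S" "j < n" using S(2) by (auto simp: T_def)
    show "0 < x j" using j Wt K by (auto simp: T_def x_def)
    show "x j \<le> K" using le_top[OF jS(1)] by (simp add: x_def)
    fix i assume i: "i < m" "a i j \<noteq> -\<infinity>"
    obtain k where k: "k \<in> S" "k \<noteq> j" "a i k \<noteq> -\<infinity>" "w i j + y j \<le> w i k + y k"
      using sol[OF jS(1) i] by blast
    have "\<bar>w i j\<bar> \<le> W" "\<bar>w i k\<bar> \<le> W" using W[OF i(1)] jS(2) k(1) S(2) by auto
    then have "y j - 2 * W \<le> y k" using k(4) by linarith
    then have "k \<in> T (Suc t)" using j k(1) by (auto simp: T_def algebra_simps)
    then show "\<exists>k\<in>T t. k \<noteq> j \<and> a i k \<noteq> -\<infinity> \<and> w i j + x j \<le> w i k + x k"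
      using k t(2) by (intro bexI[of _ k]) (auto simp: x_def)
  qed
qed

theorem descent_decides_dependence:
  assumes int: "\<And>i j. i < m \<Longrightarrow> j < n \<Longrightarrow> a i j \<noteq> -\<infinity> \<Longrightarrow> a i j = ereal (of_int (w i j))"
    and W: "\<And>i j. i < m \<Longrightarrow> j < n \<Longrightarrow> \<bar>w i j\<bar> \<le> W" "0 \<le> W"
    and K: "2 * W * int n < K" and J: "J \<subseteq> {..<n}" and R: "int n * K \<le> int R"
  shows "(\<exists>j<n. 0 < (sweep ^^ R) (\<lambda>j. if j \<in> J then K else 0) j) \<longleftrightarrow> columns_dependent {..<m} J a"
proof -
  let ?start = "\<lambda>j. if j \<in> J then K else 0"
  let ?v = "(sweep ^^ R) ?start"
  have K0: "0 \<le> K" using K W(2) by (meson less_le_trans mult_nonneg_nonneg of_nat_0_le_iff order_less_imp_le zero_le_numeral order_trans)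
  have "(\<Sum>k<n. ?start k) \<le> (\<Sum>k<n. K)" using K0 by (intro sum_mono) auto
  then have fixpoint: "sweep ?v = ?v" using R K0 by (intro sweep_rounds_fixpoint) auto
  show ?thesis
  proof
    assume alive: "\<exists>j<n. 0 < ?v j"
    show "columns_dependent {..<m} J a"
    proof (rule columns_dependentI[where S = "{j. j < n \<and> 0 < ?v j}" and x = "\<lambda>j. of_int (?v j)"])
      show "{j. j < n \<and> 0 < ?v j} \<noteq> {}" using alive by auto
      show "{j. j < n \<and> 0 < ?v j} \<subseteq> J"
      proof
        fix j assume "j \<in> {j. j < n \<and> 0 < ?v j}"
        then have "0 < ?start j" using sweep_rounds_le[of R ?start j] by simp
        then show "j \<in> J" by (simp split: if_splits)
      qed
      fix i j assume j: "j \<in> {j. j < n \<and> 0 < ?v j}" and i: "i \<in> {..<m}" "a i j \<noteq> -\<infinity>"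
      then have "\<not> row_violated ?v j i" using sweep_fixpoint_not_violated[OF fixpoint] by auto
      then obtain k where k: "k < n" "k \<noteq> j" "a i k \<noteq> -\<infinity>" "0 < ?v k" "w i j + ?v j \<le> w i k + ?v k"
        using i(2) by (auto simp: row_violated_def)
      have "a i j = ereal (of_int (w i j))" "a i k = ereal (of_int (w i k))"
        using int[of i j] int[of i k] i j k by auto
      moreover have "real_of_int (w i j) + real_of_int (?v j) \<le> real_of_int (w i k) + real_of_int (?v k)"
        using k(5) by linarith
      ultimately show "\<exists>k\<in>{j. j < n \<and> 0 < ?v j}. k \<noteq> j \<and>
          a i j + ereal (of_int (?v j)) \<le> a i k + ereal (of_int (?v k))"
        using k by (intro bexI[of _ k]) auto
    qed
  next
    assume "columns_dependent {..<m} J a"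
    then obtain S and z :: "nat \<Rightarrow> real" where S: "S \<noteq> {}" "S \<subseteq> J" and
      z: "\<And>i j. j \<in> S \<Longrightarrow> i \<in> {..<m} \<Longrightarrow> a i j \<noteq> -\<infinity> \<Longrightarrow>
        \<exists>k\<in>S. k \<noteq> j \<and> a i j + ereal (z j) \<le> a i k + ereal (z k)"
      by (rule columns_dependentE) (rule that)
    have Sn: "S \<subseteq> {..<n}" using S(2) J by auto
    have sol: "\<exists>k\<in>S. k \<noteq> j \<and> a i k \<noteq> -\<infinity> \<and> w i j + \<lfloor>z j\<rfloor> \<le> w i k + \<lfloor>z k\<rfloor>"
      if j: "j \<in> S" and i: "i < m" "a i j \<noteq> -\<infinity>" for i j
    proof -
      obtain k where k: "k \<in> S" "k \<noteq> j" "a i j + ereal (z j) \<le> a i k + ereal (z k)"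
        using z[OF j _ i(2)] i(1) by auto
      have aij: "a i j = ereal (of_int (w i j))" using int[of i j] i j Sn by auto
      have aik: "a i k \<noteq> -\<infinity>" using k(3) unfolding aij by auto
      then have "a i k = ereal (of_int (w i k))" using int[of i k] i(1) k(1) Sn by auto
      then have "of_int (w i j) + z j \<le> of_int (w i k) + z k" using k(3) aij by simp
      then have "\<lfloor>of_int (w i j) + z j\<rfloor> \<le> \<lfloor>of_int (w i k) + z k\<rfloor>" by (rule floor_mono)
      then show ?thesis using k aik by (intro bexI[of _ k]) auto
    qed
    obtain S' x where S': "S' \<noteq> {}" "S' \<subseteq> S" "\<forall>j\<in>S'. 0 < x j \<and> x j \<le> K"
      and x: "\<forall>j\<in>S'. \<forall>i<m. a i j \<noteq> -\<infinity> \<longrightarrow>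
        (\<exists>k\<in>S'. k \<noteq> j \<and> a i k \<noteq> -\<infinity> \<and> w i j + x j \<le> w i k + x k)"
      by (rule exE[OF bounded_solution[where y = "\<lambda>j. \<lfloor>z j\<rfloor>", OF S(1) Sn sol W(1) K W(2)]])
         (assumption | elim exE conjE, rule that)+
    have S'n: "S' \<subseteq> {..<n}" using S'(2) Sn by auto
    have step: "\<forall>j\<in>S'. x j \<le> lower l u j" if "\<forall>j\<in>S'. x j \<le> u j" for l u
      using lower_ge_solution[OF S'n, of x u] x S'(3) that by simp
    have "\<forall>j\<in>S'. x j \<le> (sweep ^^ R') ?start j" for R'
    proof (induction R')
      case 0
      then show ?case using S' S(2) by auto
    next
      case (Suc R')
      have "\<forall>j\<in>S'. x j \<le> sweep ((sweep ^^ R') ?start) j"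
        by (rule sweep_from_induct[where P = "\<lambda>u. \<forall>j\<in>S'. x j \<le> u j"]) (use Suc step in auto)
      then show ?case by simp
    qed
    then have "\<forall>j\<in>S'. x j \<le> ?v j" by simp
    moreover obtain j where "j \<in> S'" using S'(1) by auto
    ultimately show "\<exists>j<n. 0 < ?v j" using S'(3) S'n by (intro exI[of _ j]) force
  qed
qed

end

text \<open>The nested loops of the program do not exclude repeated deletions. These delete fewer columns,
which is harmless: subsets of independent sets are independent.\<close>

lemma exists_deletion_iff:
  assumes "k \<le> dim_col A"
  shows "(\<exists>J. J \<subseteq> {..<dim_col A} \<and> card J = dim_col A - k \<and> \<not> mat_dependent A J) \<longleftrightarrow>
    (\<exists>d. (\<forall>i<k. d i < dim_col A) \<and> \<not> mat_dependent A ({..<dim_col A} - d ` {..<k}))"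
proof
  assume "\<exists>J. J \<subseteq> {..<dim_col A} \<and> card J = dim_col A - k \<and> \<not> mat_dependent A J"
  then obtain J where J: "J \<subseteq> {..<dim_col A}" "card J = dim_col A - k" "\<not> mat_dependent A J" by blast
  have "card ({..<dim_col A} - J) = k"
    using J(1,2) assms by (subst card_Diff_subset) (auto intro: finite_subset)
  then obtain d where d: "bij_betw d {..<k} ({..<dim_col A} - J)"
    using ex_bij_betw_nat_finite[of "{..<dim_col A} - J"] by (auto simp: atLeast0LessThan)
  then have im: "d ` {..<k} = {..<dim_col A} - J" by (simp add: bij_betw_def)
  have "{..<dim_col A} - d ` {..<k} = J" unfolding im using J(1) by auto
  moreover have "\<forall>i<k. d i < dim_col A" using im by auto
  ultimately show "\<exists>d. (\<forall>i<k. d i < dim_col A) \<and> \<not> mat_dependent A ({..<dim_col A} - d ` {..<k})"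
    using J(3) by metis
next
  assume "\<exists>d. (\<forall>i<k. d i < dim_col A) \<and> \<not> mat_dependent A ({..<dim_col A} - d ` {..<k})"
  then obtain d where d: "\<forall>i<k. d i < dim_col A" "\<not> mat_dependent A ({..<dim_col A} - d ` {..<k})" by blast
  have "card (d ` {..<k}) \<le> k" using card_image_le[of "{..<k}" d] by simp
  moreover have "card ({..<dim_col A} - d ` {..<k}) = dim_col A - card (d ` {..<k})"
    using d(1) by (subst card_Diff_subset) auto
  ultimately have "dim_col A - k \<le> card ({..<dim_col A} - d ` {..<k})" by simp
  then obtain J where J: "J \<subseteq> {..<dim_col A} - d ` {..<k}" "card J = dim_col A - k"
    by (rule obtain_subset_with_card_n) auto
  have "\<not> mat_dependent A J" using d(2) columns_dependent_mono[OF _ order_refl J(1)] by blast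
  then show "\<exists>J. J \<subseteq> {..<dim_col A} \<and> card J = dim_col A - k \<and> \<not> mat_dependent A J"
    using J by blast
qed

section \<open>Timed reasoning about programs\<close>

text \<open>A Hoare triple for total correctness with time bound \<open>T\<close> and a frame: only the cells in \<open>M\<close> may change.\<close>

definition achieves :: "prog \<Rightarrow> memory \<Rightarrow> nat \<Rightarrow> int set \<Rightarrow> (memory \<Rightarrow> bool) \<Rightarrow> bool" where
  "achieves c s T M Q \<longleftrightarrow> (\<exists>t s'. run c s t s' \<and> t \<le> T \<and> (\<forall>a. a \<notin> M \<longrightarrow> s' a = s a) \<and> Q s')"

lemma achievesI:
  assumes "run c s t s'" "t \<le> T" "\<And>a. a \<notin> M \<Longrightarrow> s' a = s a" "Q s'"
  shows "achieves c s T M Q"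
  unfolding achieves_def using assms by (intro exI[of _ t] exI[of _ s']) simp

lemma achievesE:
  assumes "achieves c s T M Q"
  obtains t s' where "run c s t s'" "t \<le> T" "\<And>a. a \<notin> M \<Longrightarrow> s' a = s a" "Q s'"
proof -
  from assms obtain t s' where "run c s t s' \<and> t \<le> T \<and> (\<forall>a. a \<notin> M \<longrightarrow> s' a = s a) \<and> Q s'"
    unfolding achieves_def by (elim exE)
  then show ?thesis by (intro that[of t s']) simp_all
qed

lemma achieves_weaken:
  assumes "achieves c s T M Q" "T \<le> T'" "M \<subseteq> M'"
    and "\<And>s'. (\<And>a. a \<notin> M \<Longrightarrow> s' a = s a) \<Longrightarrow> Q s' \<Longrightarrow> Q' s'"
  shows "achieves c s T' M' Q'"
proof -
  obtain t s' where r: "run c s t s'" "t \<le> T" "\<And>a. a \<notin> M \<Longrightarrow> s' a = s a" "Q s'"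
    using assms(1) by (rule achievesE) (rule that)
  show ?thesis
    by (rule achievesI[OF r(1)]) (use r(2) assms(2) in simp, use r(3) assms(3) in blast, rule assms(4)[OF r(3,4)])
qed

lemma achieves_Seq:
  assumes "achieves c1 s T1 M1 R"
    and "\<And>t. (\<And>a. a \<notin> M1 \<Longrightarrow> t a = s a) \<Longrightarrow> R t \<Longrightarrow> achieves c2 t T2 M2 Q"
    and "M1 \<subseteq> M" "M2 \<subseteq> M" "T1 + T2 \<le> T"
  shows "achieves (Seq c1 c2) s T M Q"
proof -
  obtain t1 s1 where r1: "run c1 s t1 s1" "t1 \<le> T1" "\<And>a. a \<notin> M1 \<Longrightarrow> s1 a = s a" "R s1"
    using assms(1) by (rule achievesE) (rule that)
  obtain t2 s2 where r2: "run c2 s1 t2 s2" "t2 \<le> T2" "\<And>a. a \<notin> M2 \<Longrightarrow> s2 a = s1 a" "Q s2"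
    by (rule achievesE[OF assms(2)[of s1]]) (use r1(3,4) in simp_all)
  show ?thesis
  proof (rule achievesI[OF run.Seq[OF r1(1) r2(1)]])
    show "t1 + t2 \<le> T" using r1(2) r2(2) assms(5) by simp
    fix a assume "a \<notin> M"
    then have "a \<notin> M1" "a \<notin> M2" using assms(3,4) by blast+
    then show "s2 a = s a" using r1(3) r2(3) by simp
  qed (rule r2(4))
qed

lemma achieves_If:
  assumes "0 < s x \<Longrightarrow> achieves c1 s T M Q" "\<not> 0 < s x \<Longrightarrow> achieves c2 s T M Q" "T + 1 \<le> T'"
  shows "achieves (If x c1 c2) s T' M Q"
proof (cases "0 < s x")
  case True
  obtain t s' where r: "run c1 s t s'" "t \<le> T" "\<And>a. a \<notin> M \<Longrightarrow> s' a = s a" "Q s'"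
    using assms(1)[OF True] by (rule achievesE) (rule that)
  show ?thesis by (rule achievesI[OF run.IfTrue[OF True r(1)]]) (use r(2-4) assms(3) in simp_all)
next
  case False
  obtain t s' where r: "run c2 s t s'" "t \<le> T" "\<And>a. a \<notin> M \<Longrightarrow> s' a = s a" "Q s'"
    using assms(2)[OF False] by (rule achievesE) (rule that)
  show ?thesis by (rule achievesI[OF run.IfFalse[OF False r(1)]]) (use r(2-4) assms(3) in simp_all)
qed

primrec loop_free :: "prog \<Rightarrow> bool" where
  "loop_free Skip = True"
| "loop_free (Const x c) = True"
| "loop_free (Add x y z) = True"
| "loop_free (Sub x y z) = True"
| "loop_free (Load x y) = True"
| "loop_free (Store x y) = True"
| "loop_free (Seq c1 c2) = (loop_free c1 \<and> loop_free c2)"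
| "loop_free (If x c1 c2) = (loop_free c1 \<and> loop_free c2)"
| "loop_free (While x c) = False"

primrec exec :: "prog \<Rightarrow> memory \<Rightarrow> memory" where
  "exec Skip s = s"
| "exec (Const x c) s = s(x := c)"
| "exec (Add x y z) s = s(x := s y + s z)"
| "exec (Sub x y z) s = s(x := s y - s z)"
| "exec (Load x y) s = s(x := s (s y))"
| "exec (Store x y) s = s(s x := s y)"
| "exec (Seq c1 c2) s = exec c2 (exec c1 s)"
| "exec (If x c1 c2) s = (if 0 < s x then exec c1 s else exec c2 s)"
| "exec (While x c) s = s"

primrec cost :: "prog \<Rightarrow> nat" where
  "cost Skip = 1"
| "cost (Const x c) = 1"
| "cost (Add x y z) = 1"
| "cost (Sub x y z) = 1"
| "cost (Load x y) = 1"
| "cost (Store x y) = 1"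
| "cost (Seq c1 c2) = cost c1 + cost c2"
| "cost (If x c1 c2) = max (cost c1) (cost c2) + 1"
| "cost (While x c) = 0"

text \<open>Loop-free code can be executed symbolically by the simplifier.\<close>

lemma run_exec: "loop_free c \<Longrightarrow> \<exists>t\<le>cost c. run c s t (exec c s)"
proof (induction c arbitrary: s)
  case (Seq c1 c2)
  then obtain t1 t2 where "t1 \<le> cost c1" "run c1 s t1 (exec c1 s)"
    "t2 \<le> cost c2" "run c2 (exec c1 s) t2 (exec c2 (exec c1 s))" by fastforce
  then show ?case by (intro exI[of _ "t1 + t2"]) (auto intro: run.Seq)
next
  case (If x c1 c2)
  then obtain t1 t2 where t: "t1 \<le> cost c1" "run c1 s t1 (exec c1 s)"
    "t2 \<le> cost c2" "run c2 s t2 (exec c2 s)" by fastforce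
  show ?case
  proof (cases "0 < s x")
    case True
    then show ?thesis using t run.IfTrue[OF True t(2)] by (intro exI[of _ "t1 + 1"]) auto
  next
    case False
    then show ?thesis using t run.IfFalse[OF False t(4)] by (intro exI[of _ "t2 + 1"]) auto
  qed
next
  case (While x c)
  then show ?case by simp
qed (auto intro!: exI[of _ "Suc 0"] intro: run.intros[simplified])

lemma achieves_exec:
  assumes "loop_free c" "\<And>a. a \<notin> M \<Longrightarrow> exec c s a = s a" "cost c \<le> T" "Q (exec c s)"
  shows "achieves c s T M Q"
proof -
  obtain t where "t \<le> cost c" "run c s t (exec c s)" using run_exec[OF assms(1)] by blast
  then show ?thesis using assms(2-4) by (intro achievesI[of c s t "exec c s"]) auto
qed

abbreviation "ONE \<equiv> - 1 :: int"
abbreviation "ZERO \<equiv> - 2 :: int"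

text \<open>The counter runs down from the value of cell \<open>c\<close>, since tests can only ask for positivity; the body sees
all values below the initial one. Cell \<open>ONE\<close> must hold 1 and cell \<open>ZERO\<close> must hold 0.\<close>

definition For :: "int \<Rightarrow> int \<Rightarrow> prog \<Rightarrow> prog" where
  "For r c body = Seq (Add r c ZERO) (While r (Seq (Sub r r ONE) body))"

text \<open>In the invariant \<open>I i\<close> the number \<open>i\<close> is the value of the counter, that is, the number of iterations still to come.
The actual number of iterations is \<open>N\<close>, whereas the time bound uses an upper bound \<open>B\<close> that can be chosen
independently of the input matrix.\<close>

lemma achieves_For:
  assumes s: "s ONE = 1" "s ZERO = 0" "s c = int N" and B: "N \<le> B"
    and M: "insert r M' \<subseteq> M" "r \<notin> M'" "ONE \<notin> M" "ZERO \<notin> M"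
    and insens: "\<And>i t x. I i t \<Longrightarrow> I i (t(r := x))"
    and init: "I N s"
    and step: "\<And>i t. i < N \<Longrightarrow> (\<And>a. a \<notin> M \<Longrightarrow> t a = s a) \<Longrightarrow> t r = int i \<Longrightarrow> I (Suc i) t \<Longrightarrow>
      achieves body t T M' (I i)"
    and T': "B * (T + 2) + 2 \<le> T'"
  shows "achieves (For r c body) s T' M (I 0)"
proof -
  have loop: "\<exists>u s'. run (While r (Seq (Sub r r ONE) body)) t u s' \<and> u \<le> i * (T + 2) + 1 \<and>
      (\<forall>a. a \<notin> M \<longrightarrow> s' a = s a) \<and> I 0 s'"
    if "i \<le> N" "\<And>a. a \<notin> M \<Longrightarrow> t a = s a" "t r = int i" "I i t" for i t
    using that
  proof (induction i arbitrary: t)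
    case 0
    then show ?case by (intro exI[of _ 1] exI[of _ t]) (simp add: run.WhileFalse[simplified])
  next
    case (Suc i)
    define t1 where "t1 = t(r := int i)"
    have sub: "run (Sub r r ONE) t 1 t1"
      using run.Sub[of r r ONE t] Suc.prems(2)[OF M(3)] Suc.prems(3) s(1) by (simp add: t1_def)
    have t1: "t1 a = s a" if "a \<notin> M" for a using Suc.prems(2)[OF that] M(1) that by (auto simp: t1_def)
    have "achieves body t1 T M' (I i)"
      by (rule step) (use Suc.prems t1 insens in \<open>auto simp: t1_def\<close>)
    then obtain u2 t2 where b: "run body t1 u2 t2" "u2 \<le> T" "\<And>a. a \<notin> M' \<Longrightarrow> t2 a = t1 a" "I i t2"
      by (rule achievesE) (rule that)
    have "t2 a = s a" if "a \<notin> M" for a using b(3)[of a] t1[OF that] M(1) that by auto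
    moreover have "t2 r = int i" using b(3)[OF M(2)] by (simp add: t1_def)
    ultimately obtain u3 s' where w: "run (While r (Seq (Sub r r ONE) body)) t2 u3 s'"
      "u3 \<le> i * (T + 2) + 1" "\<forall>a. a \<notin> M \<longrightarrow> s' a = s a" "I 0 s'"
      using Suc.IH[of t2] Suc.prems(1) b(4) by auto
    have "run (While r (Seq (Sub r r ONE) body)) t ((1 + u2) + u3 + 1) s'"
      by (rule run.WhileTrue[OF _ run.Seq[OF sub b(1)] w(1)]) (use Suc.prems(3) in simp)
    then show ?case using w(2-4) b(2)
      by (intro exI[of _ "(1 + u2) + u3 + 1"] exI[of _ s'])
         (auto simp: algebra_simps)
  qed
  have start: "run (Add r c ZERO) s 1 (s(r := int N))"
    using run.Add[of r c ZERO s] s(2,3) by simp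
  obtain u s' where u: "run (While r (Seq (Sub r r ONE) body)) (s(r := int N)) u s'"
    "u \<le> N * (T + 2) + 1" "\<forall>a. a \<notin> M \<longrightarrow> s' a = s a" "I 0 s'"
  proof (rule exE[OF loop[of N "s(r := int N)"]])
    show "(s(r := int N)) a = s a" if "a \<notin> M" for a using that M(1) by auto
  qed (use insens[OF init] in auto)
  show ?thesis
    unfolding For_def
  proof (rule achievesI[OF run.Seq[OF start u(1)]])
    have "N * (T + 2) \<le> B * (T + 2)" using B by (rule mult_le_mono1)
    then show "1 + u \<le> T'" using u(2) T' by linarith
  qed (use u(3,4) in auto)
qed

section \<open>The program\<close>

text \<open>Registers are small negative addresses. Within a sweep, subprograms that are nested more deeply use smaller
  addresses, so that the registers that one of them may change form an interval.\<close>

abbreviation "BOUNDS \<equiv> - 3 :: int"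
abbreviation "RESULT \<equiv> - 4 :: int"
abbreviation "ALIVE \<equiv> - 24 :: int"
abbreviation "ROUND \<equiv> - 25 :: int"
abbreviation "SUBROUND \<equiv> - 26 :: int"
abbreviation "COL \<equiv> - 27 :: int"
abbreviation "CURRENT \<equiv> - 28 :: int"
abbreviation "ROW \<equiv> - 29 :: int"
abbreviation "VIOLATED \<equiv> - 30 :: int"
abbreviation "LEVEL \<equiv> - 31 :: int"
abbreviation "OTHER \<equiv> - 32 :: int"
abbreviation "SUPPORTED \<equiv> - 33 :: int"
abbreviation "DIFF \<equiv> - 34 :: int"
abbreviation "CELL \<equiv> - 35 :: int"
abbreviation "VAL \<equiv> - 36 :: int"
abbreviation "FLAG \<equiv> - 37 :: int"
abbreviation "PTR \<equiv> - 38 :: int"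
abbreviation "COUNT \<equiv> - 39 :: int"

text \<open>The entry in row \<open>i\<close> and column \<open>j\<close> occupies the cells \<open>2 + 2 * (i * n + j)\<close> and its successor. As the machine
cannot multiply, \<open>fetch\<close> computes \<open>i * n\<close> in a loop of \<open>i\<close> additions before \<open>locate\<close> takes over.\<close>

definition locate :: "int \<Rightarrow> prog" where
  "locate rj = Seq (Add PTR PTR rj) (Seq (Add PTR PTR PTR) (Seq (Const FLAG 2) (Seq (Add PTR PTR FLAG)
    (Seq (Load FLAG PTR) (Seq (Add PTR PTR ONE) (Load VAL PTR))))))"

definition fetch :: "int \<Rightarrow> int \<Rightarrow> prog" where
  "fetch ri rj = Seq (Const PTR 0) (Seq (For COUNT ri (Add PTR PTR 1)) (locate rj))"

text \<open>An array is laid out downwards from the address \<open>base\<close>, on the negative side of memory, where it cannot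
collide with the input.\<close>

definition read_cell :: "int \<Rightarrow> int \<Rightarrow> int \<Rightarrow> prog" where
  "read_cell base x r = Seq (Const x base) (Seq (Sub x x r) (Load x x))"

definition write_cell :: "int \<Rightarrow> int \<Rightarrow> int \<Rightarrow> prog" where
  "write_cell base r y = Seq (Const PTR base) (Seq (Sub PTR PTR r) (Store PTR y))"

lemma exec_read_cell:
  "base < x \<Longrightarrow> r \<noteq> x \<Longrightarrow> 0 \<le> s r \<Longrightarrow> exec (read_cell base x r) s = s(x := s (base - s r))"
  by (auto simp: read_cell_def)

lemma exec_write_cell:
  "r \<noteq> PTR \<Longrightarrow> y \<noteq> PTR \<Longrightarrow> exec (write_cell base r y) s = (s(PTR := base - s r))(base - s r := s y)"
  by (simp add: write_cell_def)

lemma read_write_cell_simps [simp]: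
  "loop_free (read_cell base x r)" "cost (read_cell base x r) = 3"
  "loop_free (write_cell base r y)" "cost (write_cell base r y) = 3"
  by (simp_all add: read_cell_def write_cell_def)

text \<open>The machine only tests for positivity, so \<open>VAL + CELL \<ge> LEVEL\<close> becomes \<open>VAL + CELL - LEVEL + 1 > 0\<close>.\<close>

definition support_test :: prog where
  "support_test = Seq (Add DIFF VAL CELL) (Seq (Sub DIFF DIFF LEVEL) (Seq (Add DIFF DIFF ONE)
     (If DIFF (Const SUPPORTED 1) Skip)))"

text \<open>One step of the search for a column \<open>OTHER \<noteq> COL\<close> that answers row \<open>ROW\<close> for column \<open>COL\<close>, whose side of the
inequality is in \<open>LEVEL\<close>. The two copies of the test come from splitting \<open>\<noteq>\<close> into \<open>>\<close> and \<open><\<close>.\<close>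

definition support_step :: "int \<Rightarrow> prog" where
  "support_step base = Seq (fetch ROW OTHER) (Seq (read_cell base CELL OTHER)
     (If FLAG (If CELL (Seq (Sub DIFF OTHER COL) (If DIFF support_test
        (Seq (Sub DIFF COL OTHER) (If DIFF support_test Skip)))) Skip) Skip))"

definition check_row :: "int \<Rightarrow> prog" where
  "check_row base = Seq (fetch ROW COL) (If FLAG (Seq (Seq (Add LEVEL VAL CURRENT) (Const SUPPORTED 0))
     (Seq (For OTHER 1 (support_step base)) (If SUPPORTED Skip (Const VIOLATED 1)))) Skip)"

definition lower_prog :: "int \<Rightarrow> prog" where
  "lower_prog base = Seq (Seq (read_cell base CURRENT COL) (Const VIOLATED 0)) (Seq (For ROW 0 (check_row base))
     (If CURRENT (If VIOLATED (Seq (Sub CURRENT CURRENT ONE) (write_cell base COL CURRENT)) Skip) Skip))"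

definition sweep_prog :: "int \<Rightarrow> prog" where
  "sweep_prog base = For COL 1 (lower_prog base)"

definition rounds_prog :: "int \<Rightarrow> prog" where
  "rounds_prog base = For ROUND 1 (For SUBROUND BOUNDS (sweep_prog base))"

text \<open>Each of the nested loops has its own counter register. The array of the descent starts below the last of
them, at \<open>- 40 - int k\<close>.\<close>

definition deletion_reg :: "nat \<Rightarrow> int" where
  "deletion_reg i = - 40 - int i"

primrec delete_prog :: "int \<Rightarrow> nat \<Rightarrow> prog" where
  "delete_prog base 0 = Skip"
| "delete_prog base (Suc i) = Seq (delete_prog base i) (write_cell base (deletion_reg i) ZERO)"

definition verdict_prog :: "int \<Rightarrow> prog" where
  "verdict_prog base = Seq (Const ALIVE 0)
     (Seq (For COL 1 (Seq (read_cell base CURRENT COL) (If CURRENT (Const ALIVE 1) Skip)))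
     (If ALIVE Skip (Const RESULT 1)))"

text \<open>The whole descent for one choice of the deleted columns: all levels start at the content of \<open>BOUNDS\<close>, those of
the deleted columns are reset to 0, and \<open>RESULT\<close> becomes 1 if no column survives.\<close>

definition core_prog :: "nat \<Rightarrow> prog" where
  "core_prog k = (let base = - 40 - int k in Seq (For COL 1 (write_cell base COL BOUNDS))
     (Seq (delete_prog base k) (Seq (rounds_prog base) (verdict_prog base))))"

primrec enumerate_prog :: "nat \<Rightarrow> nat \<Rightarrow> prog" where
  "enumerate_prog k 0 = core_prog k"
| "enumerate_prog k (Suc i) = For (deletion_reg i) 1 (enumerate_prog k i)"

text \<open>Computes the starting level, one plus \<open>n\<close> times the sum of \<open>2 * \<bar>a\<bar>\<close> over all finite entries \<open>a\<close>.
It exceeds \<open>2 * n * \<bar>a\<bar>\<close> for every single entry, as the descent requires.\<close>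

definition bound_prog :: prog where
  "bound_prog = Seq (Const BOUNDS 1) (For COL 1 (For ROW 0 (For OTHER 1 (Seq (fetch ROW OTHER)
     (If VAL (Seq (Add BOUNDS BOUNDS VAL) (Add BOUNDS BOUNDS VAL)) (Seq (Sub BOUNDS BOUNDS VAL) (Sub BOUNDS BOUNDS VAL)))))))"

definition rank_prog :: "nat \<Rightarrow> prog" where
  "rank_prog k = Seq (Const ONE 1) (Seq bound_prog (Seq (enumerate_prog k k) (Add 0 RESULT ZERO)))"

text \<open>The number \<open>b\<close> bounds the dimensions, so that running times can be expressed by functions of \<open>b\<close> alone.\<close>

locale matrix_in_memory =
  fixes A :: "ereal mat" and b :: nat
  assumes dims: "dim_row A \<le> b" "dim_col A \<le> b"
begin

definition entry_value :: "nat \<Rightarrow> nat \<Rightarrow> int" where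
  "entry_value i j = \<lfloor>real_of_ereal (A $$ (i, j))\<rfloor>"

text \<open>The part of memory that the whole program relies on: the unchanged input and the two constants.\<close>

definition loaded :: "memory \<Rightarrow> bool" where
  "loaded s \<longleftrightarrow> (\<forall>a\<ge>0. s a = encode_mat A a) \<and> s ONE = 1 \<and> s ZERO = 0"

lemma loadedD:
  assumes "loaded s"
  shows "s 0 = int (dim_row A)" "s 1 = int (dim_col A)" "s ONE = 1" "s ZERO = 0"
  using assms by (auto simp: loaded_def encode_mat_def)

lemma loaded_frame:
  assumes "loaded s" "\<And>a. a \<notin> M \<Longrightarrow> t a = s a" "\<And>a. a \<in> M \<Longrightarrow> a < ZERO"
  shows "loaded t"
proof -
  have "t a = s a" if "ZERO \<le> a" for a using assms(2)[of a] assms(3)[of a] that by fastforce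
  then show ?thesis using assms(1) by (simp add: loaded_def)
qed

lemma encode_mat_entry:
  assumes "i < dim_row A" "j < dim_col A"
  shows "encode_mat A (2 + 2 * int (i * dim_col A + j)) = (if A $$ (i, j) = -\<infinity> then 0 else 1)"
    and "encode_mat A (3 + 2 * int (i * dim_col A + j)) = entry_value i j"
proof -
  let ?q = "i * dim_col A + j"
  have "Suc i * dim_col A \<le> dim_row A * dim_col A" using assms(1) by (intro mult_le_mono1) simp
  then have "?q < dim_row A * dim_col A" using assms(2) by simp
  then have q: "int ?q < int (dim_row A) * int (dim_col A)" by (metis of_nat_less_iff of_nat_mult)
  have div: "?q div dim_col A = i" "?q mod dim_col A = j" using assms(2) by auto
  have half: "(2 + 2 * int ?q - 2) div 2 = int ?q" "(3 + 2 * int ?q - 2) div 2 = int ?q" by auto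
  have range: "2 + 2 * int ?q < 2 + 2 * int (dim_row A) * int (dim_col A)"
    "3 + 2 * int ?q < 2 + 2 * int (dim_row A) * int (dim_col A)"
  proof -
    obtain Q P where QP: "int ?q = Q" "int (dim_row A) * int (dim_col A) = P" by blast
    show "2 + 2 * int ?q < 2 + 2 * int (dim_row A) * int (dim_col A)"
      "3 + 2 * int ?q < 2 + 2 * int (dim_row A) * int (dim_col A)"
      using q unfolding mult.assoc QP by simp_all
  qed
  show "encode_mat A (2 + 2 * int ?q) = (if A $$ (i, j) = -\<infinity> then 0 else 1)"
    unfolding encode_mat_def half Let_def using range(1) div by (simp del: of_nat_add of_nat_mult)
  show "encode_mat A (3 + 2 * int ?q) = entry_value i j"
    unfolding encode_mat_def half Let_def using range(2) div
    by (simp add: entry_value_def del: of_nat_add of_nat_mult)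
qed

lemma fetch_correct:
  assumes s: "loaded s" "s ri = int i" "s rj = int j" and ij: "i < dim_row A" "j < dim_col A"
    and reg: "ri \<notin> {- 39..- 36}" "rj \<notin> {- 39..- 36}"
  shows "achieves (fetch ri rj) s (3 * b + 10) {- 39..- 36}
    (\<lambda>t. t FLAG = (if A $$ (i, j) = -\<infinity> then 0 else 1) \<and> t VAL = entry_value i j)"
  unfolding fetch_def
proof (rule achieves_Seq)
  show "achieves (Const PTR 0) s 1 {PTR} (\<lambda>t. t PTR = 0)" by (rule achieves_exec) auto
  fix t assume t: "\<And>a. a \<notin> {PTR} \<Longrightarrow> t a = s a" "t PTR = 0"
  have lt: "loaded t" by (rule loaded_frame[where M = "{PTR}", OF s(1) t(1)]) auto
  show "achieves (Seq (For COUNT ri (Add PTR PTR 1)) (locate rj)) t (3 * b + 9) {- 39..- 36}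
    (\<lambda>t. t FLAG = (if A $$ (i, j) = -\<infinity> then 0 else 1) \<and> t VAL = entry_value i j)"
  proof (rule achieves_Seq)
    show "achieves (For COUNT ri (Add PTR PTR 1)) t (3 * b + 2) {COUNT, PTR}
        (\<lambda>u. u PTR = (int i - int 0) * int (dim_col A))"
    proof (rule achieves_For[where N = i and B = b and M' = "{PTR}" and T = 1])
      show "t ri = int i" using t(1)[of ri] reg(1) s(2) by auto
      fix i' u assume u: "i' < i" "\<And>a. a \<notin> {COUNT, PTR} \<Longrightarrow> u a = t a" "u COUNT = int i'"
        "u PTR = (int i - int (Suc i')) * int (dim_col A)"
      have "u 1 = int (dim_col A)" using u(2)[of 1] loadedD(2)[OF lt] by simp
      then show "achieves (Add PTR PTR 1) u 1 {PTR} (\<lambda>u. u PTR = (int i - int i') * int (dim_col A))"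
        by (intro achieves_exec) (auto simp: u(4) algebra_simps)
    qed (use loadedD[OF lt] dims ij t(2) in auto)
    fix u assume u: "\<And>a. a \<notin> {COUNT, PTR} \<Longrightarrow> u a = t a" "u PTR = (int i - int 0) * int (dim_col A)"
    have lu: "loaded u" by (rule loaded_frame[where M = "{COUNT, PTR}", OF lt u(1)]) auto
    let ?q = "i * dim_col A + j"
    have ptr: "u PTR + u rj = int ?q" using u t(1)[of rj] reg(2) s(3) by auto
    have rj: "rj \<noteq> PTR" using reg(2) by auto
    have cells: "u (2 + 2 * int ?q) = (if A $$ (i, j) = -\<infinity> then 0 else 1)"
      "u (3 + 2 * int ?q) = entry_value i j"
      using lu encode_mat_entry[OF ij] by (simp_all add: loaded_def)
    have one: "u ONE = 1" by (rule loadedD(3)[OF lu])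
    have ne: "int ?q + int ?q + 2 \<noteq> FLAG" "int ?q + int ?q + 2 \<noteq> PTR"
      "int ?q + int ?q + 3 \<noteq> FLAG" "int ?q + int ?q + 3 \<noteq> PTR" by linarith+
    have ex: "exec (locate rj) u =
        u(PTR := int ?q + int ?q + 3, FLAG := u (int ?q + int ?q + 2), VAL := u (int ?q + int ?q + 3))"
    proof -
      have "exec (locate rj) u = exec (Seq (Load FLAG PTR) (Seq (Add PTR PTR ONE) (Load VAL PTR)))
          (u(PTR := int ?q + int ?q + 2, FLAG := 2))"
        unfolding locate_def using rj ptr by (simp del: of_nat_add of_nat_mult add: fun_upd_twist)
      also have "\<dots> = u(PTR := int ?q + int ?q + 3, FLAG := u (int ?q + int ?q + 2), VAL := u (int ?q + int ?q + 3))"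
        using ne one by (auto simp del: of_nat_add of_nat_mult simp add: fun_eq_iff add.assoc)
      finally show ?thesis .
    qed
    show "achieves (locate rj) u 7 {PTR, FLAG, VAL}
        (\<lambda>t. t FLAG = (if A $$ (i, j) = -\<infinity> then 0 else 1) \<and> t VAL = entry_value i j)"
    proof (rule achieves_exec)
      show "loop_free (locate rj)" "cost (locate rj) \<le> 7" by (simp_all add: locate_def)
      show "exec (locate rj) u a = u a" if "a \<notin> {PTR, FLAG, VAL}" for a using that by (simp add: ex)
      have two: "int ?q + int ?q = 2 * int ?q" by simp
      show "exec (locate rj) u FLAG = (if A $$ (i, j) = -\<infinity> then 0 else 1) \<and> exec (locate rj) u VAL = entry_value i j"
        unfolding ex two using cells by (simp add: add.commute del: of_nat_add of_nat_mult)
    qed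
  qed auto
qed auto

end

section \<open>Correctness of the descent program\<close>

lemma if_one_or: "(if P then 1 else if Q then 1 else 0 :: int) = (if P \<or> Q then 1 else 0)"
  by simp

lemma ex_from_split:
  assumes "r < (n :: nat)"
  shows "(\<exists>l. r \<le> l \<and> l < n \<and> P l) \<longleftrightarrow> P r \<or> (\<exists>l. Suc r \<le> l \<and> l < n \<and> P l)"
proof
  assume "\<exists>l. r \<le> l \<and> l < n \<and> P l"
  then obtain l where l: "r \<le> l" "l < n" "P l" by blast
  show "P r \<or> (\<exists>l. Suc r \<le> l \<and> l < n \<and> P l)"
  proof (cases "l = r")
    case False
    then have "Suc r \<le> l" using l(1) by simp
    then show ?thesis using l by blast
  qed (use l in simp)
next
  assume "P r \<or> (\<exists>l. Suc r \<le> l \<and> l < n \<and> P l)"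
  then show "\<exists>l. r \<le> l \<and> l < n \<and> P l" using assms Suc_leD by blast
qed

text \<open>The running times that the loop rule delivers when the dimensions are at most \<open>b\<close> and the starting level is at
most \<open>B\<close>.\<close>

definition row_time :: "nat \<Rightarrow> nat" where
  "row_time b = b * (3 * b + 26) + 3 * b + 17"

definition lower_time :: "nat \<Rightarrow> nat" where
  "lower_time b = b * (row_time b + 2) + 12"

definition sweep_time :: "nat \<Rightarrow> nat" where
  "sweep_time b = b * (lower_time b + 2) + 2"

definition rounds_time :: "nat \<Rightarrow> nat \<Rightarrow> nat" where
  "rounds_time b B = b * (B * (sweep_time b + 2) + 2 + 2) + 2"

context matrix_in_memory
begin

abbreviation "row_violated_here \<equiv> row_violated (dim_col A) (\<lambda>i j. A $$ (i, j)) entry_value"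
abbreviation "lower_here \<equiv> lower (dim_row A) (dim_col A) (\<lambda>i j. A $$ (i, j)) entry_value"
abbreviation "sweep_here \<equiv> sweep_from (dim_row A) (dim_col A) (\<lambda>i j. A $$ (i, j)) entry_value"

definition stores :: "int \<Rightarrow> (nat \<Rightarrow> int) \<Rightarrow> memory \<Rightarrow> bool" where
  "stores base v s \<longleftrightarrow> (\<forall>j<dim_col A. s (base - int j) = v j)"

lemma storesD: "stores base v s \<Longrightarrow> j < dim_col A \<Longrightarrow> s (base - int j) = v j"
  by (simp add: stores_def)

lemma stores_frame:
  assumes "stores base v s" "\<And>a. a \<notin> M \<Longrightarrow> t a = s a" "\<And>a. a \<in> M \<Longrightarrow> base < a"
  shows "stores base v t"
proof -
  have "t a = s a" if "a \<le> base" for a using assms(2)[of a] assms(3)[of a] that by fastforce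
  then show ?thesis using assms(1) by (simp add: stores_def)
qed

lemma support_step_correct:
  assumes t: "loaded t" "stores base v t" "base \<le> - 40"
    and regs: "t COL = int j" "t ROW = int i" "t OTHER = int l" "t LEVEL = entry_value i j + v j"
    and il: "i < dim_row A" "l < dim_col A"
  shows "achieves (support_step base) t (3 * b + 24) {- 39..- 33}
    (\<lambda>u. u SUPPORTED = (if l \<noteq> j \<and> A $$ (i, l) \<noteq> -\<infinity> \<and> 0 < v l \<and>
        entry_value i j + v j \<le> entry_value i l + v l then 1 else t SUPPORTED))"
  unfolding support_step_def
proof (rule achieves_Seq)
  show "achieves (fetch ROW OTHER) t (3 * b + 10) {- 39..- 36}
      (\<lambda>u. u FLAG = (if A $$ (i, l) = -\<infinity> then 0 else 1) \<and> u VAL = entry_value i l)"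
    by (rule fetch_correct[OF t(1) regs(2,3) il]) auto
  fix u assume u: "\<And>a. a \<notin> {- 39..- 36} \<Longrightarrow> u a = t a"
    "u FLAG = (if A $$ (i, l) = -\<infinity> then 0 else 1) \<and> u VAL = entry_value i l"
  have su: "stores base v u" by (rule stores_frame[where M = "{- 39..- 36}", OF t(2) u(1)]) (use t(3) in auto)
  have r: "u COL = int j" "u OTHER = int l" "u LEVEL = entry_value i j + v j" "u SUPPORTED = t SUPPORTED" "u ONE = 1"
    using u(1) regs loadedD(3)[OF t(1)] by simp_all
  have cell: "u (base - int l) = v l" by (rule storesD[OF su il(2)])
  have rd: "exec (read_cell base CELL OTHER) u = u(CELL := v l)"
    using exec_read_cell[of base CELL OTHER u] t(3) r cell by simp
  show "achieves (Seq (read_cell base CELL OTHER)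
       (If FLAG (If CELL (Seq (Sub DIFF OTHER COL) (If DIFF support_test
          (Seq (Sub DIFF COL OTHER) (If DIFF support_test Skip)))) Skip) Skip)) u 14 {- 39..- 33}
    (\<lambda>u. u SUPPORTED = (if l \<noteq> j \<and> A $$ (i, l) \<noteq> -\<infinity> \<and> 0 < v l \<and>
        entry_value i j + v j \<le> entry_value i l + v l then 1 else t SUPPORTED))"
    by (rule achieves_exec) (use u(2) r in \<open>auto simp: rd support_test_def\<close>)
qed auto

text \<open>The loop over \<open>OTHER\<close> sets \<open>SUPPORTED\<close> as soon as one column answers the row; \<open>VIOLATED\<close> accumulates over the
rows.\<close>

lemma check_row_correct:
  assumes t: "loaded t" "stores base v t" "base \<le> - 40"
    and regs: "t COL = int j" "t ROW = int i" "t CURRENT = v j"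
    and ij: "i < dim_row A" "j < dim_col A"
  shows "achieves (check_row base) t (row_time b) {- 39..- 30}
    (\<lambda>u. u VIOLATED = (if row_violated_here v j i then 1 else t VIOLATED))"
  unfolding check_row_def
proof (rule achieves_Seq)
  let ?supports = "\<lambda>l. l \<noteq> j \<and> A $$ (i, l) \<noteq> -\<infinity> \<and> 0 < v l \<and> entry_value i j + v j \<le> entry_value i l + v l"
  show "achieves (fetch ROW COL) t (3 * b + 10) {- 39..- 36}
      (\<lambda>u. u FLAG = (if A $$ (i, j) = -\<infinity> then 0 else 1) \<and> u VAL = entry_value i j)"
    by (rule fetch_correct[OF t(1) regs(2,1) ij]) auto
  fix u assume u: "\<And>a. a \<notin> {- 39..- 36} \<Longrightarrow> u a = t a"
    "u FLAG = (if A $$ (i, j) = -\<infinity> then 0 else 1) \<and> u VAL = entry_value i j"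
  have lu: "loaded u" by (rule loaded_frame[where M = "{- 39..- 36}", OF t(1) u(1)]) auto
  have su: "stores base v u" by (rule stores_frame[where M = "{- 39..- 36}", OF t(2) u(1)]) (use t(3) in auto)
  have ru: "u COL = int j" "u ROW = int i" "u CURRENT = v j" "u VIOLATED = t VIOLATED"
    using u(1) regs by simp_all
  show "achieves (If FLAG (Seq (Seq (Add LEVEL VAL CURRENT) (Const SUPPORTED 0))
     (Seq (For OTHER 1 (support_step base)) (If SUPPORTED Skip (Const VIOLATED 1)))) Skip)
     u (b * (3 * b + 26) + 7) {- 39..- 30}
    (\<lambda>u. u VIOLATED = (if row_violated_here v j i then 1 else t VIOLATED))"
  proof (rule achieves_If)
    assume "0 < u FLAG"
    then have finite: "A $$ (i, j) \<noteq> -\<infinity>" using u(2) by (auto split: if_splits)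
    show "achieves (Seq (Seq (Add LEVEL VAL CURRENT) (Const SUPPORTED 0))
        (Seq (For OTHER 1 (support_step base)) (If SUPPORTED Skip (Const VIOLATED 1))))
        u (b * (3 * b + 26) + 6) {- 39..- 30}
        (\<lambda>u. u VIOLATED = (if row_violated_here v j i then 1 else t VIOLATED))"
    proof (rule achieves_Seq)
      show "achieves (Seq (Add LEVEL VAL CURRENT) (Const SUPPORTED 0)) u 2 {LEVEL, SUPPORTED}
          (\<lambda>x. x LEVEL = entry_value i j + v j \<and> x SUPPORTED = 0)"
        by (rule achieves_exec) (use u(2) ru in auto)
      fix x assume x: "\<And>a. a \<notin> {LEVEL, SUPPORTED} \<Longrightarrow> x a = u a"
        "x LEVEL = entry_value i j + v j \<and> x SUPPORTED = 0"
      have lx: "loaded x" by (rule loaded_frame[where M = "{LEVEL, SUPPORTED}", OF lu x(1)]) auto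
      have sx: "stores base v x"
        by (rule stores_frame[where M = "{LEVEL, SUPPORTED}", OF su x(1)]) (use t(3) in auto)
      have rx: "x COL = int j" "x ROW = int i" "x VIOLATED = t VIOLATED" using x(1) ru by simp_all
      show "achieves (Seq (For OTHER 1 (support_step base)) (If SUPPORTED Skip (Const VIOLATED 1)))
          x (b * (3 * b + 26) + 4) {- 39..- 30}
          (\<lambda>u. u VIOLATED = (if row_violated_here v j i then 1 else t VIOLATED))"
      proof (rule achieves_Seq)
        let ?I = "\<lambda>r y. y SUPPORTED = (if \<exists>l. r \<le> l \<and> l < dim_col A \<and> ?supports l then 1 else 0)"
        show "achieves (For OTHER 1 (support_step base)) x (b * (3 * b + 26) + 2) {- 39..- 32} (?I 0)"
        proof (rule achieves_For[where N = "dim_col A" and B = b and M' = "{- 39..- 33}" and T = "3 * b + 24"])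
          fix r y assume r: "r < dim_col A" and y: "\<And>a. a \<notin> {- 39..- 32} \<Longrightarrow> y a = x a"
            "y OTHER = int r" "?I (Suc r) y"
          have ly: "loaded y" by (rule loaded_frame[where M = "{- 39..- 32}", OF lx y(1)]) auto
          have sy: "stores base v y"
            by (rule stores_frame[where M = "{- 39..- 32}", OF sx y(1)]) (use t(3) in auto)
          have ry: "y COL = int j" "y ROW = int i" "y LEVEL = entry_value i j + v j"
            using y(1) rx x(2) by simp_all
          have split: "(\<exists>l. r \<le> l \<and> l < dim_col A \<and> ?supports l) \<longleftrightarrow>
              ?supports r \<or> (\<exists>l. Suc r \<le> l \<and> l < dim_col A \<and> ?supports l)"
            by (rule ex_from_split[OF r])
          show "achieves (support_step base) y (3 * b + 24) {- 39..- 33} (?I r)"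
            unfolding split
            by (rule achieves_weaken[OF support_step_correct[OF ly sy t(3) ry(1,2) y(2) ry(3) ij(1) r]])
               (simp_all only: y(3) if_one_or order_refl)
        qed (use loadedD[OF lx] dims x(2) in auto)
        fix y assume y: "\<And>a. a \<notin> {- 39..- 32} \<Longrightarrow> y a = x a" "?I 0 y"
        have "row_violated_here v j i \<longleftrightarrow> \<not> (\<exists>l. 0 \<le> l \<and> l < dim_col A \<and> ?supports l)"
          using finite by (auto simp: row_violated_def)
        moreover have "y VIOLATED = t VIOLATED" using y(1) rx by simp
        ultimately show "achieves (If SUPPORTED Skip (Const VIOLATED 1)) y 2 {VIOLATED}
            (\<lambda>u. u VIOLATED = (if row_violated_here v j i then 1 else t VIOLATED))"
          by (intro achieves_exec) (use y(2) in auto)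
      qed auto
    qed auto
  next
    assume "\<not> 0 < u FLAG"
    then have "A $$ (i, j) = -\<infinity>" using u(2) by (auto split: if_splits)
    then have "\<not> row_violated_here v j i" by (simp add: row_violated_def)
    then show "achieves Skip u (b * (3 * b + 26) + 6) {- 39..- 30}
        (\<lambda>u. u VIOLATED = (if row_violated_here v j i then 1 else t VIOLATED))"
      by (intro achieves_exec) (use ru in auto)
  qed auto
qed (auto simp: row_time_def)

lemma lower_prog_correct:
  assumes t: "loaded t" "stores base v t" "base \<le> - 40" "t COL = int j" and j: "j < dim_col A"
  shows "achieves (lower_prog base) t (lower_time b) ({- 39..- 28} \<union> {..base}) (stores base (lower_here j v))"
  unfolding lower_prog_def
proof (rule achieves_Seq)
  have rd: "exec (read_cell base CURRENT COL) t = t(CURRENT := v j)"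
    using exec_read_cell[of base CURRENT COL t] t storesD[OF t(2) j] by simp
  show "achieves (Seq (read_cell base CURRENT COL) (Const VIOLATED 0)) t 4 {CURRENT, VIOLATED}
      (\<lambda>u. u CURRENT = v j \<and> u VIOLATED = 0)"
    by (rule achieves_exec) (auto simp: rd)
  fix u assume u: "\<And>a. a \<notin> {CURRENT, VIOLATED} \<Longrightarrow> u a = t a" "u CURRENT = v j \<and> u VIOLATED = 0"
  have lu: "loaded u" by (rule loaded_frame[where M = "{CURRENT, VIOLATED}", OF t(1) u(1)]) auto
  have su: "stores base v u"
    by (rule stores_frame[where M = "{CURRENT, VIOLATED}", OF t(2) u(1)]) (use t(3) in auto)
  have ru: "u COL = int j" using u(1) t(4) by simp
  let ?I = "\<lambda>r x. x VIOLATED = (if \<exists>i. r \<le> i \<and> i < dim_row A \<and> row_violated_here v j i then 1 else 0)"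
  show "achieves (Seq (For ROW 0 (check_row base))
     (If CURRENT (If VIOLATED (Seq (Sub CURRENT CURRENT ONE) (write_cell base COL CURRENT)) Skip) Skip))
     u (b * (row_time b + 2) + 8) ({- 39..- 28} \<union> {..base}) (stores base (lower_here j v))"
  proof (rule achieves_Seq)
    show "achieves (For ROW 0 (check_row base)) u (b * (row_time b + 2) + 2) {- 39..- 29}
        (\<lambda>x. x VIOLATED = (if \<exists>i. 0 \<le> i \<and> i < dim_row A \<and> row_violated_here v j i then 1 else 0))"
    proof (rule achieves_For[where N = "dim_row A" and B = b and M' = "{- 39..- 30}" and T = "row_time b" and I = ?I])
      fix r x assume r: "r < dim_row A" and x: "\<And>a. a \<notin> {- 39..- 29} \<Longrightarrow> x a = u a"
        "x ROW = int r" "?I (Suc r) x"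
      have lx: "loaded x" by (rule loaded_frame[where M = "{- 39..- 29}", OF lu x(1)]) auto
      have sx: "stores base v x"
        by (rule stores_frame[where M = "{- 39..- 29}", OF su x(1)]) (use t(3) in auto)
      have rx: "x COL = int j" "x CURRENT = v j" using x(1) ru u(2) by simp_all
      have split: "(\<exists>i. r \<le> i \<and> i < dim_row A \<and> row_violated_here v j i) \<longleftrightarrow>
          row_violated_here v j r \<or> (\<exists>i. Suc r \<le> i \<and> i < dim_row A \<and> row_violated_here v j i)"
        by (rule ex_from_split[OF r])
      show "achieves (check_row base) x (row_time b) {- 39..- 30} (?I r)"
        unfolding split
        by (rule achieves_weaken[OF check_row_correct[OF lx sx t(3) rx(1) x(2) rx(2) r j]])
           (simp_all only: x(3) if_one_or order_refl)
    qed (use loadedD[OF lu] dims u(2) in auto)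
    fix x assume x: "\<And>a. a \<notin> {- 39..- 29} \<Longrightarrow> x a = u a"
      "x VIOLATED = (if \<exists>i. 0 \<le> i \<and> i < dim_row A \<and> row_violated_here v j i then 1 else 0)"
    have sx: "stores base v x"
      by (rule stores_frame[where M = "{- 39..- 29}", OF su x(1)]) (use t(3) in auto)
    have rx: "x COL = int j" "x CURRENT = v j" "x ONE = 1" using x(1) ru u(2) loadedD(3)[OF lu] by simp_all
    let ?c = "If CURRENT (If VIOLATED (Seq (Sub CURRENT CURRENT ONE) (write_cell base COL CURRENT)) Skip) Skip"
    have ex: "exec ?c x = (if 0 < v j \<and> (\<exists>i<dim_row A. row_violated_here v j i)
        then x(CURRENT := v j - 1, PTR := base - int j, base - int j := v j - 1) else x)"
      using x(2) rx t(3) by (auto simp: exec_write_cell)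
    show "achieves ?c x 6 ({CURRENT, PTR} \<union> {..base}) (stores base (lower_here j v))"
    proof (rule achieves_exec)
      show "exec ?c x a = x a" if "a \<notin> {CURRENT, PTR} \<union> {..base}" for a using that unfolding ex by auto
      show "stores base (lower_here j v) (exec ?c x)"
        using sx t(3) unfolding ex stores_def by (auto simp: lower_def)
    qed simp_all
  qed auto
qed (auto simp: lower_time_def)

lemma sweep_prog_correct:
  assumes t: "loaded t" "stores base v t" "base \<le> - 40"
  shows "achieves (sweep_prog base) t (sweep_time b) ({- 39..- 27} \<union> {..base}) (stores base (sweep_here 0 v))"
  unfolding sweep_prog_def
proof (rule achieves_For[where N = "dim_col A" and B = b and M' = "{- 39..- 28} \<union> {..base}" and T = "lower_time b"
      and I = "\<lambda>r. stores base (sweep_here r v)"])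
  show "stores base (sweep_here (dim_col A) v) t" using t(2) by (simp add: sweep_from_end)
  show "stores base (sweep_here r v) (u(COL := x))" if "stores base (sweep_here r v) u" for r u x
    using that t(3) by (simp add: stores_def)
  fix r u assume r: "r < dim_col A" and u: "\<And>a. a \<notin> {- 39..- 27} \<union> {..base} \<Longrightarrow> u a = t a"
    "u COL = int r" "stores base (sweep_here (Suc r) v) u"
  have lu: "loaded u"
    by (rule loaded_frame[where M = "{- 39..- 27} \<union> {..base}", OF t(1) u(1)]) (use t(3) in auto)
  show "achieves (lower_prog base) u (lower_time b) ({- 39..- 28} \<union> {..base}) (stores base (sweep_here r v))"
    using lower_prog_correct[OF lu u(3) t(3) u(2) r] by (simp add: sweep_from_step[OF r])
qed (use loadedD[OF t(1)] dims t(3) in \<open>auto simp: sweep_time_def\<close>)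

text \<open>Two nested loops make \<open>n * K\<close> sweeps, which is the largest possible value of the sum of all levels.\<close>

lemma rounds_prog_correct:
  assumes t: "loaded t" "stores base v t" "base \<le> - 40" "t BOUNDS = int K" "K \<le> B"
  shows "achieves (rounds_prog base) t (rounds_time b B) ({- 39..- 25} \<union> {..base})
    (stores base ((sweep_here 0 ^^ (dim_col A * K)) v))"
proof -
  let ?J = "\<lambda>r. stores base ((sweep_here 0 ^^ ((dim_col A - r) * K)) v)"
  have "achieves (rounds_prog base) t (rounds_time b B) ({- 39..- 25} \<union> {..base}) (?J 0)"
    unfolding rounds_prog_def
  proof (rule achieves_For[where N = "dim_col A" and B = b and M' = "{- 39..- 26} \<union> {..base}"
        and T = "B * (sweep_time b + 2) + 2" and I = ?J])
    show "?J (dim_col A) t" using t(2) by simp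
    show "?J r (u(ROUND := x))" if "?J r u" for r u x
      using that t(3) by (simp add: stores_def)
    fix r u assume r: "r < dim_col A" and u: "\<And>a. a \<notin> {- 39..- 25} \<union> {..base} \<Longrightarrow> u a = t a"
      "u ROUND = int r" "?J (Suc r) u"
    have lu: "loaded u"
      by (rule loaded_frame[where M = "{- 39..- 25} \<union> {..base}", OF t(1) u(1)]) (use t(3) in auto)
    let ?v = "(sweep_here 0 ^^ ((dim_col A - Suc r) * K)) v"
    let ?I = "\<lambda>q. stores base ((sweep_here 0 ^^ (K - q)) ?v)"
    have "achieves (For SUBROUND BOUNDS (sweep_prog base)) u (B * (sweep_time b + 2) + 2)
        ({- 39..- 26} \<union> {..base}) (?I 0)"
    proof (rule achieves_For[where N = K and B = B and M' = "{- 39..- 27} \<union> {..base}"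
          and T = "sweep_time b" and I = ?I])
      show "?I K u" using u(3) by simp
      show "?I q (x(SUBROUND := y))" if "?I q x" for q x y
        using that t(3) by (simp add: stores_def)
      show "u BOUNDS = int K" using u(1)[of BOUNDS] t(3,4) by simp
      fix q x assume q: "q < K" and x: "\<And>a. a \<notin> {- 39..- 26} \<union> {..base} \<Longrightarrow> x a = u a" "?I (Suc q) x"
      have lx: "loaded x"
        by (rule loaded_frame[where M = "{- 39..- 26} \<union> {..base}", OF lu x(1)]) (use t(3) in auto)
      have "K - q = Suc (K - Suc q)" using q by simp
      then show "achieves (sweep_prog base) x (sweep_time b) ({- 39..- 27} \<union> {..base}) (?I q)"
        using sweep_prog_correct[OF lx x(2) t(3)] by simp
    qed (use loadedD[OF lu] t(3,5) in auto)
    moreover have "(sweep_here 0 ^^ ((dim_col A - r) * K)) v = (sweep_here 0 ^^ (K - 0)) ?v"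
    proof -
      have "(dim_col A - r) * K = K + (dim_col A - Suc r) * K"
        using r by (metis Suc_diff_Suc add.commute mult_Suc)
      then show ?thesis by (simp add: funpow_add)
    qed
    ultimately show "achieves (For SUBROUND BOUNDS (sweep_prog base)) u (B * (sweep_time b + 2) + 2)
        ({- 39..- 26} \<union> {..base}) (?J r)" by simp
  qed (use loadedD[OF t(1)] dims t(3) in \<open>auto simp: rounds_time_def\<close>)
  then show ?thesis by simp
qed

end

section \<open>Enumerating the deletions, running time, and the corollary\<close>

lemma if_or: "(if P then a else if Q then a else c) = (if P \<or> Q then a else c)"
  by simp

definition core_time :: "nat \<Rightarrow> nat \<Rightarrow> nat \<Rightarrow> nat" where
  "core_time k b B = 12 * b + 3 * k + 8 + rounds_time b B"

primrec enumerate_time :: "nat \<Rightarrow> nat \<Rightarrow> nat \<Rightarrow> nat \<Rightarrow> nat" where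
  "enumerate_time k b B 0 = core_time k b B"
| "enumerate_time k b B (Suc i) = b * (enumerate_time k b B i + 2) + 2"

definition bound_time :: "nat \<Rightarrow> nat" where
  "bound_time b = b * (b * (b * (3 * b + 15) + 4) + 4) + 3"

context matrix_in_memory
begin

lemma verdict_prog_correct:
  assumes t: "loaded t" "stores base v t" "base \<le> - 40"
  shows "achieves (verdict_prog base) t (7 * b + 5) {- 28, - 27, - 24, RESULT}
    (\<lambda>u. u RESULT = (if \<exists>j<dim_col A. 0 < v j then t RESULT else 1))"
  unfolding verdict_prog_def
proof (rule achieves_Seq)
  show "achieves (Const ALIVE 0) t 1 {ALIVE} (\<lambda>u. u ALIVE = 0)" by (rule achieves_exec) auto
  fix u assume u: "\<And>a. a \<notin> {ALIVE} \<Longrightarrow> u a = t a" "u ALIVE = 0"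
  have lu: "loaded u" by (rule loaded_frame[where M = "{ALIVE}", OF t(1) u(1)]) auto
  have su: "stores base v u" by (rule stores_frame[where M = "{ALIVE}", OF t(2) u(1)]) (use t(3) in auto)
  let ?body = "Seq (read_cell base CURRENT COL) (If CURRENT (Const ALIVE 1) Skip)"
  let ?I = "\<lambda>r x. x ALIVE = (if \<exists>j. r \<le> j \<and> j < dim_col A \<and> 0 < v j then 1 else 0)"
  show "achieves (Seq (For COL 1 ?body) (If ALIVE Skip (Const RESULT 1))) u (7 * b + 4)
      {- 28, - 27, - 24, RESULT} (\<lambda>u. u RESULT = (if \<exists>j<dim_col A. 0 < v j then t RESULT else 1))"
  proof (rule achieves_Seq)
    show "achieves (For COL 1 ?body) u (7 * b + 2) {CURRENT, ALIVE, COL}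
        (\<lambda>x. x ALIVE = (if \<exists>j. 0 \<le> j \<and> j < dim_col A \<and> 0 < v j then 1 else 0))"
    proof (rule achieves_For[where N = "dim_col A" and B = b and M' = "{CURRENT, ALIVE}" and T = 5 and I = ?I])
      fix r x assume r: "r < dim_col A" and x: "\<And>a. a \<notin> {CURRENT, ALIVE, COL} \<Longrightarrow> x a = u a"
        "x COL = int r" "?I (Suc r) x"
      have sx: "stores base v x"
        by (rule stores_frame[where M = "{CURRENT, ALIVE, COL}", OF su x(1)]) (use t(3) in auto)
      have rd: "exec (read_cell base CURRENT COL) x = x(CURRENT := v r)"
        using exec_read_cell[of base CURRENT COL x] t(3) x(2) storesD[OF sx r] by simp
      have ex: "exec ?body x ALIVE = (if 0 < v r then 1 else x ALIVE)" by (simp add: rd)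
      show "achieves ?body x 5 {CURRENT, ALIVE} (?I r)"
      proof (rule achieves_exec)
        show "?I r (exec ?body x)" unfolding ex x(3) if_or ex_from_split[OF r] by (rule refl)
      qed (auto simp: rd)
    qed (use loadedD[OF lu] dims u(2) in auto)
    fix x assume x: "\<And>a. a \<notin> {CURRENT, ALIVE, COL} \<Longrightarrow> x a = u a" "?I 0 x"
    have "x RESULT = t RESULT" using x(1) u(1) by simp
    then show "achieves (If ALIVE Skip (Const RESULT 1)) x 2 {RESULT}
        (\<lambda>u. u RESULT = (if \<exists>j<dim_col A. 0 < v j then t RESULT else 1))"
      by (intro achieves_exec) (use x(2) in auto)
  qed auto
qed auto

lemma init_correct:
  assumes t: "loaded t" "t BOUNDS = K" "base \<le> - 40"
  shows "achieves (For COL 1 (write_cell base COL BOUNDS)) t (5 * b + 2) ({PTR, COL} \<union> {..base})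
    (stores base (\<lambda>_. K))"
proof -
  let ?I = "\<lambda>r x. \<forall>j. r \<le> j \<and> j < dim_col A \<longrightarrow> x (base - int j) = K"
  have "achieves (For COL 1 (write_cell base COL BOUNDS)) t (5 * b + 2) ({PTR, COL} \<union> {..base}) (?I 0)"
  proof (rule achieves_For[where N = "dim_col A" and B = b and M' = "{PTR} \<union> {..base}" and T = 3 and I = ?I])
    fix r x assume r: "r < dim_col A" and x: "\<And>a. a \<notin> {PTR, COL} \<union> {..base} \<Longrightarrow> x a = t a"
      "x COL = int r" "?I (Suc r) x"
    have ex: "exec (write_cell base COL BOUNDS) x = x(PTR := base - int r, base - int r := K)"
      using exec_write_cell[of COL BOUNDS base x] x(1)[of BOUNDS] x(2) t(2,3) by simp
    show "achieves (write_cell base COL BOUNDS) x 3 ({PTR} \<union> {..base}) (?I r)"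
    proof (rule achieves_exec)
      show "?I r (exec (write_cell base COL BOUNDS) x)"
        unfolding ex using x(3) t(3) by (auto dest: le_neq_implies_less)
    qed (auto simp: ex)
  qed (use loadedD[OF t(1)] dims t(3) in auto)
  then show ?thesis by (rule achieves_weaken) (auto simp: stores_def)
qed

lemma delete_prog_exec:
  assumes "t ZERO = 0" "base \<le> - 40" "\<And>i'. i' < i \<Longrightarrow> t (deletion_reg i') = int (d i')"
    and "\<And>i'. i' < i \<Longrightarrow> base < deletion_reg i'"
  shows "loop_free (delete_prog base i)" "cost (delete_prog base i) = 3 * i + 1"
    and "a \<notin> {PTR} \<union> {..base} \<Longrightarrow> exec (delete_prog base i) t a = t a"
    and "exec (delete_prog base i) t (base - int j) = (if j \<in> d ` {..<i} then 0 else t (base - int j))"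
proof -
  show "loop_free (delete_prog base i)" by (induction i) simp_all
  show "cost (delete_prog base i) = 3 * i + 1" by (induction i) simp_all
  have "(\<forall>a. a \<notin> {PTR} \<union> {..base} \<longrightarrow> exec (delete_prog base i) t a = t a) \<and>
      (\<forall>j. exec (delete_prog base i) t (base - int j) = (if j \<in> d ` {..<i} then 0 else t (base - int j)))"
    using assms
  proof (induction i)
    case 0
    then show ?case by simp
  next
    case (Suc i)
    let ?u = "exec (delete_prog base i) t"
    have IH: "\<And>a. a \<notin> {PTR} \<union> {..base} \<Longrightarrow> ?u a = t a"
      "\<And>j. ?u (base - int j) = (if j \<in> d ` {..<i} then 0 else t (base - int j))"
      using Suc.IH Suc.prems by simp_all
    have reg: "deletion_reg i \<noteq> PTR" by (simp add: deletion_reg_def)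
    have "?u (deletion_reg i) = int (d i)" using IH(1)[of "deletion_reg i"] reg Suc.prems(3,4)[of i] by simp
    moreover have "?u ZERO = 0" using IH(1)[of ZERO] Suc.prems(1,2) by simp
    ultimately have ex: "exec (delete_prog base (Suc i)) t = ?u(PTR := base - int (d i), base - int (d i) := 0)"
      using exec_write_cell[OF reg, of ZERO base ?u] by simp
    show ?case unfolding ex using IH Suc.prems(2) by (auto simp: lessThan_Suc)
  qed
  then show "a \<notin> {PTR} \<union> {..base} \<Longrightarrow> exec (delete_prog base i) t a = t a"
    and "exec (delete_prog base i) t (base - int j) = (if j \<in> d ` {..<i} then 0 else t (base - int j))"
    by simp_all
qed

definition survives :: "nat \<Rightarrow> nat \<Rightarrow> (nat \<Rightarrow> nat) \<Rightarrow> bool" where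
  "survives k K d \<longleftrightarrow> (\<exists>j<dim_col A.
     0 < (sweep_here 0 ^^ (dim_col A * K)) (\<lambda>j. if j \<in> {..<dim_col A} - d ` {..<k} then int K else 0) j)"

lemma core_prog_correct:
  assumes t: "loaded t" "t BOUNDS = int K" "K \<le> B" "\<And>i. i < k \<Longrightarrow> t (deletion_reg i) = int (d i)"
  shows "achieves (core_prog k) t (core_time k b B) ({- 39..- 24} \<union> {RESULT} \<union> {..- 40 - int k})
    (\<lambda>u. u RESULT = (if survives k K d then t RESULT else 1))"
proof -
  let ?base = "- 40 - int k"
  let ?M = "{- 39..- 24} \<union> {RESULT} \<union> {..?base}"
  let ?Q = "\<lambda>u :: memory. u RESULT = (if survives k K d then t RESULT else 1)"
  let ?v = "\<lambda>j. if j \<in> {..<dim_col A} - d ` {..<k} then int K else 0"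
  have base: "?base \<le> - 40" by simp
  show ?thesis
    unfolding core_prog_def Let_def
  proof (rule achieves_Seq)
    show "achieves (For COL 1 (write_cell ?base COL BOUNDS)) t (5 * b + 2) ({PTR, COL} \<union> {..?base})
        (stores ?base (\<lambda>_. int K))"
      by (rule init_correct[OF t(1,2) base])
    fix u assume u: "\<And>a. a \<notin> {PTR, COL} \<union> {..?base} \<Longrightarrow> u a = t a" "stores ?base (\<lambda>_. int K) u"
    have lu: "loaded u"
      by (rule loaded_frame[where M = "{PTR, COL} \<union> {..?base}", OF t(1) u(1)]) auto
    have dreg: "?base < deletion_reg i" if "i < k" for i using that by (simp add: deletion_reg_def)
    have du: "u (deletion_reg i) = int (d i)" if "i < k" for i
      using u(1)[of "deletion_reg i"] t(4)[OF that] dreg[OF that] by (simp add: deletion_reg_def)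
    note del = delete_prog_exec[OF loadedD(4)[OF lu] base du dreg]
    show "achieves (Seq (delete_prog ?base k) (Seq (rounds_prog ?base) (verdict_prog ?base))) u
        (3 * k + 1 + (rounds_time b B + (7 * b + 5))) ?M ?Q"
    proof (rule achieves_Seq)
      show "achieves (delete_prog ?base k) u (3 * k + 1) ({PTR} \<union> {..?base}) (stores ?base ?v)"
      proof (rule achieves_exec)
        show "stores ?base ?v (exec (delete_prog ?base k) u)"
          unfolding stores_def
        proof (intro allI impI)
          fix j assume "j < dim_col A"
          then show "exec (delete_prog ?base k) u (?base - int j) = ?v j"
            using del(4)[of k j] storesD[OF u(2)] by simp
        qed
        show "exec (delete_prog ?base k) u a = u a" if "a \<notin> {PTR} \<union> {..?base}" for a
          using del(3)[of k a] that by simp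
      qed (use del(1,2)[of k] in simp_all)
      fix x assume x: "\<And>a. a \<notin> {PTR} \<union> {..?base} \<Longrightarrow> x a = u a" "stores ?base ?v x"
      have lx: "loaded x" by (rule loaded_frame[where M = "{PTR} \<union> {..?base}", OF lu x(1)]) auto
      have Kx: "x BOUNDS = int K" using x(1)[of BOUNDS] u(1)[of BOUNDS] t(2) by simp
      let ?w = "(sweep_here 0 ^^ (dim_col A * K)) ?v"
      show "achieves (Seq (rounds_prog ?base) (verdict_prog ?base)) x (rounds_time b B + (7 * b + 5)) ?M ?Q"
      proof (rule achieves_Seq)
        show "achieves (rounds_prog ?base) x (rounds_time b B) ({- 39..- 25} \<union> {..?base}) (stores ?base ?w)"
          by (rule rounds_prog_correct[OF lx x(2) base Kx t(3)])
        fix y assume y: "\<And>a. a \<notin> {- 39..- 25} \<union> {..?base} \<Longrightarrow> y a = x a" "stores ?base ?w y"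
        have ly: "loaded y"
          by (rule loaded_frame[where M = "{- 39..- 25} \<union> {..?base}", OF lx y(1)]) auto
        have "y RESULT = t RESULT" using y(1)[of RESULT] x(1)[of RESULT] u(1)[of RESULT] by simp
        then show "achieves (verdict_prog ?base) y (7 * b + 5) {- 28, - 27, - 24, RESULT} ?Q"
          using verdict_prog_correct[OF ly y(2) base] unfolding survives_def by (simp only:)
      qed auto
    qed auto
  qed (auto simp: core_time_def)
qed

text \<open>The first \<open>i\<close> deletions are still free, those from \<open>i\<close> on are fixed by \<open>d\<close>: this is what the innermost \<open>i\<close> loops
search through.\<close>

definition some_deletion_kills :: "nat \<Rightarrow> nat \<Rightarrow> nat \<Rightarrow> (nat \<Rightarrow> nat) \<Rightarrow> bool" where
  "some_deletion_kills k K i d \<longleftrightarrow>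
     (\<exists>d'. (\<forall>i'<i. d' i' < dim_col A) \<and> (\<forall>i'\<ge>i. d' i' = d i') \<and> \<not> survives k K d')"

lemma some_deletion_kills_0: "some_deletion_kills k K 0 d \<longleftrightarrow> \<not> survives k K d"
proof -
  have "d' = d" if "\<forall>i'\<ge>0. d' i' = d i'" for d' using that by auto
  then show ?thesis unfolding some_deletion_kills_def by auto
qed

lemma some_deletion_kills_Suc:
  "some_deletion_kills k K (Suc i) d \<longleftrightarrow> (\<exists>x. 0 \<le> x \<and> x < dim_col A \<and> some_deletion_kills k K i (d(i := x)))"
proof
  assume "some_deletion_kills k K (Suc i) d"
  then obtain d' where d': "\<forall>i'<Suc i. d' i' < dim_col A" "\<forall>i'\<ge>Suc i. d' i' = d i'" "\<not> survives k K d'"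
    by (auto simp: some_deletion_kills_def)
  then show "\<exists>x. 0 \<le> x \<and> x < dim_col A \<and> some_deletion_kills k K i (d(i := x))"
    unfolding some_deletion_kills_def
    by (intro exI[of _ "d' i"] conjI exI[of _ d']) auto
next
  assume "\<exists>x. 0 \<le> x \<and> x < dim_col A \<and> some_deletion_kills k K i (d(i := x))"
  then obtain x d' where d': "x < dim_col A" "\<forall>i'<i. d' i' < dim_col A" "\<forall>i'\<ge>i. d' i' = (d(i := x)) i'"
    "\<not> survives k K d'" by (auto simp: some_deletion_kills_def)
  then have "\<forall>i'<Suc i. d' i' < dim_col A" by (auto simp: less_Suc_eq)
  moreover have "\<forall>i'\<ge>Suc i. d' i' = d i'" using d'(3) by auto
  ultimately show "some_deletion_kills k K (Suc i) d" using d'(4) by (auto simp: some_deletion_kills_def)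
qed

lemma not_deletion_reg: "- 40 < a \<Longrightarrow> a \<notin> deletion_reg ` X"
  by (auto simp: deletion_reg_def)

lemma enumerate_prog_correct:
  assumes "i \<le> k" "loaded t" "t BOUNDS = int K" "K \<le> B"
    and "\<And>i'. i \<le> i' \<Longrightarrow> i' < k \<Longrightarrow> t (deletion_reg i') = int (d i')"
  shows "achieves (enumerate_prog k i) t (enumerate_time k b B i)
    ({- 39..- 24} \<union> {RESULT} \<union> {..- 40 - int k} \<union> deletion_reg ` {..<i})
    (\<lambda>u. u RESULT = (if some_deletion_kills k K i d then 1 else t RESULT))"
  using assms
proof (induction i arbitrary: t d)
  case 0
  have "achieves (core_prog k) t (core_time k b B) ({- 39..- 24} \<union> {RESULT} \<union> {..- 40 - int k})
    (\<lambda>u. u RESULT = (if survives k K d then t RESULT else 1))"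
    by (rule core_prog_correct) (use 0 in auto)
  then show ?case
    unfolding enumerate_prog.simps enumerate_time.simps some_deletion_kills_0
    by (rule achieves_weaken) auto
next
  case (Suc i)
  let ?M = "\<lambda>i. {- 39..- 24} \<union> {RESULT} \<union> {..- 40 - int k} \<union> deletion_reg ` {..<i}"
  let ?I = "\<lambda>r u. u RESULT = (if \<exists>x. r \<le> x \<and> x < dim_col A \<and> some_deletion_kills k K i (d(i := x)) then 1 else t RESULT)"
  have regM: "deletion_reg i' \<in> ?M (Suc i) \<longleftrightarrow> i' < Suc i" if "i' < k" for i'
    using that by (auto simp: deletion_reg_def)
  have regM': "deletion_reg i \<notin> ?M i"
    using Suc.prems(1) by (auto simp: deletion_reg_def)
  have "achieves (For (deletion_reg i) 1 (enumerate_prog k i)) t (enumerate_time k b B (Suc i)) (?M (Suc i)) (?I 0)"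
  proof (rule achieves_For[where N = "dim_col A" and B = b and M' = "?M i" and T = "enumerate_time k b B i" and I = ?I])
    show "deletion_reg i \<notin> ?M i" by (rule regM')
    show "insert (deletion_reg i) (?M i) \<subseteq> ?M (Suc i)" by (auto simp: lessThan_Suc)
    show "ONE \<notin> ?M (Suc i)" "ZERO \<notin> ?M (Suc i)" by (auto simp: deletion_reg_def)
    show "?I r (u(deletion_reg i := x))" if "?I r u" for r u x using that by (simp add: deletion_reg_def)
    fix r u assume r: "r < dim_col A" and u: "\<And>a. a \<notin> ?M (Suc i) \<Longrightarrow> u a = t a"
      "u (deletion_reg i) = int r" "?I (Suc r) u"
    have lu: "loaded u"
      by (rule loaded_frame[where M = "?M (Suc i)", OF Suc.prems(2) u(1)]) (auto simp: deletion_reg_def)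
    have Ku: "u BOUNDS = int K" using u(1)[of BOUNDS] Suc.prems(3) not_deletion_reg[of BOUNDS] by simp
    have du: "u (deletion_reg i') = int ((d(i := r)) i')" if i': "i \<le> i'" "i' < k" for i'
    proof (cases "i' = i")
      case False
      then have "u (deletion_reg i') = t (deletion_reg i')" using u(1) regM[OF i'(2)] i' by simp
      then show ?thesis using Suc.prems(5)[of i'] i' False by simp
    qed (simp add: u(2))
    have "achieves (enumerate_prog k i) u (enumerate_time k b B i) (?M i)
        (\<lambda>x. x RESULT = (if some_deletion_kills k K i (d(i := r)) then 1 else u RESULT))"
      by (rule Suc.IH[OF _ lu Ku Suc.prems(4) du]) (use Suc.prems(1) in simp_all)
    then show "achieves (enumerate_prog k i) u (enumerate_time k b B i) (?M i) (?I r)"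
      unfolding u(3) if_or ex_from_split[OF r] .
  qed (use loadedD[OF Suc.prems(2)] dims in auto)
  then show ?case by (simp add: some_deletion_kills_Suc)
qed

definition total_weight :: int where
  "total_weight = (\<Sum>i<dim_row A. \<Sum>l<dim_col A. \<bar>entry_value i l\<bar>)"

lemma bound_prog_correct:
  assumes t: "loaded t"
  shows "achieves bound_prog t (bound_time b) ({- 39..- 27} \<union> {BOUNDS})
    (\<lambda>u. u BOUNDS = 1 + int (dim_col A) * (2 * total_weight))"
  unfolding bound_prog_def
proof (rule achieves_Seq)
  let ?add = "If VAL (Seq (Add BOUNDS BOUNDS VAL) (Add BOUNDS BOUNDS VAL)) (Seq (Sub BOUNDS BOUNDS VAL) (Sub BOUNDS BOUNDS VAL))"
  let ?row = "For OTHER 1 (Seq (fetch ROW OTHER) ?add)"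
  show "achieves (Const BOUNDS 1) t 1 {BOUNDS} (\<lambda>u. u BOUNDS = 1)" by (rule achieves_exec) auto
  fix u assume u: "\<And>a. a \<notin> {BOUNDS} \<Longrightarrow> u a = t a" "u BOUNDS = 1"
  have lu: "loaded u" by (rule loaded_frame[where M = "{BOUNDS}", OF t(1) u(1)]) auto
  let ?I = "\<lambda>r x. x BOUNDS = 1 + int (dim_col A - r) * (2 * total_weight)"
  have "achieves (For COL 1 (For ROW 0 ?row)) u (b * (b * (b * (3 * b + 15) + 4) + 4) + 2)
      ({- 39..- 27} \<union> {BOUNDS}) (?I 0)"
  proof (rule achieves_For[where N = "dim_col A" and B = b and M' = "{- 39..- 36} \<union> {OTHER, ROW, BOUNDS}"
        and T = "b * (b * (3 * b + 15) + 4) + 2" and I = ?I])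
    fix r x assume r: "r < dim_col A" and x: "\<And>a. a \<notin> {- 39..- 27} \<union> {BOUNDS} \<Longrightarrow> x a = u a"
      "x COL = int r" "?I (Suc r) x"
    have lx: "loaded x" by (rule loaded_frame[where M = "{- 39..- 27} \<union> {BOUNDS}", OF lu x(1)]) auto
    let ?J = "\<lambda>i y. y BOUNDS = x BOUNDS + 2 * (\<Sum>i'\<in>{i..<dim_row A}. \<Sum>l<dim_col A. \<bar>entry_value i' l\<bar>)"
    have "achieves (For ROW 0 ?row) x (b * (b * (3 * b + 15) + 4) + 2) ({- 39..- 36} \<union> {OTHER, ROW, BOUNDS}) (?J 0)"
    proof (rule achieves_For[where N = "dim_row A" and B = b and M' = "{- 39..- 36} \<union> {OTHER, BOUNDS}"
          and T = "b * (3 * b + 15) + 2" and I = ?J])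
      fix i y assume i: "i < dim_row A" and y: "\<And>a. a \<notin> {- 39..- 36} \<union> {OTHER, ROW, BOUNDS} \<Longrightarrow> y a = x a"
        "y ROW = int i" "?J (Suc i) y"
      have ly: "loaded y"
        by (rule loaded_frame[where M = "{- 39..- 36} \<union> {OTHER, ROW, BOUNDS}", OF lx y(1)]) auto
      let ?L = "\<lambda>l z. z BOUNDS = y BOUNDS + 2 * (\<Sum>l'\<in>{l..<dim_col A}. \<bar>entry_value i l'\<bar>)"
      have "achieves ?row y (b * (3 * b + 15) + 2) ({- 39..- 36} \<union> {OTHER, BOUNDS}) (?L 0)"
      proof (rule achieves_For[where N = "dim_col A" and B = b and M' = "{- 39..- 36} \<union> {BOUNDS}"
            and T = "3 * b + 13" and I = ?L])
        fix l z assume l: "l < dim_col A" and z: "\<And>a. a \<notin> {- 39..- 36} \<union> {OTHER, BOUNDS} \<Longrightarrow> z a = y a"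
          "z OTHER = int l" "?L (Suc l) z"
        have lz: "loaded z"
          by (rule loaded_frame[where M = "{- 39..- 36} \<union> {OTHER, BOUNDS}", OF ly z(1)]) auto
        have rz: "z ROW = int i" using z(1) y(2) by simp
        have split: "(\<Sum>l'\<in>{l..<dim_col A}. \<bar>entry_value i l'\<bar>) =
            \<bar>entry_value i l\<bar> + (\<Sum>l'\<in>{Suc l..<dim_col A}. \<bar>entry_value i l'\<bar>)"
          by (rule sum.atLeast_Suc_lessThan[OF l])
        show "achieves (Seq (fetch ROW OTHER) ?add) z (3 * b + 13) ({- 39..- 36} \<union> {BOUNDS}) (?L l)"
        proof (rule achieves_Seq)
          show "achieves (fetch ROW OTHER) z (3 * b + 10) {- 39..- 36}
              (\<lambda>u. u FLAG = (if A $$ (i, l) = -\<infinity> then 0 else 1) \<and> u VAL = entry_value i l)"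
            by (rule fetch_correct[OF lz rz z(2) i l]) auto
          fix q assume q: "\<And>a. a \<notin> {- 39..- 36} \<Longrightarrow> q a = z a"
            "q FLAG = (if A $$ (i, l) = -\<infinity> then 0 else 1) \<and> q VAL = entry_value i l"
          have "q BOUNDS = z BOUNDS" using q(1) by simp
          then show "achieves ?add q 3 {BOUNDS} (?L l)"
            by (intro achieves_exec) (use q(2) z(3) split in auto)
        qed auto
      qed (use loadedD[OF ly] dims in \<open>auto simp: distrib_left\<close>)
      moreover have "(\<Sum>i'\<in>{i..<dim_row A}. \<Sum>l<dim_col A. \<bar>entry_value i' l\<bar>) =
          (\<Sum>l<dim_col A. \<bar>entry_value i l\<bar>) + (\<Sum>i'\<in>{Suc i..<dim_row A}. \<Sum>l<dim_col A. \<bar>entry_value i' l\<bar>)"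
        by (rule sum.atLeast_Suc_lessThan[OF i])
      ultimately show "achieves ?row y (b * (3 * b + 15) + 2) ({- 39..- 36} \<union> {OTHER, BOUNDS}) (?J i)"
        using y(3) by (elim achieves_weaken) (auto simp: atLeast0LessThan)
    qed (use loadedD[OF lx] dims in \<open>auto simp: distrib_left\<close>)
    moreover have "int (dim_col A - r) = int (dim_col A - Suc r) + 1" using r by auto
    ultimately show "achieves (For ROW 0 ?row) x (b * (b * (3 * b + 15) + 4) + 2) ({- 39..- 36} \<union> {OTHER, ROW, BOUNDS}) (?I r)"
      using x(3) by (elim achieves_weaken) (auto simp: atLeast0LessThan total_weight_def algebra_simps)
  qed (use loadedD[OF lu] dims u(2) in \<open>auto simp: distrib_left\<close>)
  then show "achieves (For COL 1 (For ROW 0 ?row)) u (b * (b * (b * (3 * b + 15) + 4) + 4) + 2)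
      ({- 39..- 27} \<union> {BOUNDS}) (\<lambda>u. u BOUNDS = 1 + int (dim_col A) * (2 * total_weight))"
    by simp
qed (auto simp: bound_time_def)

definition descent_height :: nat where
  "descent_height = nat (1 + int (dim_col A) * (2 * total_weight))"

lemma total_weight_nonneg: "0 \<le> total_weight"
  unfolding total_weight_def by (intro sum_nonneg) simp

lemma rank_prog_correct:
  assumes "descent_height \<le> B"
  shows "achieves (rank_prog k) (encode_mat A) (bound_time b + enumerate_time k b B k + 2) UNIV
    (\<lambda>u. u 0 = (if some_deletion_kills k descent_height k (\<lambda>_. 0) then 1 else 0))"
  unfolding rank_prog_def
proof (rule achieves_Seq)
  show "achieves (Const ONE 1) (encode_mat A) 1 {ONE} (\<lambda>t. t ONE = 1)" by (rule achieves_exec) auto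
  fix t assume t: "\<And>a. a \<notin> {ONE} \<Longrightarrow> t a = encode_mat A a" "t ONE = 1"
  have "encode_mat A a = 0" if "a < 0" for a using that by (simp add: encode_mat_def)
  then have lt: "loaded t" "t RESULT = 0" using t by (auto simp: loaded_def)
  show "achieves (Seq bound_prog (Seq (enumerate_prog k k) (Add 0 RESULT ZERO))) t
      (bound_time b + (enumerate_time k b B k + 1)) UNIV
      (\<lambda>u. u 0 = (if some_deletion_kills k descent_height k (\<lambda>_. 0) then 1 else 0))"
  proof (rule achieves_Seq)
    show "achieves bound_prog t (bound_time b) ({- 39..- 27} \<union> {BOUNDS})
        (\<lambda>u. u BOUNDS = 1 + int (dim_col A) * (2 * total_weight))"
      by (rule bound_prog_correct[OF lt(1)])
    fix u assume u: "\<And>a. a \<notin> {- 39..- 27} \<union> {BOUNDS} \<Longrightarrow> u a = t a"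
      "u BOUNDS = 1 + int (dim_col A) * (2 * total_weight)"
    have lu: "loaded u" by (rule loaded_frame[where M = "{- 39..- 27} \<union> {BOUNDS}", OF lt(1) u(1)]) auto
    have Ku: "u BOUNDS = int descent_height" using u(2) total_weight_nonneg by (simp add: descent_height_def)
    have ru: "u RESULT = 0" using u(1) lt(2) by simp
    let ?M = "{- 39..- 24} \<union> {RESULT} \<union> {..- 40 - int k} \<union> deletion_reg ` {..<k}"
    show "achieves (Seq (enumerate_prog k k) (Add 0 RESULT ZERO)) u (enumerate_time k b B k + 1) UNIV
        (\<lambda>u. u 0 = (if some_deletion_kills k descent_height k (\<lambda>_. 0) then 1 else 0))"
    proof (rule achieves_Seq)
      show "achieves (enumerate_prog k k) u (enumerate_time k b B k) ?M
          (\<lambda>x. x RESULT = (if some_deletion_kills k descent_height k (\<lambda>_. 0) then 1 else u RESULT))"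
        by (rule enumerate_prog_correct[OF order_refl lu Ku assms]) simp
      fix x assume x: "\<And>a. a \<notin> ?M \<Longrightarrow> x a = u a"
        "x RESULT = (if some_deletion_kills k descent_height k (\<lambda>_. 0) then 1 else u RESULT)"
      have "x ZERO = 0" using x(1)[of ZERO] loadedD(4)[OF lu] not_deletion_reg[of ZERO] by simp
      then show "achieves (Add 0 RESULT ZERO) x 1 {0}
          (\<lambda>u. u 0 = (if some_deletion_kills k descent_height k (\<lambda>_. 0) then 1 else 0))"
        by (intro achieves_exec) (use x(2) ru in auto)
    qed auto
  qed auto
qed auto

lemma some_deletion_kills_iff:
  assumes int: "int_trop_mat A" and k: "k \<le> dim_col A"
  shows "some_deletion_kills k descent_height k (\<lambda>_. 0) \<longleftrightarrow> dim_col A - k \<le> trop_rank A"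
proof -
  have trop: "trop_mat A" using int by (force simp: int_trop_mat_def trop_mat_def)
  have entry: "A $$ (i, j) = ereal (of_int (entry_value i j))"
    if ij: "i < dim_row A" "j < dim_col A" "A $$ (i, j) \<noteq> -\<infinity>" for i j
  proof -
    have "A $$ (i, j) \<in> elements_mat A"
      using ij by (intro elements_matI[of A "dim_row A" "dim_col A" i j]) auto
    then obtain z :: int where "A $$ (i, j) = ereal (of_int z)"
      using int ij(3) by (auto simp: int_trop_mat_def)
    then show ?thesis by (simp add: entry_value_def)
  qed
  have weight: "\<bar>entry_value i j\<bar> \<le> total_weight" if "i < dim_row A" "j < dim_col A" for i j
  proof -
    have "\<bar>entry_value i j\<bar> \<le> (\<Sum>l<dim_col A. \<bar>entry_value i l\<bar>)"
      using that by (intro member_le_sum) auto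
    also have "\<dots> \<le> total_weight"
      unfolding total_weight_def using that
      by (intro member_le_sum[where f = "\<lambda>i. \<Sum>l<dim_col A. \<bar>entry_value i l\<bar>"]) (auto intro: sum_nonneg)
    finally show ?thesis .
  qed
  have height: "int descent_height = 1 + int (dim_col A) * (2 * total_weight)"
    using total_weight_nonneg by (simp add: descent_height_def)
  have surv: "survives k descent_height d \<longleftrightarrow> mat_dependent A ({..<dim_col A} - d ` {..<k})" for d
    unfolding survives_def
    by (rule descent_decides_dependence[where W = total_weight])
       (use entry weight total_weight_nonneg height in \<open>auto simp: algebra_simps\<close>)
  have "some_deletion_kills k descent_height k (\<lambda>_. 0) \<longleftrightarrow>
      (\<exists>d. (\<forall>i<k. d i < dim_col A) \<and> \<not> mat_dependent A ({..<dim_col A} - d ` {..<k}))"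
  proof
    assume "some_deletion_kills k descent_height k (\<lambda>_. 0)"
    then show "\<exists>d. (\<forall>i<k. d i < dim_col A) \<and> \<not> mat_dependent A ({..<dim_col A} - d ` {..<k})"
      by (auto simp: some_deletion_kills_def surv)
  next
    assume "\<exists>d. (\<forall>i<k. d i < dim_col A) \<and> \<not> mat_dependent A ({..<dim_col A} - d ` {..<k})"
    then obtain d where d: "\<forall>i<k. d i < dim_col A" "\<not> mat_dependent A ({..<dim_col A} - d ` {..<k})" by blast
    define d' where "d' i = (if i < k then d i else 0)" for i
    have "d' ` {..<k} = d ` {..<k}" by (auto simp: d'_def)
    then show "some_deletion_kills k descent_height k (\<lambda>_. 0)"
      unfolding some_deletion_kills_def surv using d by (intro exI[of _ d']) (auto simp: d'_def)
  qed
  also have "\<dots> \<longleftrightarrow> (\<exists>J. J \<subseteq> {..<dim_col A} \<and> card J = dim_col A - k \<and> \<not> mat_dependent A J)"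
    by (rule exists_deletion_iff[OF k, symmetric])
  also have "\<dots> \<longleftrightarrow> dim_col A - k \<le> trop_rank A"
    by (rule trop_rank_ge_iff[OF trop, symmetric])
  finally show ?thesis .
qed

lemma descent_height_le:
  assumes int: "int_trop_mat A" and max: "max_abs_entry A \<le> b"
  shows "descent_height \<le> 1 + b * (2 * (b * (b * b)))"
proof -
  have entry: "\<bar>entry_value i j\<bar> \<le> int b" if "i < dim_row A" "j < dim_col A" for i j
  proof -
    have el: "A $$ (i, j) \<in> elements_mat A"
      using that by (intro elements_matI[of A "dim_row A" "dim_col A" i j]) auto
    then consider "A $$ (i, j) = -\<infinity>" | z :: int where "A $$ (i, j) = ereal (of_int z)"
      using int by (auto simp: int_trop_mat_def)
    then show ?thesis
    proof cases
      case 1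
      then show ?thesis by (simp add: entry_value_def)
    next
      case 2
      have "elements_mat A = (\<lambda>(i, j). A $$ (i, j)) ` ({..<dim_row A} \<times> {..<dim_col A})"
        by (force simp: elements_mat_def)
      then have "finite (elements_mat A)" by simp
      then have "nat \<lfloor>\<bar>real_of_ereal (A $$ (i, j))\<bar>\<rfloor> \<le> max_abs_entry A"
        unfolding max_abs_entry_def using el by (intro Max_ge) auto
      moreover have "\<bar>real_of_int z\<bar> = real_of_int \<bar>z\<bar>" by simp
      ultimately have "nat \<bar>z\<bar> \<le> b" using 2 max by (simp del: of_int_abs)
      then show ?thesis using 2 by (simp add: entry_value_def)
    qed
  qed
  have row: "(\<Sum>l<dim_col A. \<bar>entry_value i l\<bar>) \<le> int (b * b)" if "i < dim_row A" for i
  proof -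
    have "(\<Sum>l<dim_col A. \<bar>entry_value i l\<bar>) \<le> (\<Sum>l<dim_col A. int b)"
      using entry that by (intro sum_mono) auto
    also have "\<dots> = int (dim_col A * b)" by simp
    also have "\<dots> \<le> int (b * b)" using dims by (intro zle_int[THEN iffD2] mult_le_mono1)
    finally show ?thesis .
  qed
  have "total_weight \<le> (\<Sum>i<dim_row A. int (b * b))"
    unfolding total_weight_def using row by (intro sum_mono) auto
  also have "\<dots> = int (dim_row A * (b * b))" by simp
  also have "\<dots> \<le> int (b * (b * b))" using dims by (intro zle_int[THEN iffD2] mult_le_mono1)
  finally have "2 * total_weight \<le> int (2 * (b * (b * b)))" by simp
  then have "int (dim_col A) * (2 * total_weight) \<le> int b * int (2 * (b * (b * b)))"
    using dims by (intro mult_mono) (simp_all add: total_weight_nonneg)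
  then have "1 + int (dim_col A) * (2 * total_weight) \<le> int (1 + b * (2 * (b * (b * b))))" by simp
  then show ?thesis unfolding descent_height_def by (metis nat_int nat_mono)
qed

end

text \<open>The running times are nested expressions in \<open>b\<close>; closure under sums and products produces their polynomials.\<close>

definition polynomially_given :: "(nat \<Rightarrow> nat) \<Rightarrow> bool" where
  "polynomially_given f \<longleftrightarrow> (\<exists>p :: nat poly. \<forall>x. f x = poly p x)"

lemma polynomially_given_const: "polynomially_given (\<lambda>_. c)"
  unfolding polynomially_given_def by (intro exI[of _ "[:c:]"]) simp

lemma polynomially_given_id: "polynomially_given (\<lambda>x. x)"
  unfolding polynomially_given_def by (intro exI[of _ "[:0, 1:]"]) simp

lemma polynomially_given_add:
  "polynomially_given f \<Longrightarrow> polynomially_given g \<Longrightarrow> polynomially_given (\<lambda>x. f x + g x)"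
  unfolding polynomially_given_def by (metis poly_add)

lemma polynomially_given_mult:
  "polynomially_given f \<Longrightarrow> polynomially_given g \<Longrightarrow> polynomially_given (\<lambda>x. f x * g x)"
  unfolding polynomially_given_def by (metis poly_mult)

lemmas polynomially_given_intros =
  polynomially_given_const polynomially_given_id polynomially_given_add polynomially_given_mult

lemma rank_time_polynomial:
  "polynomially_given (\<lambda>b. bound_time b + enumerate_time k b (1 + b * (2 * (b * (b * b)))) k + 2)"
proof -
  have "polynomially_given (\<lambda>b. enumerate_time k b (1 + b * (2 * (b * (b * b)))) i)" for i
  proof (induction i)
    case 0
    show ?case
      unfolding enumerate_time.simps core_time_def rounds_time_def sweep_time_def lower_time_def row_time_def
      by (intro polynomially_given_intros)
  next
    case (Suc i)
    then show ?case unfolding enumerate_time.simps by (intro polynomially_given_intros)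
  qed
  then show ?thesis unfolding bound_time_def by (intro polynomially_given_intros)
qed

theorem rank_pseudo_polynomial:
  "pseudo_poly_time_decidable {A. dim_col A \<le> dim_row A \<and> k \<le> dim_col A}
     (\<lambda>A. dim_col A - k \<le> trop_rank A)"
proof -
  obtain p :: "nat poly" where
    p: "\<And>b. bound_time b + enumerate_time k b (1 + b * (2 * (b * (b * b)))) k + 2 = poly p b"
    using rank_time_polynomial[of k] unfolding polynomially_given_def by metis
  show ?thesis
    unfolding pseudo_poly_time_decidable_def
  proof (intro exI[of _ "rank_prog k"] exI[of _ p] ballI impI)
    fix A :: "ereal mat"
    assume "A \<in> {A. dim_col A \<le> dim_row A \<and> k \<le> dim_col A}" and int: "int_trop_mat A"
    then have k: "k \<le> dim_col A" by simp
    define b where "b = dim_row A + dim_col A + max_abs_entry A"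
    interpret matrix_in_memory A b by unfold_locales (simp_all add: b_def)
    have "descent_height \<le> 1 + b * (2 * (b * (b * b)))"
      by (rule descent_height_le[OF int]) (simp add: b_def)
    from rank_prog_correct[OF this, of k]
    obtain t s where "run (rank_prog k) (encode_mat A) t s" "t \<le> poly p b"
      "s 0 = (if some_deletion_kills k descent_height k (\<lambda>_. 0) then 1 else 0)"
      unfolding p by (rule achievesE)
    then show "\<exists>t s. run (rank_prog k) (encode_mat A) t s \<and>
        t \<le> poly p (dim_row A + dim_col A + max_abs_entry A) \<and>
        s 0 = (if dim_col A - k \<le> trop_rank A then 1 else 0)"
      unfolding some_deletion_kills_iff[OF int k] b_def by blast
  qed
qed

theorem corollary4p17:
  fixes k :: nat
  shows
    "(\<forall>m n (A :: ereal mat). A \<in> carrier_mat m n \<longrightarrow> trop_mat A \<longrightarrow> n \<le> m \<longrightarrow> k \<le> n \<longrightarrow>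
        card {J. J \<subseteq> {..<n} \<and> card J = n - k} = n choose k \<and>
        (\<forall>J. J \<subseteq> {..<n} \<and> card J = n - k \<longrightarrow> submatrix A UNIV J \<in> carrier_mat m (n - k)) \<and>
        (n - k \<le> trop_rank A \<longleftrightarrow>
          (\<exists>J. J \<subseteq> {..<n} \<and> card J = n - k \<and>
             \<not> neg_inf_column (submatrix A UNIV J) \<and>
             \<not> max_has_winning_state (submatrix A UNIV J)))) \<and>
     pseudo_poly_time_decidable {A. dim_col A \<le> dim_row A \<and> k \<le> dim_col A}
       (\<lambda>A. dim_col A - k \<le> trop_rank A)"
proof (intro conjI allI impI)
  fix m n and A :: "ereal mat"
  assume A: "A \<in> carrier_mat m n" "trop_mat A" "n \<le> m" "k \<le> n"
  have "card {J. J \<subseteq> {..<n} \<and> card J = n - k} = n choose (n - k)"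
    by (simp add: n_subsets)
  then show "card {J. J \<subseteq> {..<n} \<and> card J = n - k} = n choose k"
    using A(4) by (simp add: binomial_symmetric[symmetric])
  have dims: "dim_row A = m" "dim_col A = n" using A(1) by auto
  note sub = dim_submatrix_subset[where I = "{}" and A = A, unfolded dims]
  show "submatrix A UNIV J \<in> carrier_mat m (n - k)" if "J \<subseteq> {..<n} \<and> card J = n - k" for J
    using sub(3,6)[of J] that by (intro carrier_matI) simp_all
  have game: "mat_dependent A J \<longleftrightarrow>
      neg_inf_column (submatrix A UNIV J) \<or> max_has_winning_state (submatrix A UNIV J)"
    if J: "J \<subseteq> {..<n}" for J
  proof -
    let ?B = "submatrix A UNIV J"
    have dep: "mat_dependent A J \<longleftrightarrow> mat_dependent ?B {..<dim_col ?B}"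
      using mat_dependent_submatrix(2)[of "{}" A J] sub(6)[of J] J dims by simp
    show ?thesis
      unfolding dep using neg_inf_column_dependent[of ?B]
        winning_iff_dependent[OF trop_mat_submatrix[OF A(2), of UNIV J]] by blast
  qed
  show "n - k \<le> trop_rank A \<longleftrightarrow> (\<exists>J. J \<subseteq> {..<n} \<and> card J = n - k \<and>
      \<not> neg_inf_column (submatrix A UNIV J) \<and> \<not> max_has_winning_state (submatrix A UNIV J))"
    unfolding trop_rank_ge_iff[OF A(2)] dims using game[unfolded dims] by auto
qed (rule rank_pseudo_polynomial)

end
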